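(* Let $P$ be a poset and let $P_0$ be a sieve in $P$. Let $\mathrm{sd}(P)_0\subset\mathrm{sd}(P)$ be the subposet on those strings that originate in $P_0$ (i.e. strings $[a_0<\dots<a_n]$ with $a_0\in P_0$); the restriction of $\max$ to $\mathrm{sd}(P)_0$ is still a locally cocartesian fibration over $P$. Then for every locally cocartesian fibration $C\to P$, the restriction functor $$\mathrm{Fun}^{\mathrm{cocart}}_{/P}(\mathrm{sd}(P)_0,C)\to\mathrm{Fun}^{\mathrm{cocart}}_{/P_0}(\mathrm{sd}(P_0),C|_{P_0})$$ is a trivial fibration (of simplicial sets).
   Context: Posets are identified with (the nerves of) the corresponding categories. A sieve in $P$ is a downward closed subposet. $\mathrm{sd}(P)$ is the barycentric subdivision: the poset whose objects are the finite nonempty strings $[a_0<\dots<a_n]$ in $P$ and whose morphisms are string inclusions. It is regarded as a locally cocartesian fibration over $P$ via $\max:[a_0<\dots<a_n]\mapsto a_n$; the locally cocartesian edge from $[a_0<\dots<a_n]$ over $a_n<b$ is the inclusion into $[a_0<\dots<a_n<b]$. For locally cocartesian fibrations $X,C\to P$, $\mathrm{Fun}^{\mathrm{cocart}}_{/P}(X,C)$ denotes the full subcategory of $\mathrm{Fun}_{/P}(X,C)$ on functors over $P$ that preserve locally cocartesian edges. $C|_{P_0}=C\times_P P_0$. *)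

theory Defs
  imports Main "HOL-Library.FuncSet" "HOL-Library.Sublist"
begin

section \<open>Simplicial sets\<close>

text \<open>
  The ordinal \<open>[n]\<close> is \<open>{..n}\<close>. Morphisms of the simplex category are extensional
  functions, so that equality of morphisms is equality in the logic.
\<close>

definition delta_hom :: "nat \<Rightarrow> nat \<Rightarrow> (nat \<Rightarrow> nat) set" where
  "delta_hom m n = {\<alpha> \<in> {..m} \<rightarrow>\<^sub>E {..n}. mono_on {..m} \<alpha>}"

text \<open>
  \<open>Act X m n \<alpha> : Simp X n \<rightarrow> Simp X m\<close> is the contravariant action of \<open>\<alpha> : [m] \<rightarrow> [n]\<close>.
  Its values outside \<open>Simp X n\<close> carry no meaning.
\<close>

record 'a sset =
  Simp :: "nat \<Rightarrow> 'a set"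
  Act :: "nat \<Rightarrow> nat \<Rightarrow> (nat \<Rightarrow> nat) \<Rightarrow> 'a \<Rightarrow> 'a"

definition simplicial_set :: "'a sset \<Rightarrow> bool" where
  "simplicial_set X \<longleftrightarrow>
     (\<forall>m n. \<forall>\<alpha> \<in> delta_hom m n. Act X m n \<alpha> \<in> Simp X n \<rightarrow> Simp X m) \<and>
     (\<forall>n. \<forall>x \<in> Simp X n. Act X n n (\<lambda>i\<in>{..n}. i) x = x) \<and>
     (\<forall>l m n. \<forall>\<beta> \<in> delta_hom l m. \<forall>\<alpha> \<in> delta_hom m n. \<forall>x \<in> Simp X n.
        Act X l m \<beta> (Act X m n \<alpha> x) = Act X l n (compose {..l} \<alpha> \<beta>) x)"

definition sset_hom :: "'a sset \<Rightarrow> 'b sset \<Rightarrow> (nat \<Rightarrow> 'a \<Rightarrow> 'b) set" where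
  "sset_hom X Y =
     {f. (\<forall>n. f n \<in> Simp X n \<rightarrow>\<^sub>E Simp Y n) \<and>
         (\<forall>m n. \<forall>\<alpha> \<in> delta_hom m n. \<forall>x \<in> Simp X n.
            f m (Act X m n \<alpha> x) = Act Y m n \<alpha> (f n x))}"

definition vertex :: "'a sset \<Rightarrow> nat \<Rightarrow> nat \<Rightarrow> 'a \<Rightarrow> 'a" where
  "vertex X n i x = Act X 0 n (\<lambda>_\<in>{..0}. i) x"

definition std_simplex :: "nat \<Rightarrow> (nat \<Rightarrow> nat) sset" where
  "std_simplex n =
     \<lparr>Simp = \<lambda>m. delta_hom m n, Act = \<lambda>l m \<beta> \<alpha>. compose {..l} \<alpha> \<beta>\<rparr>"

definition boundary :: "nat \<Rightarrow> (nat \<Rightarrow> nat) sset" where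
  "boundary n =
     \<lparr>Simp = \<lambda>m. {\<alpha> \<in> delta_hom m n. \<alpha> ` {..m} \<noteq> {..n}}, Act = Act (std_simplex n)\<rparr>"

definition horn :: "nat \<Rightarrow> nat \<Rightarrow> (nat \<Rightarrow> nat) sset" where
  "horn n k =
     \<lparr>Simp = \<lambda>m. {\<alpha> \<in> delta_hom m n. insert k (\<alpha> ` {..m}) \<noteq> {..n}},
      Act = Act (std_simplex n)\<rparr>"

text \<open>The map \<open>\<Delta>\<^sup>k \<rightarrow> X\<close> classifying \<open>x \<in> Simp X k\<close>.\<close>

definition yoneda :: "'a sset \<Rightarrow> nat \<Rightarrow> 'a \<Rightarrow> nat \<Rightarrow> (nat \<Rightarrow> nat) \<Rightarrow> 'a" where
  "yoneda X k x = (\<lambda>m. \<lambda>\<alpha>\<in>delta_hom m k. Act X m k \<alpha> x)"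

definition sset_prod :: "'a sset \<Rightarrow> 'b sset \<Rightarrow> ('a \<times> 'b) sset" where
  "sset_prod X Y =
     \<lparr>Simp = \<lambda>n. Simp X n \<times> Simp Y n,
      Act = \<lambda>m n \<alpha> z. (Act X m n \<alpha> (fst z), Act Y m n \<alpha> (snd z))\<rparr>"

definition fibre_prod ::
  "'a sset \<Rightarrow> (nat \<Rightarrow> 'a \<Rightarrow> 's) \<Rightarrow> 'b sset \<Rightarrow> (nat \<Rightarrow> 'b \<Rightarrow> 's) \<Rightarrow> ('a \<times> 'b) sset" where
  "fibre_prod X p Y g =
     \<lparr>Simp = \<lambda>n. {z \<in> Simp X n \<times> Simp Y n. p n (fst z) = g n (snd z)},
      Act = Act (sset_prod X Y)\<rparr>"

definition fibre_prod_proj ::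
  "'a sset \<Rightarrow> (nat \<Rightarrow> 'a \<Rightarrow> 's) \<Rightarrow> 'b sset \<Rightarrow> (nat \<Rightarrow> 'b \<Rightarrow> 's) \<Rightarrow> nat \<Rightarrow> 'a \<times> 'b \<Rightarrow> 'b" where
  "fibre_prod_proj X p Y g = (\<lambda>n. \<lambda>z\<in>Simp (fibre_prod X p Y g) n. snd z)"

definition sset_incl :: "'a sset \<Rightarrow> nat \<Rightarrow> 'a \<Rightarrow> 'a" where
  "sset_incl Y = (\<lambda>n. \<lambda>y\<in>Simp Y n. y)"

definition full_subsset :: "'a sset \<Rightarrow> 'a set \<Rightarrow> 'a sset" where
  "full_subsset X V =
     \<lparr>Simp = \<lambda>n. {x \<in> Simp X n. \<forall>i\<le>n. vertex X n i x \<in> V}, Act = Act X\<rparr>"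


section \<open>Fibrations\<close>

text \<open>
  In the next two definitions \<open>A\<close> is a simplicial subset of \<open>B\<close>; the lifting problem is
  the square \<open>u : A \<rightarrow> X\<close>, \<open>v : B \<rightarrow> S\<close> against \<open>p : X \<rightarrow> S\<close>.
\<close>

definition lifting_problem ::
  "'i sset \<Rightarrow> 'i sset \<Rightarrow> 'a sset \<Rightarrow> 's sset \<Rightarrow> (nat \<Rightarrow> 'a \<Rightarrow> 's) \<Rightarrow>
     (nat \<Rightarrow> 'i \<Rightarrow> 'a) \<Rightarrow> (nat \<Rightarrow> 'i \<Rightarrow> 's) \<Rightarrow> bool" where
  "lifting_problem A B X S p u v \<longleftrightarrow>
     u \<in> sset_hom A X \<and> v \<in> sset_hom B S \<and> (\<forall>n. \<forall>a \<in> Simp A n. p n (u n a) = v n a)"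

definition has_solution ::
  "'i sset \<Rightarrow> 'i sset \<Rightarrow> 'a sset \<Rightarrow> 's sset \<Rightarrow> (nat \<Rightarrow> 'a \<Rightarrow> 's) \<Rightarrow>
     (nat \<Rightarrow> 'i \<Rightarrow> 'a) \<Rightarrow> (nat \<Rightarrow> 'i \<Rightarrow> 's) \<Rightarrow> bool" where
  "has_solution A B X S p u v \<longleftrightarrow>
     (\<exists>w \<in> sset_hom B X.
        (\<forall>n. \<forall>a \<in> Simp A n. w n a = u n a) \<and> (\<forall>n. \<forall>b \<in> Simp B n. p n (w n b) = v n b))"

definition trivial_fibration :: "'a sset \<Rightarrow> 's sset \<Rightarrow> (nat \<Rightarrow> 'a \<Rightarrow> 's) \<Rightarrow> bool" where
  "trivial_fibration X S p \<longleftrightarrow>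
     simplicial_set X \<and> simplicial_set S \<and> p \<in> sset_hom X S \<and>
     (\<forall>n u v. lifting_problem (boundary n) (std_simplex n) X S p u v \<longrightarrow>
        has_solution (boundary n) (std_simplex n) X S p u v)"

definition inner_fibration :: "'a sset \<Rightarrow> 's sset \<Rightarrow> (nat \<Rightarrow> 'a \<Rightarrow> 's) \<Rightarrow> bool" where
  "inner_fibration X S p \<longleftrightarrow>
     simplicial_set X \<and> simplicial_set S \<and> p \<in> sset_hom X S \<and>
     (\<forall>n k u v. 0 < k \<and> k < n \<and> lifting_problem (horn n k) (std_simplex n) X S p u v \<longrightarrow>
        has_solution (horn n k) (std_simplex n) X S p u v)"

text \<open>
  The outer horn \<open>\<Lambda>\<^sup>n\<^sub>0\<close> with \<open>n \<ge> 2\<close> contains the edge \<open>\<Delta>\<^bsup>{0,1}\<^esup>\<close>, which is the inclusion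
  \<open>[1] \<rightarrow> [n]\<close>, i.e. the function \<open>\<lambda>i\<in>{..1}. i\<close>; it is required to be sent to \<open>e\<close>.
\<close>

definition cocartesian_edge ::
  "'a sset \<Rightarrow> 's sset \<Rightarrow> (nat \<Rightarrow> 'a \<Rightarrow> 's) \<Rightarrow> 'a \<Rightarrow> bool" where
  "cocartesian_edge X S p e \<longleftrightarrow>
     e \<in> Simp X 1 \<and>
     (\<forall>n u v. 2 \<le> n \<and> lifting_problem (horn n 0) (std_simplex n) X S p u v \<and>
        u 1 (\<lambda>i\<in>{..1}. i) = e \<longrightarrow>
        has_solution (horn n 0) (std_simplex n) X S p u v)"

definition cocartesian_fibration :: "'a sset \<Rightarrow> 's sset \<Rightarrow> (nat \<Rightarrow> 'a \<Rightarrow> 's) \<Rightarrow> bool" where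
  "cocartesian_fibration X S p \<longleftrightarrow>
     inner_fibration X S p \<and>
     (\<forall>s \<in> Simp S 1. \<forall>x \<in> Simp X 0. p 0 x = vertex S 1 0 s \<longrightarrow>
        (\<exists>e. cocartesian_edge X S p e \<and> vertex X 1 0 e = x \<and> p 1 e = s))"

definition edge_pullback ::
  "'a sset \<Rightarrow> 's sset \<Rightarrow> (nat \<Rightarrow> 'a \<Rightarrow> 's) \<Rightarrow> 's \<Rightarrow> ('a \<times> (nat \<Rightarrow> nat)) sset" where
  "edge_pullback X S p s = fibre_prod X p (std_simplex 1) (yoneda S 1 s)"

definition edge_pullback_proj ::
  "'a sset \<Rightarrow> 's sset \<Rightarrow> (nat \<Rightarrow> 'a \<Rightarrow> 's) \<Rightarrow> 's \<Rightarrow>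
     nat \<Rightarrow> 'a \<times> (nat \<Rightarrow> nat) \<Rightarrow> (nat \<Rightarrow> nat)" where
  "edge_pullback_proj X S p s = fibre_prod_proj X p (std_simplex 1) (yoneda S 1 s)"

text \<open>
  An edge \<open>e\<close> of \<open>X\<close> lifts to the edge \<open>(e, id)\<close> of the pullback of \<open>X\<close> along the map
  \<open>\<Delta>\<^sup>1 \<rightarrow> S\<close> classifying \<open>p e\<close>.
\<close>

definition locally_cocartesian_edge ::
  "'a sset \<Rightarrow> 's sset \<Rightarrow> (nat \<Rightarrow> 'a \<Rightarrow> 's) \<Rightarrow> 'a \<Rightarrow> bool" where
  "locally_cocartesian_edge X S p e \<longleftrightarrow>
     e \<in> Simp X 1 \<and>
     cocartesian_edge (edge_pullback X S p (p 1 e)) (std_simplex 1)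
       (edge_pullback_proj X S p (p 1 e)) (e, \<lambda>i\<in>{..1}. i)"

definition locally_cocartesian_fibration ::
  "'a sset \<Rightarrow> 's sset \<Rightarrow> (nat \<Rightarrow> 'a \<Rightarrow> 's) \<Rightarrow> bool" where
  "locally_cocartesian_fibration X S p \<longleftrightarrow>
     inner_fibration X S p \<and>
     (\<forall>s \<in> Simp S 1. cocartesian_fibration (edge_pullback X S p s) (std_simplex 1)
        (edge_pullback_proj X S p s))"


section \<open>Functors over a base\<close>

definition Fun_over ::
  "'a sset \<Rightarrow> (nat \<Rightarrow> 'a \<Rightarrow> 's) \<Rightarrow> 'c sset \<Rightarrow> (nat \<Rightarrow> 'c \<Rightarrow> 's) \<Rightarrow>
     (nat \<Rightarrow> 'a \<times> (nat \<Rightarrow> nat) \<Rightarrow> 'c) sset" where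
  "Fun_over X p C q =
     \<lparr>Simp = \<lambda>n. {F \<in> sset_hom (sset_prod X (std_simplex n)) C.
                    \<forall>k. \<forall>x \<in> Simp X k. \<forall>\<alpha> \<in> delta_hom k n. q k (F k (x, \<alpha>)) = p k x},
      Act = \<lambda>m n \<theta> F k. \<lambda>z\<in>Simp (sset_prod X (std_simplex m)) k.
                F k (fst z, compose {..k} \<theta> (snd z))\<rparr>"

text \<open>
  A vertex of \<open>Fun_over X p C q\<close> is a map \<open>X \<times> \<Delta>\<^sup>0 \<rightarrow> C\<close>; the degenerate edge
  of \<open>\<Delta>\<^sup>0\<close> is \<open>\<lambda>_\<in>{..1}. 0\<close>.
\<close>

definition preserves_locally_cocartesian ::
  "'s sset \<Rightarrow> 'a sset \<Rightarrow> (nat \<Rightarrow> 'a \<Rightarrow> 's) \<Rightarrow> 'c sset \<Rightarrow> (nat \<Rightarrow> 'c \<Rightarrow> 's) \<Rightarrow>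
     (nat \<Rightarrow> 'a \<times> (nat \<Rightarrow> nat) \<Rightarrow> 'c) \<Rightarrow> bool" where
  "preserves_locally_cocartesian S X p C q F \<longleftrightarrow>
     (\<forall>e. locally_cocartesian_edge X S p e \<longrightarrow>
        locally_cocartesian_edge C S q (F 1 (e, \<lambda>_\<in>{..1}. 0)))"

definition Fun_cocart ::
  "'s sset \<Rightarrow> 'a sset \<Rightarrow> (nat \<Rightarrow> 'a \<Rightarrow> 's) \<Rightarrow> 'c sset \<Rightarrow> (nat \<Rightarrow> 'c \<Rightarrow> 's) \<Rightarrow>
     (nat \<Rightarrow> 'a \<times> (nat \<Rightarrow> nat) \<Rightarrow> 'c) sset" where
  "Fun_cocart S X p C q =
     full_subsset (Fun_over X p C q)
       {F \<in> Simp (Fun_over X p C q) 0. preserves_locally_cocartesian S X p C q F}"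


section \<open>Posets, strings and subdivision\<close>

text \<open>
  A poset is a carrier set together with a relation \<open>r\<close>, where \<open>(a, b) \<in> r\<close> means
  \<open>a \<le> b\<close>. The nerve of \<open>A\<close> only depends on the restriction of \<open>r\<close> to \<open>A\<close>, so subposets
  are given by shrinking \<open>A\<close> alone.
\<close>

definition nerve :: "'p set \<Rightarrow> 'p rel \<Rightarrow> (nat \<Rightarrow> 'p) sset" where
  "nerve A r =
     \<lparr>Simp = \<lambda>n. {\<sigma> \<in> {..n} \<rightarrow>\<^sub>E A. \<forall>i j. i \<le> j \<and> j \<le> n \<longrightarrow> (\<sigma> i, \<sigma> j) \<in> r},
      Act = \<lambda>m n \<alpha> \<sigma>. compose {..m} \<sigma> \<alpha>\<rparr>"

definition nerve_map :: "'p set \<Rightarrow> 'p rel \<Rightarrow> ('p \<Rightarrow> 'q) \<Rightarrow> nat \<Rightarrow> (nat \<Rightarrow> 'p) \<Rightarrow> (nat \<Rightarrow> 'q)" where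
  "nerve_map A r f = (\<lambda>n. \<lambda>\<sigma>\<in>Simp (nerve A r) n. compose {..n} f \<sigma>)"

definition sieve :: "'p set \<Rightarrow> 'p rel \<Rightarrow> 'p set \<Rightarrow> bool" where
  "sieve P r P0 \<longleftrightarrow> P0 \<subseteq> P \<and> (\<forall>b \<in> P0. \<forall>a \<in> P. (a, b) \<in> r \<longrightarrow> a \<in> P0)"

definition strings :: "'p set \<Rightarrow> 'p rel \<Rightarrow> 'p list set" where
  "strings P r = {s. s \<noteq> [] \<and> set s \<subseteq> P \<and> sorted_wrt (\<lambda>a b. (a, b) \<in> r \<and> a \<noteq> b) s}"

definition strings_from :: "'p set \<Rightarrow> 'p rel \<Rightarrow> 'p set \<Rightarrow> 'p list set" where
  "strings_from P r P0 = {s \<in> strings P r. hd s \<in> P0}"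

definition string_incl :: "'p list rel" where
  "string_incl = {(s, t). subseq s t}"

text \<open>
  For a set \<open>A\<close> of strings, ordered by inclusion, the nerve of \<open>A\<close> and the map
  \<open>max\<close> from it (the maximum of a string is its last entry). The subdivision \<open>sd(P)\<close> is
  the case \<open>A = strings P r\<close>, and \<open>sd(P)\<^sub>0\<close> the case \<open>A = strings_from P r P0\<close>.
\<close>

abbreviation sd :: "'p list set \<Rightarrow> (nat \<Rightarrow> 'p list) sset" where
  "sd A \<equiv> nerve A string_incl"

abbreviation sd_max :: "'p list set \<Rightarrow> nat \<Rightarrow> (nat \<Rightarrow> 'p list) \<Rightarrow> (nat \<Rightarrow> 'p)" where
  "sd_max A \<equiv> nerve_map A string_incl last"


section \<open>The restriction functor\<close>

text \<open>The pullback of \<open>q : C \<rightarrow> S\<close> to a simplicial subset \<open>T\<close> of \<open>S\<close>, and its map to \<open>T\<close>.\<close>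

definition restrict_base ::
  "'c sset \<Rightarrow> (nat \<Rightarrow> 'c \<Rightarrow> 's) \<Rightarrow> 's sset \<Rightarrow> ('c \<times> 's) sset" where
  "restrict_base C q T = fibre_prod C q T (sset_incl T)"

definition restrict_base_proj ::
  "'c sset \<Rightarrow> (nat \<Rightarrow> 'c \<Rightarrow> 's) \<Rightarrow> 's sset \<Rightarrow> nat \<Rightarrow> 'c \<times> 's \<Rightarrow> 's" where
  "restrict_base_proj C q T = fibre_prod_proj C q T (sset_incl T)"

text \<open>
  Let \<open>Y\<close> be a simplicial subset of \<open>X\<close> whose structure map \<open>pY : Y \<rightarrow> T\<close> is the
  restriction of \<open>X \<rightarrow> S\<close>. A map \<open>F : X \<times> \<Delta>\<^sup>n \<rightarrow> C\<close> over \<open>S\<close> restricts to the map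
  \<open>Y \<times> \<Delta>\<^sup>n \<rightarrow> C \<times>\<^sub>S T\<close> whose components are \<open>F\<close> and \<open>pY\<close>. The first argument \<open>D\<close> is the domain
  of the resulting functor.
\<close>

definition restriction_functor ::
  "(nat \<Rightarrow> 'a \<times> (nat \<Rightarrow> nat) \<Rightarrow> 'c) sset \<Rightarrow> 'a sset \<Rightarrow> (nat \<Rightarrow> 'a \<Rightarrow> 's) \<Rightarrow>
     nat \<Rightarrow> (nat \<Rightarrow> 'a \<times> (nat \<Rightarrow> nat) \<Rightarrow> 'c) \<Rightarrow> (nat \<Rightarrow> 'a \<times> (nat \<Rightarrow> nat) \<Rightarrow> 'c \<times> 's)" where
  "restriction_functor D Y pY =
     (\<lambda>n. \<lambda>F\<in>Simp D n. \<lambda>k. \<lambda>z\<in>Simp (sset_prod Y (std_simplex n)) k. (F k z, pY k (fst z)))"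

end

theory Submission
  imports Defs
begin

text \<open>
  Put \<open>X = sd(P)\<^sub>0\<close> and \<open>Y = sd(P\<^sub>0)\<close>, which is the part of \<open>X\<close> over \<open>P\<^sub>0\<close>. A lifting problem amounts to
  extending a map over \<open>P\<close> from \<open>Y \<times> \<Delta>\<^sup>n \<union> X \<times> \<partial>\<Delta>\<^sup>n\<close> to \<open>X \<times> \<Delta>\<^sup>n\<close>, and the missing simplices are filled
  in by induction on the length of their top string. A string outside \<open>P\<^sub>0\<close> is \<open>t @ [c]\<close> with \<open>t\<close>
  again in \<open>X\<close>, so the chains below it form a prism whose bottom misses \<open>c\<close> and whose top is obtained
  from the bottom by appending \<open>c\<close>. The simplices of the prism are attached along inner horns, except
  for one \<open>0\<close>-horn each time; the latter lies over a single edge \<open>a < c\<close> of \<open>P\<close> and its initial edge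
  \<open>s \<rightarrow> s @ [c]\<close> is locally cocartesian, which is exactly what is needed to fill it. No cocartesian
  edges over longer chains of \<open>P\<close> occur, so locally cocartesian fibrations suffice.

  Over a point of \<open>P\<close> the locally cocartesian edges of \<open>X\<close> are degenerate. Their images in \<open>C\<close> are locally
  cocartesian because every value at a string \<open>t @ [c]\<close> is the target of a locally cocartesian edge.
\<close>

text \<open>Fillers are chosen without any coherence and \<open>P\<close> may be infinite, so no
  list of cells is available: Zorn's lemma yields a maximal partial extension, and a well-founded
  rank on cells shows that it omits none. At each step exactly the horn of a cell must be present.
  This holds because the missing nondegenerate simplices are matched in pairs, a cell with its
  missing face, by deleting or inserting \<open>s\<close> just before the first string containing
  \<open>c\<close>. The \<open>[n]\<close>-coordinate is kept fixed along
  \<open>s -> s @ [c]\<close>, because a simplex of the functor category has to preserve cocartesian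
  edges only at its vertices.

  An obstacle is that identities of strings, too, must go to locally cocartesian edges. That
  identities have this property is an instance of Joyal's theorem on outer horns whose leading edge
  is invertible. Outside \<open>P0\<close> only identities at the target of a locally cocartesian
  edge \<open>k\<close> occur, and placing \<open>k\<close> in front of the outer horn turns the
  claim into a second matching problem. One attachment theorem, for an arbitrary domain and base,
  serves both uses.\<close>

section \<open>Operators and simplicial sets\<close>

text \<open>Both rules would rewrite \<open>{..0}\<close> and \<open>1\<close>, and operators such
  as \<open>\<lambda>_\<in>{..0}. i\<close> and \<open>delta_id 1\<close> would no longer be met in
  the form in which the definitions produce them.\<close>

declare atMost_0 [simp del] One_nat_def [simp del]

abbreviation delta_id :: "nat \<Rightarrow> nat \<Rightarrow> nat" where
  "delta_id n \<equiv> (\<lambda>i\<in>{..n}. i)"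

lemma delta_homI:
  assumes "\<And>i. i \<le> m \<Longrightarrow> \<alpha> i \<le> n" "\<And>i j. i \<le> j \<Longrightarrow> j \<le> m \<Longrightarrow> \<alpha> i \<le> \<alpha> j"
    "\<alpha> \<in> extensional {..m}"
  shows "\<alpha> \<in> delta_hom m n"
  using assms by (auto simp: delta_hom_def PiE_def mono_on_def)

lemma delta_hom_le: "\<alpha> \<in> delta_hom m n \<Longrightarrow> i \<le> m \<Longrightarrow> \<alpha> i \<le> n"
  by (auto simp: delta_hom_def)

lemma delta_hom_mono: "\<alpha> \<in> delta_hom m n \<Longrightarrow> i \<le> j \<Longrightarrow> j \<le> m \<Longrightarrow> \<alpha> i \<le> \<alpha> j"
  by (auto simp: delta_hom_def mono_on_def)

lemma delta_hom_ext: "\<alpha> \<in> delta_hom m n \<Longrightarrow> \<alpha> \<in> extensional {..m}"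
  by (auto simp: delta_hom_def PiE_def)

lemma delta_hom_eqI:
  assumes "\<alpha> \<in> delta_hom m n" "\<beta> \<in> delta_hom m n'" "\<And>i. i \<le> m \<Longrightarrow> \<alpha> i = \<beta> i"
  shows "\<alpha> = \<beta>"
  by (rule extensionalityI[where A = "{..m}"]) (use assms delta_hom_ext in auto)

lemma delta_id_in [simp, intro]: "delta_id n \<in> delta_hom n n"
  by (rule delta_homI) auto

lemma delta_const_in [simp, intro]: "j \<le> n \<Longrightarrow> (\<lambda>_\<in>{..m}. j) \<in> delta_hom m n"
  by (rule delta_homI) auto

lemma delta_compose [simp, intro]:
  "\<alpha> \<in> delta_hom m n \<Longrightarrow> \<beta> \<in> delta_hom l m \<Longrightarrow> compose {..l} \<alpha> \<beta> \<in> delta_hom l n"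
  by (rule delta_homI) (auto simp: compose_def delta_hom_le delta_hom_mono)

lemma delta_compose_assoc:
  assumes "\<gamma> \<in> delta_hom k l"
  shows "compose {..k} (compose {..l} \<alpha> \<beta>) \<gamma> = compose {..k} \<alpha> (compose {..k} \<beta> \<gamma>)"
  by (rule ext) (use assms in \<open>auto simp: compose_def delta_hom_le\<close>)

lemma delta_compose_id [simp]:
  assumes "\<alpha> \<in> delta_hom m n"
  shows "compose {..m} \<alpha> (delta_id m) = \<alpha>" "compose {..m} (delta_id n) \<alpha> = \<alpha>"
proof -
  have *: "\<alpha> \<in> {..m} \<rightarrow> {..n}" "\<alpha> \<in> extensional {..m}"
    using assms by (auto simp: delta_hom_def PiE_def)
  show "compose {..m} \<alpha> (delta_id m) = \<alpha>" using compose_Id[OF *] .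
  show "compose {..m} (delta_id n) \<alpha> = \<alpha>" using Id_compose[OF *] .
qed

lemma compose_const:
  assumes "\<beta> \<in> delta_hom l m"
  shows "compose {..l} (\<lambda>_\<in>{..m}. j) \<beta> = (\<lambda>_\<in>{..l}. j)"
  by (rule ext) (use assms in \<open>auto simp: compose_def delta_hom_le\<close>)

lemma Act_in:
  "simplicial_set X \<Longrightarrow> \<alpha> \<in> delta_hom m n \<Longrightarrow> x \<in> Simp X n \<Longrightarrow> Act X m n \<alpha> x \<in> Simp X m"
  by (auto simp: simplicial_set_def)

lemma Act_id: "simplicial_set X \<Longrightarrow> x \<in> Simp X n \<Longrightarrow> Act X n n (delta_id n) x = x"
  by (auto simp: simplicial_set_def)

lemma Act_comp:
  "simplicial_set X \<Longrightarrow> \<beta> \<in> delta_hom l m \<Longrightarrow> \<alpha> \<in> delta_hom m n \<Longrightarrow> x \<in> Simp X n \<Longrightarrow>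
   Act X l m \<beta> (Act X m n \<alpha> x) = Act X l n (compose {..l} \<alpha> \<beta>) x"
  by (auto simp: simplicial_set_def)

lemma simplicial_setI:
  assumes "\<And>m n \<alpha> x. \<alpha> \<in> delta_hom m n \<Longrightarrow> x \<in> Simp X n \<Longrightarrow> Act X m n \<alpha> x \<in> Simp X m"
    "\<And>n x. x \<in> Simp X n \<Longrightarrow> Act X n n (delta_id n) x = x"
    "\<And>l m n \<alpha> \<beta> x. \<beta> \<in> delta_hom l m \<Longrightarrow> \<alpha> \<in> delta_hom m n \<Longrightarrow> x \<in> Simp X n \<Longrightarrow>
        Act X l m \<beta> (Act X m n \<alpha> x) = Act X l n (compose {..l} \<alpha> \<beta>) x"
  shows "simplicial_set X"
  using assms by (auto simp: simplicial_set_def)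

lemma sset_homI:
  assumes "\<And>n x. x \<in> Simp X n \<Longrightarrow> f n x \<in> Simp Y n" "\<And>n. f n \<in> extensional (Simp X n)"
    "\<And>m n \<alpha> x. \<alpha> \<in> delta_hom m n \<Longrightarrow> x \<in> Simp X n \<Longrightarrow> f m (Act X m n \<alpha> x) = Act Y m n \<alpha> (f n x)"
  shows "f \<in> sset_hom X Y"
  using assms by (auto simp: sset_hom_def PiE_def)

lemma sset_hom_in: "f \<in> sset_hom X Y \<Longrightarrow> x \<in> Simp X n \<Longrightarrow> f n x \<in> Simp Y n"
  by (auto simp: sset_hom_def)

lemma sset_hom_nat:
  "f \<in> sset_hom X Y \<Longrightarrow> \<alpha> \<in> delta_hom m n \<Longrightarrow> x \<in> Simp X n \<Longrightarrow>
   f m (Act X m n \<alpha> x) = Act Y m n \<alpha> (f n x)"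
  by (auto simp: sset_hom_def)

lemma sset_hom_ext: "f \<in> sset_hom X Y \<Longrightarrow> f n \<in> extensional (Simp X n)"
  by (auto simp: sset_hom_def PiE_def)

lemma sset_hom_eqI:
  assumes "f \<in> sset_hom X Y" "g \<in> sset_hom X Y'" "\<And>n x. x \<in> Simp X n \<Longrightarrow> f n x = g n x"
  shows "f = g"
proof
  fix n
  show "f n = g n"
    by (rule extensionalityI[where A = "Simp X n"]) (use assms sset_hom_ext in auto)
qed

lemma vertex_in: "simplicial_set X \<Longrightarrow> x \<in> Simp X n \<Longrightarrow> i \<le> n \<Longrightarrow> vertex X n i x \<in> Simp X 0"
  unfolding vertex_def by (rule Act_in[OF _ delta_const_in])

lemma Simp_std [simp]: "Simp (std_simplex n) m = delta_hom m n"
  and Act_std [simp]: "Act (std_simplex n) l m \<beta> \<alpha> = compose {..l} \<alpha> \<beta>"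
  and Simp_boundary: "Simp (boundary n) m = {\<alpha> \<in> delta_hom m n. \<alpha> ` {..m} \<noteq> {..n}}"
  and Act_boundary [simp]: "Act (boundary n) l m \<beta> \<alpha> = compose {..l} \<alpha> \<beta>"
  and Simp_horn: "Simp (horn n k) m = {\<alpha> \<in> delta_hom m n. insert k (\<alpha> ` {..m}) \<noteq> {..n}}"
  and Act_horn [simp]: "Act (horn n k) l m \<beta> \<alpha> = compose {..l} \<alpha> \<beta>"
  and Simp_prod [simp]: "Simp (sset_prod X Y) n = Simp X n \<times> Simp Y n"
  and Act_prod [simp]: "Act (sset_prod X Y) m n \<alpha> z = (Act X m n \<alpha> (fst z), Act Y m n \<alpha> (snd z))"
  and Simp_fibre_prod: "Simp (fibre_prod X p Y g) n = {z \<in> Simp X n \<times> Simp Y n. p n (fst z) = g n (snd z)}"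
  and Act_fibre_prod [simp]:
    "Act (fibre_prod X p Y g) m n \<alpha> z = (Act X m n \<alpha> (fst z), Act Y m n \<alpha> (snd z))"
  and Act_nerve [simp]: "Act (nerve A r) m n \<alpha> \<sigma> = compose {..m} \<sigma> \<alpha>"
  and Act_full [simp]: "Act (full_subsset X V) = Act X"
  and Simp_full: "Simp (full_subsset X V) n = {x \<in> Simp X n. \<forall>i\<le>n. vertex X n i x \<in> V}"
  by (auto simp: std_simplex_def boundary_def horn_def sset_prod_def fibre_prod_def nerve_def full_subsset_def)

lemma Simp_nerve:
  "Simp (nerve A r) n = {\<sigma> \<in> {..n} \<rightarrow>\<^sub>E A. \<forall>i j. i \<le> j \<and> j \<le> n \<longrightarrow> (\<sigma> i, \<sigma> j) \<in> r}"
  by (simp add: nerve_def)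

lemma nerveI:
  assumes "\<And>i. i \<le> n \<Longrightarrow> \<sigma> i \<in> A" "\<And>i j. i \<le> j \<Longrightarrow> j \<le> n \<Longrightarrow> (\<sigma> i, \<sigma> j) \<in> r"
    "\<sigma> \<in> extensional {..n}"
  shows "\<sigma> \<in> Simp (nerve A r) n"
  using assms by (auto simp: Simp_nerve PiE_def)

lemma nerveD:
  assumes "\<sigma> \<in> Simp (nerve A r) n"
  shows "\<And>i. i \<le> n \<Longrightarrow> \<sigma> i \<in> A" "\<And>i j. i \<le> j \<Longrightarrow> j \<le> n \<Longrightarrow> (\<sigma> i, \<sigma> j) \<in> r"
    "\<sigma> \<in> extensional {..n}"
  using assms by (auto simp: Simp_nerve PiE_def)

lemma nerve_eqI:
  assumes "\<sigma> \<in> Simp (nerve A r) n" "\<tau> \<in> Simp (nerve A' r') n" "\<And>i. i \<le> n \<Longrightarrow> \<sigma> i = \<tau> i"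
  shows "\<sigma> = \<tau>"
  by (rule extensionalityI[where A = "{..n}"]) (use assms nerveD(3) in auto)

lemma simplicial_nerve [simp, intro]: "simplicial_set (nerve A r)"
proof (rule simplicial_setI)
  fix m n \<alpha> \<sigma> assume "\<alpha> \<in> delta_hom m n" "\<sigma> \<in> Simp (nerve A r) n"
  then show "Act (nerve A r) m n \<alpha> \<sigma> \<in> Simp (nerve A r) m"
    by (intro nerveI) (auto simp: compose_def dest: nerveD delta_hom_le delta_hom_mono)
next
  fix n \<sigma> assume "\<sigma> \<in> Simp (nerve A r) n"
  then show "Act (nerve A r) n n (delta_id n) \<sigma> = \<sigma>"
    by (auto simp: Simp_nerve PiE_def compose_Id)
next
  fix l m n \<alpha> \<beta> \<sigma> assume "\<beta> \<in> delta_hom l m" "\<alpha> \<in> delta_hom m n" "\<sigma> \<in> Simp (nerve A r) n"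
  then show "Act (nerve A r) l m \<beta> (Act (nerve A r) m n \<alpha> \<sigma>) = Act (nerve A r) l n (compose {..l} \<alpha> \<beta>) \<sigma>"
    by (simp add: delta_compose_assoc)
qed

lemma simplicial_std [simp, intro]: "simplicial_set (std_simplex n)"
  by (rule simplicial_setI) (auto simp: delta_compose_assoc)

lemma simplicial_prod [simp, intro]:
  "simplicial_set X \<Longrightarrow> simplicial_set Y \<Longrightarrow> simplicial_set (sset_prod X Y)"
  by (rule simplicial_setI) (auto simp: Act_in Act_id Act_comp)

lemma simplicial_fibre_prod:
  assumes "simplicial_set X" "simplicial_set Y" "p \<in> sset_hom X S" "g \<in> sset_hom Y S"
  shows "simplicial_set (fibre_prod X p Y g)"
  by (rule simplicial_setI)
    (use assms in \<open>auto simp: Simp_fibre_prod Act_in Act_id Act_comp sset_hom_nat[OF assms(3)] sset_hom_nat[OF assms(4)]\<close>)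

lemma fibre_prod_proj_hom:
  assumes "simplicial_set X" "simplicial_set Y" "p \<in> sset_hom X S" "g \<in> sset_hom Y S"
  shows "fibre_prod_proj X p Y g \<in> sset_hom (fibre_prod X p Y g) Y"
proof -
  have *: "simplicial_set (fibre_prod X p Y g)" by (rule simplicial_fibre_prod[OF assms])
  show ?thesis
    by (rule sset_homI)
      (use Act_in[OF *] in \<open>auto simp: fibre_prod_proj_def Simp_fibre_prod\<close>)
qed

lemma simplicial_full:
  assumes X: "simplicial_set X"
  shows "simplicial_set (full_subsset X V)"
proof (rule simplicial_setI)
  fix m n \<alpha> x assume \<alpha>: "\<alpha> \<in> delta_hom m n" and x: "x \<in> Simp (full_subsset X V) n"
  have "vertex X m i (Act X m n \<alpha> x) = vertex X n (\<alpha> i) x" if "i \<le> m" for i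
  proof -
    have "compose {..0::nat} \<alpha> (\<lambda>_\<in>{..0}. i) = (\<lambda>_\<in>{..0}. \<alpha> i)"
      by (rule ext) (auto simp: compose_def)
    moreover have "x \<in> Simp X n" using x by (simp add: Simp_full)
    ultimately show ?thesis unfolding vertex_def
      using Act_comp[OF X delta_const_in[OF that, of 0] \<alpha>] by simp
  qed
  then show "Act (full_subsset X V) m n \<alpha> x \<in> Simp (full_subsset X V) m"
    using x \<alpha> by (auto simp: Simp_full Act_in[OF X] delta_hom_le)
qed (auto simp: Simp_full Act_id[OF X] Act_comp[OF X])

lemma yoneda_hom:
  assumes X: "simplicial_set X" "x \<in> Simp X n"
  shows "yoneda X n x \<in> sset_hom (std_simplex n) X"
  by (rule sset_homI) (use assms in \<open>auto simp: yoneda_def Act_in Act_comp\<close>)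

lemma nerve_map_hom:
  assumes "\<And>a. a \<in> A \<Longrightarrow> f a \<in> B" "\<And>a b. a \<in> A \<Longrightarrow> b \<in> A \<Longrightarrow> (a, b) \<in> r \<Longrightarrow> (f a, f b) \<in> r'"
  shows "nerve_map A r f \<in> sset_hom (nerve A r) (nerve B r')"
proof (rule sset_homI)
  fix n \<sigma> assume "\<sigma> \<in> Simp (nerve A r) n"
  then show "nerve_map A r f n \<sigma> \<in> Simp (nerve B r') n"
  proof -
    assume \<sigma>: "\<sigma> \<in> Simp (nerve A r) n"
    have "compose {..n} f \<sigma> \<in> Simp (nerve B r') n"
    proof (rule nerveI)
      show "compose {..n} f \<sigma> i \<in> B" if "i \<le> n" for i
        using assms(1) nerveD(1)[OF \<sigma> that] that by (simp add: compose_def)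
      show "(compose {..n} f \<sigma> i, compose {..n} f \<sigma> j) \<in> r'" if "i \<le> j" "j \<le> n" for i j
        using assms(2) nerveD(1)[OF \<sigma>] nerveD(2)[OF \<sigma> that] that by (simp add: compose_def)
    qed simp
    then show ?thesis using \<sigma> by (simp add: nerve_map_def)
  qed
next
  fix m n \<alpha> \<sigma> assume *: "\<alpha> \<in> delta_hom m n" "\<sigma> \<in> Simp (nerve A r) n"
  then have "compose {..m} \<sigma> \<alpha> \<in> Simp (nerve A r) m"
    using Act_in[OF simplicial_nerve] by force
  then show "nerve_map A r f m (Act (nerve A r) m n \<alpha> \<sigma>) = Act (nerve B r') m n \<alpha> (nerve_map A r f n \<sigma>)"
    using * by (simp add: nerve_map_def delta_compose_assoc)
qed (simp add: nerve_map_def)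

section \<open>Horns\<close>

definition coface :: "nat \<Rightarrow> nat \<Rightarrow> nat \<Rightarrow> nat" where
  "coface m j = (\<lambda>k\<in>{..m}. if k < j then k else Suc k)"

lemma coface_in [simp, intro]: "coface m j \<in> delta_hom m (Suc m)"
  by (rule delta_homI) (auto simp: coface_def)

lemma coface_apply: "k \<le> m \<Longrightarrow> coface m j k = (if k < j then k else Suc k)"
  by (simp add: coface_def)

lemma coface_image: "j \<le> Suc m \<Longrightarrow> coface m j ` {..m} = {..Suc m} - {j}"
proof
  show "coface m j ` {..m} \<subseteq> {..Suc m} - {j}" by (auto simp: coface_def)
  show "{..Suc m} - {j} \<subseteq> coface m j ` {..m}" if "j \<le> Suc m"
  proof
    fix a assume a: "a \<in> {..Suc m} - {j}"
    show "a \<in> coface m j ` {..m}"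
    proof (cases "a < j")
      case True
      then show ?thesis using that by (intro image_eqI[of _ _ a]) (auto simp: coface_def)
    next
      case False
      then show ?thesis using a by (intro image_eqI[of _ _ "a - 1"]) (auto simp: coface_def)
    qed
  qed
qed

lemma coface_factor:
  assumes "\<alpha> \<in> delta_hom l (Suc m)" "j \<notin> \<alpha> ` {..l}" "j \<le> Suc m"
  obtains \<beta> where "\<beta> \<in> delta_hom l m" "\<alpha> = compose {..l} (coface m j) \<beta>"
proof -
  let ?\<beta> = "\<lambda>k\<in>{..l}. if \<alpha> k < j then \<alpha> k else \<alpha> k - 1"
  have ne: "\<alpha> k \<noteq> j" if "k \<le> l" for k using assms(2) that by auto
  have le: "\<alpha> k \<le> Suc m" if "k \<le> l" for k using assms(1) that by (rule delta_hom_le)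
  have 1: "?\<beta> \<in> delta_hom l m"
  proof (rule delta_homI)
    fix i assume "i \<le> l"
    with ne[of i] le[of i] assms(3) show "?\<beta> i \<le> m" by auto
  next
    fix i k assume "i \<le> k" "k \<le> l"
    with delta_hom_mono[OF assms(1), of i k] ne[of i] ne[of k] show "?\<beta> i \<le> ?\<beta> k" by auto
  qed auto
  have "\<alpha> = compose {..l} (coface m j) ?\<beta>"
  proof (rule delta_hom_eqI[OF assms(1)])
    show "compose {..l} (coface m j) ?\<beta> \<in> delta_hom l (Suc m)" using 1 by blast
    fix i assume "i \<le> l"
    with ne[of i] le[of i] assms(3) show "\<alpha> i = compose {..l} (coface m j) ?\<beta> i"
      by (auto simp: compose_def coface_def)
  qed
  with 1 show ?thesis by (rule that)
qed

lemma hornI: "\<alpha> \<in> delta_hom m n \<Longrightarrow> j \<le> n \<Longrightarrow> j \<noteq> k \<Longrightarrow> j \<notin> \<alpha> ` {..m} \<Longrightarrow> \<alpha> \<in> Simp (horn n k) m"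
  by (auto simp: Simp_horn)

lemma hornE:
  assumes "\<alpha> \<in> Simp (horn n k) m" "k \<le> n"
  obtains j where "\<alpha> \<in> delta_hom m n" "j \<le> n" "j \<noteq> k" "j \<notin> \<alpha> ` {..m}"
proof -
  have "insert k (\<alpha> ` {..m}) \<subseteq> {..n}"
    using assms by (auto simp: Simp_horn delta_hom_le)
  then have "\<exists>j\<le>n. j \<notin> insert k (\<alpha> ` {..m})" using assms by (auto simp: Simp_horn)
  with that assms show ?thesis by (auto simp: Simp_horn)
qed

lemma horn_delta: "\<alpha> \<in> Simp (horn n k) m \<Longrightarrow> \<alpha> \<in> delta_hom m n"
  by (auto simp: Simp_horn)

lemma horn_compose [intro]:
  assumes "\<alpha> \<in> Simp (horn n k) m" "\<beta> \<in> delta_hom l m" "k \<le> n"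
  shows "compose {..l} \<alpha> \<beta> \<in> Simp (horn n k) l"
proof -
  obtain j where "\<alpha> \<in> delta_hom m n" "j \<le> n" "j \<noteq> k" "j \<notin> \<alpha> ` {..m}"
    using hornE[OF assms(1,3)] .
  moreover from this have "j \<notin> compose {..l} \<alpha> \<beta> ` {..l}"
    using assms(2) by (auto simp: compose_def delta_hom_le)
  ultimately show ?thesis
    using assms(2) by (intro hornI[of _ _ _ j]) auto
qed

text \<open>The horn is the union of the faces other than the \<open>i\<close>-th. A claim about its
  simplices that is stable under operators therefore needs to be checked on cofaces only.\<close>

lemma horn_factor:
  assumes "\<alpha> \<in> Simp (horn (Suc m) i) l" "i \<le> Suc m"
  obtains j \<beta> where "j \<le> Suc m" "j \<noteq> i" "\<beta> \<in> delta_hom l m" "\<alpha> = compose {..l} (coface m j) \<beta>"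
  using hornE[OF assms] coface_factor by metis

lemma nonhorn_image:
  assumes "\<alpha> \<in> delta_hom l n" "\<alpha> \<notin> Simp (horn n i) l"
  shows "{..n} - {i} \<subseteq> \<alpha> ` {..l}"
  using assms by (auto simp: Simp_horn)

text \<open>An operator outside the horn hits every value except possibly \<open>i\<close>, and any
  choice of preimages along \<open>coface m i\<close> is increasing, because
  \<open>coface m i\<close> is strictly increasing and \<open>\<alpha>\<close> monotone. So whenever
  such a simplex of a cell is present, the missing face is present too.\<close>

lemma nonhorn_section:
  assumes \<alpha>: "\<alpha> \<in> delta_hom l (Suc m)" "\<alpha> \<notin> Simp (horn (Suc m) i) l" "i \<le> Suc m"
  obtains \<beta> where "\<beta> \<in> delta_hom m l" "compose {..m} \<alpha> \<beta> = coface m i"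
proof -
  have "\<exists>a\<le>l. \<alpha> a = coface m i k" if "k \<le> m" for k
  proof -
    have "coface m i k \<in> coface m i ` {..m}" using that by simp
    then have "coface m i k \<in> \<alpha> ` {..l}"
      unfolding coface_image[OF \<alpha>(3)] using nonhorn_image[OF \<alpha>(1,2)] by blast
    then show ?thesis by force
  qed
  then obtain b where b: "\<And>k. k \<le> m \<Longrightarrow> b k \<le> l" "\<And>k. k \<le> m \<Longrightarrow> \<alpha> (b k) = coface m i k"
    by metis
  let ?\<beta> = "restrict b {..m}"
  have 1: "?\<beta> \<in> delta_hom m l"
  proof (rule delta_homI)
    fix j k assume jk: "j \<le> k" "k \<le> m"
    show "?\<beta> j \<le> ?\<beta> k"
    proof (rule ccontr)
      assume "\<not> ?\<beta> j \<le> ?\<beta> k"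
      then have *: "b k < b j" using jk by auto
      then have "\<alpha> (b k) \<le> \<alpha> (b j)" using b(1)[of j] jk by (intro delta_hom_mono[OF \<alpha>(1)]) auto
      then have "coface m i k \<le> coface m i j" using b jk by auto
      then have "j = k" using jk by (auto simp: coface_def split: if_splits)
      with * show False by simp
    qed
  qed (use b in auto)
  have "compose {..m} \<alpha> ?\<beta> = coface m i"
    by (rule delta_hom_eqI[OF delta_compose[OF \<alpha>(1) 1] coface_in]) (auto simp: compose_def b)
  with 1 show ?thesis by (rule that)
qed

text \<open>Injectivity makes the map strictly increasing: induction upwards from \<open>0\<close>
  bounds it below by the identity, and induction downwards from \<open>n\<close> bounds it
  above.\<close>

lemma mono_full_image_id:
  assumes "\<alpha> \<in> delta_hom n n" "inj_on \<alpha> {..n}"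
  shows "\<alpha> = delta_id n"
proof (rule delta_hom_eqI[OF assms(1) delta_id_in])
  have lt: "\<alpha> i < \<alpha> (Suc i)" if "Suc i \<le> n" for i
    using delta_hom_mono[OF assms(1), of i "Suc i"] inj_onD[OF assms(2), of i "Suc i"] that by fastforce
  have ge: "i \<le> n \<longrightarrow> i \<le> \<alpha> i" for i
  proof (induction i)
    case (Suc i)
    show ?case using lt[of i] Suc.IH by linarith
  qed simp
  have le: "k \<le> n \<longrightarrow> \<alpha> (n - k) \<le> n - k" for k
  proof (induction k)
    case 0
    show ?case using delta_hom_le[OF assms(1), of n] by simp
  next
    case (Suc k)
    have "Suc k \<le> n \<Longrightarrow> Suc (n - Suc k) = n - k" by simp
    then show ?case using lt[of "n - Suc k"] Suc.IH by fastforce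
  qed
  fix i assume "i \<le> n"
  with ge[of i] le[of "n - i"] show "\<alpha> i = delta_id n i" by simp
qed

text \<open>Counting the image decides: it is everything, or everything but \<open>i\<close>. These
  two are the only nondegenerate simplices that attaching a cell adds, which is what the conditions
  on marked edges and on distinct cells come down to.\<close>

lemma nonhorn_injective:
  assumes \<alpha>: "\<alpha> \<in> delta_hom l (Suc m)" "\<alpha> \<notin> Simp (horn (Suc m) i) l" "i \<le> Suc m" "inj_on \<alpha> {..l}"
  obtains "l = Suc m" "\<alpha> = delta_id (Suc m)" | "l = m" "\<alpha> = coface m i"
proof (cases "i \<in> \<alpha> ` {..l}")
  case True
  then have "\<alpha> ` {..l} = {..Suc m}"
    using nonhorn_image[OF \<alpha>(1,2)] \<alpha>(1) by (auto simp: delta_hom_le)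
  then have "card {..l} = card {..Suc m}" using card_image[OF \<alpha>(4)] by simp
  then have l: "l = Suc m" by simp
  then show ?thesis using that(1) mono_full_image_id \<alpha> by metis
next
  case False
  then have "\<alpha> ` {..l} = {..Suc m} - {i}"
    using nonhorn_image[OF \<alpha>(1,2)] \<alpha>(1) by (auto simp: delta_hom_le)
  then have "card {..l} = card ({..Suc m} - {i})" using card_image[OF \<alpha>(4)] by simp
  then have l: "l = m" using \<alpha>(3) by simp
  obtain \<beta> where \<beta>: "\<beta> \<in> delta_hom l m" "\<alpha> = compose {..l} (coface m i) \<beta>"
    using coface_factor[OF \<alpha>(1) False \<alpha>(3)] .
  have "inj_on \<beta> {..l}"
    using \<alpha>(4) \<beta>(2) by (auto simp: inj_on_def compose_def)
  then have "\<beta> = delta_id m" using \<beta> l mono_full_image_id by blast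
  then show ?thesis using that(2) l \<beta>(2) by (metis coface_in delta_compose_id(1))
qed

text \<open>By Yoneda a lift on the standard simplex amounts to its value at the identity operator.
  This and \<open>solutionI\<close> trade lifting problems for the existence of a simplex with
  prescribed faces.\<close>

lemma horn_solution:
  assumes sol: "has_solution (horn n k) (std_simplex n) X S p u v"
    and "simplicial_set X" "v \<in> sset_hom (std_simplex n) S" "k \<le> n"
  obtains c where "c \<in> Simp X n" "p n c = v n (delta_id n)"
    "\<And>m \<alpha>. \<alpha> \<in> Simp (horn n k) m \<Longrightarrow> Act X m n \<alpha> c = u m \<alpha>"
proof -
  obtain w where w: "w \<in> sset_hom (std_simplex n) X" "\<And>m \<alpha>. \<alpha> \<in> Simp (horn n k) m \<Longrightarrow> w m \<alpha> = u m \<alpha>"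
    "\<And>m \<alpha>. \<alpha> \<in> delta_hom m n \<Longrightarrow> p m (w m \<alpha>) = v m \<alpha>"
    using sol by (auto simp: has_solution_def)
  show ?thesis
  proof (rule that)
    show "w n (delta_id n) \<in> Simp X n" using sset_hom_in[OF w(1)] by simp
    show "p n (w n (delta_id n)) = v n (delta_id n)" using w(3) by simp
    fix m \<alpha> assume a: "\<alpha> \<in> Simp (horn n k) m"
    have "w m (Act (std_simplex n) m n \<alpha> (delta_id n)) = Act X m n \<alpha> (w n (delta_id n))"
      by (rule sset_hom_nat[OF w(1)]) (use a horn_delta in auto)
    then show "Act X m n \<alpha> (w n (delta_id n)) = u m \<alpha>" using w(2)[OF a] horn_delta[OF a] by simp
  qed
qed

lemma solutionI:
  assumes "simplicial_set X" "p \<in> sset_hom X S" "v \<in> sset_hom (std_simplex n) S"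
    "c \<in> Simp X n" "p n c = v n (delta_id n)"
    "\<And>m \<alpha>. \<alpha> \<in> Simp A m \<Longrightarrow> \<alpha> \<in> delta_hom m n \<and> Act X m n \<alpha> c = u m \<alpha>"
  shows "has_solution A (std_simplex n) X S p u v"
  unfolding has_solution_def
proof (intro bexI conjI allI ballI)
  show "yoneda X n c \<in> sset_hom (std_simplex n) X" by (rule yoneda_hom) (use assms in auto)
  fix m \<alpha>
  show "yoneda X n c m \<alpha> = u m \<alpha>" if "\<alpha> \<in> Simp A m"
    using assms(6)[OF that] by (simp add: yoneda_def)
  show "p m (yoneda X n c m \<alpha>) = v m \<alpha>" if "\<alpha> \<in> Simp (std_simplex n) m"
  proof -
    have \<alpha>: "\<alpha> \<in> delta_hom m n" using that by simp
    have "v m \<alpha> = Act S m n \<alpha> (v n (delta_id n))"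
      using sset_hom_nat[OF assms(3) \<alpha>, of "delta_id n"] \<alpha> by simp
    then show ?thesis
      using sset_hom_nat[OF assms(2) \<alpha> assms(4)] \<alpha> assms(5) by (simp add: yoneda_def)
  qed
qed

lemma inner_fibration_fill:
  assumes "inner_fibration X S p" "0 < k" "k < n" "u \<in> sset_hom (horn n k) X" "s \<in> Simp S n"
    "\<And>m \<alpha>. \<alpha> \<in> Simp (horn n k) m \<Longrightarrow> p m (u m \<alpha>) = Act S m n \<alpha> s"
  obtains c where "c \<in> Simp X n" "p n c = s"
    "\<And>m \<alpha>. \<alpha> \<in> Simp (horn n k) m \<Longrightarrow> Act X m n \<alpha> c = u m \<alpha>"
proof -
  have X: "simplicial_set X" and S: "simplicial_set S" using assms(1) by (auto simp: inner_fibration_def)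
  have v: "yoneda S n s \<in> sset_hom (std_simplex n) S" by (rule yoneda_hom[OF S assms(5)])
  have "lifting_problem (horn n k) (std_simplex n) X S p u (yoneda S n s)"
    unfolding lifting_problem_def
  proof (intro conjI allI ballI)
    fix m \<alpha> assume a: "\<alpha> \<in> Simp (horn n k) m"
    show "p m (u m \<alpha>) = yoneda S n s m \<alpha>"
      using assms(6)[OF a] horn_delta[OF a] by (simp add: yoneda_def)
  qed (fact v assms(4))+
  moreover have "\<forall>n k u v. 0 < k \<and> k < n \<and> lifting_problem (horn n k) (std_simplex n) X S p u v \<longrightarrow>
        has_solution (horn n k) (std_simplex n) X S p u v"
    using assms(1) unfolding inner_fibration_def by (elim conjE)
  ultimately have sol: "has_solution (horn n k) (std_simplex n) X S p u (yoneda S n s)"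
    using assms(2,3) by (metis (no_types, lifting))
  have y: "yoneda S n s n (delta_id n) = s" using Act_id[OF S assms(5)] by (simp add: yoneda_def)
  have kn: "k \<le> n" using assms(3) by simp
  show ?thesis
    by (rule horn_solution[OF sol X v kn]) (auto simp: y intro: that)
qed

section \<open>Locally cocartesian edges\<close>

definition collapse :: "nat \<Rightarrow> nat \<Rightarrow> nat" where
  "collapse n = (\<lambda>i\<in>{..n}. min i 1)"

abbreviation horn_over ::
  "'s sset \<Rightarrow> (nat \<Rightarrow> 'a \<Rightarrow> 's) \<Rightarrow> nat \<Rightarrow> (nat \<Rightarrow> (nat \<Rightarrow> nat) \<Rightarrow> 'a) \<Rightarrow> (nat \<Rightarrow> nat) \<Rightarrow> 's \<Rightarrow> bool" where
  "horn_over S p n u \<gamma> s \<equiv>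
     \<forall>m. \<forall>\<alpha> \<in> Simp (horn n 0) m. p m (u m \<alpha>) = Act S m 1 (compose {..m} \<gamma> \<alpha>) s"

abbreviation horn_filler ::
  "'a sset \<Rightarrow> 's sset \<Rightarrow> (nat \<Rightarrow> 'a \<Rightarrow> 's) \<Rightarrow> nat \<Rightarrow> (nat \<Rightarrow> (nat \<Rightarrow> nat) \<Rightarrow> 'a) \<Rightarrow> (nat \<Rightarrow> nat) \<Rightarrow> 's \<Rightarrow> bool" where
  "horn_filler X S p n u \<gamma> s \<equiv>
     \<exists>c \<in> Simp X n. p n c = Act S n 1 \<gamma> s \<and> (\<forall>m. \<forall>\<alpha> \<in> Simp (horn n 0) m. Act X m n \<alpha> c = u m \<alpha>)"

text \<open>
  Horns with leading edge \<open>e\<close> in the pullback along \<open>p e : \<Delta>\<^sup>1 \<rightarrow> S\<close> are horns of \<open>X\<close> lying over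
  the degeneration of \<open>p e\<close> along \<open>0 \<mapsto> 0\<close>, \<open>j \<mapsto> 1\<close> for \<open>j > 0\<close>.
\<close>

definition lc_edge :: "'a sset \<Rightarrow> 's sset \<Rightarrow> (nat \<Rightarrow> 'a \<Rightarrow> 's) \<Rightarrow> 'a \<Rightarrow> bool" where
  "lc_edge X S p e \<longleftrightarrow> e \<in> Simp X 1 \<and>
     (\<forall>n\<ge>2. \<forall>u \<in> sset_hom (horn n 0) X.
        (horn_over S p n u (collapse n) (p 1 e)) \<and>
        u 1 (delta_id 1) = e \<longrightarrow>
        (horn_filler X S p n u (collapse n) (p 1 e)))"

lemma collapse_in [simp, intro]: "collapse n \<in> delta_hom n 1"
  by (rule delta_homI) (auto simp: collapse_def)

lemma initial_edge_in: "0 < n \<Longrightarrow> delta_id 1 \<in> delta_hom 1 n"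
  by (rule delta_homI) auto

lemma initial_edge_horn: "2 \<le> n \<Longrightarrow> delta_id 1 \<in> Simp (horn n 0) 1"
  by (rule hornI[where j = n]) (auto intro: initial_edge_in)

lemma collapse_initial: "0 < n \<Longrightarrow> compose {..1} (collapse n) (delta_id 1) = delta_id 1"
  by (rule delta_hom_eqI[where m = 1 and n = 1 and n' = 1])
     (auto simp: compose_def collapse_def intro!: delta_homI)

text \<open>A monotone map to \<open>[1]\<close> that takes the value \<open>1\<close> at
  \<open>1\<close> keeps it. This is why \<open>lc_edge\<close> fixes the degeneration of the base
  edge instead of quantifying over maps to \<open>[1]\<close>.\<close>

lemma collapse_unique:
  assumes "\<gamma> \<in> delta_hom n 1" "0 < n" "compose {..1} \<gamma> (delta_id 1) = delta_id 1"
  shows "\<gamma> = collapse n"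
proof (rule delta_hom_eqI[OF assms(1) collapse_in])
  have g: "\<gamma> 0 = 0" "\<gamma> 1 = 1"
    using fun_cong[OF assms(3), of 0] fun_cong[OF assms(3), of 1] by (auto simp: compose_def)
  fix i assume i: "i \<le> n"
  show "\<gamma> i = collapse n i"
  proof (cases "i = 0")
    case False
    then have "\<gamma> 1 \<le> \<gamma> i" using i by (intro delta_hom_mono[OF assms(1)]) auto
    then show ?thesis using delta_hom_le[OF assms(1) i] g i False by (auto simp: collapse_def)
  qed (use g in \<open>auto simp: collapse_def\<close>)
qed

lemma lc_edgeD:
  assumes "lc_edge X S p e" "2 \<le> n" "u \<in> sset_hom (horn n 0) X"
    "\<And>m \<alpha>. \<alpha> \<in> Simp (horn n 0) m \<Longrightarrow> p m (u m \<alpha>) = Act S m 1 (compose {..m} (collapse n) \<alpha>) (p 1 e)"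
    "u 1 (delta_id 1) = e"
  obtains c where "c \<in> Simp X n" "p n c = Act S n 1 (collapse n) (p 1 e)"
    "\<And>m \<alpha>. \<alpha> \<in> Simp (horn n 0) m \<Longrightarrow> Act X m n \<alpha> c = u m \<alpha>"
proof -
  have "horn_filler X S p n u (collapse n) (p 1 e)"
    by (rule assms(1)[unfolded lc_edge_def, THEN conjunct2, rule_format])
      (use assms(2-5) in auto)
  then show ?thesis using that by blast
qed

lemma lc_edge_in: "lc_edge X S p e \<Longrightarrow> e \<in> Simp X 1"
  by (simp add: lc_edge_def)

lemma Simp_edge_pullback:
  "Simp (edge_pullback X S p s) n =
     {z. fst z \<in> Simp X n \<and> snd z \<in> delta_hom n 1 \<and> p n (fst z) = Act S n 1 (snd z) s}"
  by (auto simp: edge_pullback_def Simp_fibre_prod yoneda_def)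

lemma Act_edge_pullback [simp]:
  "Act (edge_pullback X S p s) m n \<alpha> z = (Act X m n \<alpha> (fst z), compose {..m} (snd z) \<alpha>)"
  by (simp add: edge_pullback_def)

lemma edge_pullback_proj_apply:
  "z \<in> Simp (edge_pullback X S p s) n \<Longrightarrow> edge_pullback_proj X S p s n z = snd z"
  by (simp add: edge_pullback_def edge_pullback_proj_def fibre_prod_proj_def)

section \<open>Base change along an edge of the base\<close>

locale sset_over =
  fixes X :: "'a sset" and S :: "'s sset" and p :: "nat \<Rightarrow> 'a \<Rightarrow> 's"
  assumes X: "simplicial_set X" and S: "simplicial_set S" and p: "p \<in> sset_hom X S"
begin

abbreviation "Q \<equiv> edge_pullback X S p"
abbreviation "\<pi> \<equiv> edge_pullback_proj X S p"

lemma simplicial_edge_pullback: "s \<in> Simp S 1 \<Longrightarrow> simplicial_set (Q s)"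
  unfolding edge_pullback_def by (rule simplicial_fibre_prod[OF X _ p yoneda_hom[OF S]]) auto

lemma edge_pullback_proj_hom:
  "s \<in> Simp S 1 \<Longrightarrow> \<pi> s \<in> sset_hom (Q s) (std_simplex 1)"
  unfolding edge_pullback_proj_def edge_pullback_def
  by (rule fibre_prod_proj_hom[OF X _ p yoneda_hom[OF S]]) auto

lemma pullback_horn:
  assumes s: "s \<in> Simp S 1" and k: "k \<le> n" and \<gamma>: "\<gamma> \<in> delta_hom n 1"
    and u: "u \<in> sset_hom (horn n k) X"
    and pu: "\<And>m \<alpha>. \<alpha> \<in> Simp (horn n k) m \<Longrightarrow> p m (u m \<alpha>) = Act S m 1 (compose {..m} \<gamma> \<alpha>) s"
  defines "u' \<equiv> \<lambda>m. \<lambda>\<alpha>\<in>Simp (horn n k) m. (u m \<alpha>, compose {..m} \<gamma> \<alpha>)"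
  shows "lifting_problem (horn n k) (std_simplex n) (Q s) (std_simplex 1) (\<pi> s) u' (yoneda (std_simplex 1) n \<gamma>)"
proof -
  have in': "u' m \<alpha> \<in> Simp (Q s) m" if "\<alpha> \<in> Simp (horn n k) m" for m \<alpha>
    using that pu \<gamma> sset_hom_in[OF u] horn_delta[OF that] by (auto simp: u'_def Simp_edge_pullback)
  have "u' \<in> sset_hom (horn n k) (Q s)"
  proof (rule sset_homI)
    fix m l \<beta> \<alpha> assume \<beta>: "\<beta> \<in> delta_hom l m" and \<alpha>: "\<alpha> \<in> Simp (horn n k) m"
    then show "u' l (Act (horn n k) l m \<beta> \<alpha>) = Act (Q s) l m \<beta> (u' m \<alpha>)"
      using sset_hom_nat[OF u \<beta> \<alpha>] horn_compose[OF \<alpha> \<beta> k] by (simp add: u'_def delta_compose_assoc)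
  qed (auto simp: in', simp add: u'_def)
  moreover have "yoneda (std_simplex 1) n \<gamma> \<in> sset_hom (std_simplex n) (std_simplex 1)"
    by (rule yoneda_hom) (use \<gamma> in auto)
  ultimately show ?thesis
    unfolding lifting_problem_def
    using in' horn_delta by (auto simp: edge_pullback_proj_apply) (auto simp: u'_def yoneda_def)
qed

text \<open>The second component of a horn in the pullback is the restriction of \<open>v\<close>,
  hence given by the single operator \<open>\<gamma>\<close>. What remains is a horn of
  \<open>X\<close> over the degeneration of \<open>s\<close> along \<open>\<gamma>\<close>, and a
  filler \<open>c\<close> of it gives the filler \<open>(c, \<gamma>)\<close>.\<close>

lemma pullback_lifting:
  assumes s: "s \<in> Simp S 1" and k: "k \<le> n"
    and L: "lifting_problem (horn n k) (std_simplex n) (Q s) (std_simplex 1) (\<pi> s) u' v"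
  defines "\<gamma> \<equiv> v n (delta_id n)" and "u \<equiv> \<lambda>m. \<lambda>\<alpha>\<in>Simp (horn n k) m. fst (u' m \<alpha>)"
  shows "\<gamma> \<in> delta_hom n 1" "u \<in> sset_hom (horn n k) X"
    "\<And>m \<alpha>. \<alpha> \<in> Simp (horn n k) m \<Longrightarrow> u' m \<alpha> = (u m \<alpha>, compose {..m} \<gamma> \<alpha>)"
    "\<And>m \<alpha>. \<alpha> \<in> Simp (horn n k) m \<Longrightarrow> p m (u m \<alpha>) = Act S m 1 (compose {..m} \<gamma> \<alpha>) s"
    "c \<in> Simp X n \<Longrightarrow> p n c = Act S n 1 \<gamma> s \<Longrightarrow>
     (\<And>m \<alpha>. \<alpha> \<in> Simp (horn n k) m \<Longrightarrow> Act X m n \<alpha> c = u m \<alpha>) \<Longrightarrow>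
     has_solution (horn n k) (std_simplex n) (Q s) (std_simplex 1) (\<pi> s) u' v"
proof -
  have u': "u' \<in> sset_hom (horn n k) (Q s)"
    and v: "v \<in> sset_hom (std_simplex n) (std_simplex 1)"
    and c: "\<And>m \<alpha>. \<alpha> \<in> Simp (horn n k) m \<Longrightarrow> \<pi> s m (u' m \<alpha>) = v m \<alpha>"
    using L by (auto simp: lifting_problem_def)
  show \<gamma>: "\<gamma> \<in> delta_hom n 1" using sset_hom_in[OF v, of "delta_id n"] by (simp add: \<gamma>_def)
  have v\<gamma>: "v m \<alpha> = compose {..m} \<gamma> \<alpha>" if "\<alpha> \<in> delta_hom m n" for m \<alpha>
    using sset_hom_nat[OF v that, of "delta_id n"] that by (simp add: \<gamma>_def)
  show u: "u \<in> sset_hom (horn n k) X"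
  proof (rule sset_homI)
    show "u m \<alpha> \<in> Simp X m" if "\<alpha> \<in> Simp (horn n k) m" for m \<alpha>
      using sset_hom_in[OF u' that] that by (simp add: u_def Simp_edge_pullback)
    fix m l \<beta> \<alpha> assume \<beta>: "\<beta> \<in> delta_hom l m" and \<alpha>: "\<alpha> \<in> Simp (horn n k) m"
    then show "u l (Act (horn n k) l m \<beta> \<alpha>) = Act X l m \<beta> (u m \<alpha>)"
      using sset_hom_nat[OF u' \<beta> \<alpha>] horn_compose[OF \<alpha> \<beta> k] by (simp add: u_def)
  qed (simp add: u_def)
  show uu: "u' m \<alpha> = (u m \<alpha>, compose {..m} \<gamma> \<alpha>)" if "\<alpha> \<in> Simp (horn n k) m" for m \<alpha>
    using c[OF that] v\<gamma>[OF horn_delta[OF that]] edge_pullback_proj_apply[OF sset_hom_in[OF u' that]] that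
    by (simp add: u_def prod_eq_iff)
  show "p m (u m \<alpha>) = Act S m 1 (compose {..m} \<gamma> \<alpha>) s" if "\<alpha> \<in> Simp (horn n k) m" for m \<alpha>
    using sset_hom_in[OF u' that] uu[OF that] by (simp add: Simp_edge_pullback)
  assume *: "c \<in> Simp X n" "p n c = Act S n 1 \<gamma> s"
    "\<And>m \<alpha>. \<alpha> \<in> Simp (horn n k) m \<Longrightarrow> Act X m n \<alpha> c = u m \<alpha>"
  have in': "(c, \<gamma>) \<in> Simp (Q s) n" using * \<gamma> by (simp add: Simp_edge_pullback)
  show "has_solution (horn n k) (std_simplex n) (Q s) (std_simplex 1) (\<pi> s) u' v"
    by (rule solutionI[OF simplicial_edge_pullback[OF s] edge_pullback_proj_hom[OF s] v in'])
      (use uu * in' horn_delta in \<open>auto simp: edge_pullback_proj_apply \<gamma>_def\<close>)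
qed

text \<open>The operator \<open>\<beta>\<close> is arbitrary since a cocartesian fibration over the
  1-simplex also needs lifts of its degenerate edges. For \<open>\<beta>\<close> the identity,
  \<open>collapse_unique\<close> leaves one \<open>\<gamma>\<close> only and the right hand side
  becomes \<open>lc_edge\<close>.\<close>

lemma cocartesian_pullback_iff:
  assumes s: "s \<in> Simp S 1" and e: "e \<in> Simp X 1" and \<beta>: "\<beta> \<in> delta_hom 1 1" "p 1 e = Act S 1 1 \<beta> s"
  shows "cocartesian_edge (Q s) (std_simplex 1) (\<pi> s) (e, \<beta>) \<longleftrightarrow>
    (\<forall>n\<ge>2. \<forall>\<gamma>\<in>delta_hom n 1. \<forall>u\<in>sset_hom (horn n 0) X.
       horn_over S p n u \<gamma> s \<and>
       u 1 (delta_id 1) = e \<and> compose {..1} \<gamma> (delta_id 1) = \<beta> \<longrightarrow>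
       (horn_filler X S p n u \<gamma> s))"
  (is "?L \<longleftrightarrow> ?R")
proof
  assume L: ?L
  show ?R
  proof (intro allI impI ballI, elim conjE)
    fix n \<gamma> u
    assume n: "2 \<le> n" and \<gamma>: "\<gamma> \<in> delta_hom n 1" and u: "u \<in> sset_hom (horn n 0) X"
      and pu: "horn_over S p n u \<gamma> s"
      and ue: "u 1 (delta_id 1) = e" and g: "compose {..1} \<gamma> (delta_id 1) = \<beta>"
    let ?u = "\<lambda>m. \<lambda>\<alpha>\<in>Simp (horn n 0) m. (u m \<alpha>, compose {..m} \<gamma> \<alpha>)"
    have "lifting_problem (horn n 0) (std_simplex n) (Q s) (std_simplex 1) (\<pi> s) ?u (yoneda (std_simplex 1) n \<gamma>)"
      using pullback_horn[OF s _ \<gamma> u] pu by simp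
    moreover have "?u 1 (delta_id 1) = (e, \<beta>)"
      using ue g initial_edge_horn[OF n] by (simp only: restrict_apply simp_thms if_True)
    ultimately have sol: "has_solution (horn n 0) (std_simplex n) (Q s) (std_simplex 1) (\<pi> s) ?u (yoneda (std_simplex 1) n \<gamma>)"
      by (intro L[unfolded cocartesian_edge_def, THEN conjunct2, rule_format] conjI n)
    have y: "yoneda (std_simplex 1) n \<gamma> \<in> sset_hom (std_simplex n) (std_simplex 1)"
      by (rule yoneda_hom) (use \<gamma> in auto)
    obtain c where c: "c \<in> Simp (Q s) n"
      "\<pi> s n c = yoneda (std_simplex 1) n \<gamma> n (delta_id n)"
      "\<And>m \<alpha>. \<alpha> \<in> Simp (horn n 0) m \<Longrightarrow> Act (Q s) m n \<alpha> c = ?u m \<alpha>"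
      using horn_solution[OF sol simplicial_edge_pullback[OF s] y] by auto
    have "snd c = \<gamma>" using c(1,2) \<gamma> by (simp add: edge_pullback_proj_apply yoneda_def)
    then have "fst c \<in> Simp X n" "p n (fst c) = Act S n 1 \<gamma> s"
      "\<And>m \<alpha>. \<alpha> \<in> Simp (horn n 0) m \<Longrightarrow> Act X m n \<alpha> (fst c) = u m \<alpha>"
      using c(1,3) by (auto simp: Simp_edge_pullback)
    then show "horn_filler X S p n u \<gamma> s" by blast
  qed
next
  assume R: ?R
  show ?L
    unfolding cocartesian_edge_def
  proof (rule conjI, goal_cases)
    case 1
    show "(e, \<beta>) \<in> Simp (Q s) 1" using e \<beta> by (simp add: Simp_edge_pullback)
  next
    case 2
    show ?case
    proof (intro allI impI, elim conjE)
      fix n u' v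
      assume n: "2 \<le> n" and L: "lifting_problem (horn n 0) (std_simplex n) (Q s) (std_simplex 1) (\<pi> s) u' v"
        and ue: "u' 1 (delta_id 1) = (e, \<beta>)"
      note P = pullback_lifting[OF s le0 L]
      let ?\<gamma> = "v n (delta_id n)" and ?u = "\<lambda>m. \<lambda>\<alpha>\<in>Simp (horn n 0) m. fst (u' m \<alpha>)"
      have "(e, \<beta>) = (?u 1 (delta_id 1), compose {..1} ?\<gamma> (delta_id 1))"
        using P(3)[OF initial_edge_horn[OF n]] ue by (simp only:)
      then have ub: "?u 1 (delta_id 1) = e" "compose {..1} ?\<gamma> (delta_id 1) = \<beta>"
        by (simp_all only: prod.inject)
      obtain c where c: "c \<in> Simp X n" "p n c = Act S n 1 ?\<gamma> s"
        "\<forall>m. \<forall>\<alpha>\<in>Simp (horn n 0) m. Act X m n \<alpha> c = ?u m \<alpha>"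
        using R[rule_format, OF n P(1) P(2), OF conjI, OF _ conjI, OF _ ub] P(4) by blast
      show "has_solution (horn n 0) (std_simplex n) (Q s) (std_simplex 1) (\<pi> s) u' v"
        by (rule P(5)[OF c(1,2)]) (rule c(3)[rule_format])
    qed
  qed
qed

lemma lc_edge_iff: "locally_cocartesian_edge X S p e \<longleftrightarrow> lc_edge X S p e"
proof (cases "e \<in> Simp X 1")
  case e: True
  have s: "p 1 e \<in> Simp S 1" using sset_hom_in[OF p e] .
  have id: "p 1 e = Act S 1 1 (delta_id 1) (p 1 e)" using Act_id[OF S s] by simp
  show ?thesis
    unfolding locally_cocartesian_edge_def cocartesian_pullback_iff[OF s e delta_id_in id]
  proof (intro iffI conjI)
    assume L: "e \<in> Simp X 1 \<and> (\<forall>n\<ge>2. \<forall>\<gamma>\<in>delta_hom n 1. \<forall>u\<in>sset_hom (horn n 0) X.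
       horn_over S p n u \<gamma> (p 1 e) \<and>
       u 1 (delta_id 1) = e \<and> compose {..1} \<gamma> (delta_id 1) = delta_id 1 \<longrightarrow>
       (horn_filler X S p n u \<gamma> (p 1 e)))"
    show "lc_edge X S p e"
      unfolding lc_edge_def
    proof (intro conjI e allI impI ballI, elim conjE)
      fix n u assume "2 \<le> n" and "u \<in> sset_hom (horn n 0) X"
        and "horn_over S p n u (collapse n) (p 1 e)"
        and "u 1 (delta_id 1) = e"
      then show "horn_filler X S p n u (collapse n) (p 1 e)"
        using L[THEN conjunct2, rule_format, of n "collapse n" u] collapse_initial[of n] by auto
    qed
  next
    assume L: "lc_edge X S p e"
    show "\<forall>n\<ge>2. \<forall>\<gamma>\<in>delta_hom n 1. \<forall>u\<in>sset_hom (horn n 0) X.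
       horn_over S p n u \<gamma> (p 1 e) \<and>
       u 1 (delta_id 1) = e \<and> compose {..1} \<gamma> (delta_id 1) = delta_id 1 \<longrightarrow>
       horn_filler X S p n u \<gamma> (p 1 e)"
    proof (intro allI impI ballI, elim conjE)
      fix n \<gamma> u assume n: "2 \<le> n" and u: "u \<in> sset_hom (horn n 0) X" and \<gamma>: "\<gamma> \<in> delta_hom n 1"
        "compose {..1} \<gamma> (delta_id 1) = delta_id 1"
        and pu: "horn_over S p n u \<gamma> (p 1 e)"
        and ue: "u 1 (delta_id 1) = e"
      have \<gamma>c: "\<gamma> = collapse n" using collapse_unique \<gamma> n by simp
      show "horn_filler X S p n u \<gamma> (p 1 e)"
        using lc_edgeD[OF L n u _ ue] pu unfolding \<gamma>c by metis
    qed
  qed (use e in auto)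
qed (auto simp: locally_cocartesian_edge_def lc_edge_def)

lemma lc_fibration_lift:
  assumes F: "locally_cocartesian_fibration X S p" and s: "s \<in> Simp S 1"
    and x: "x \<in> Simp X 0" "p 0 x = vertex S 1 0 s"
  obtains e where "lc_edge X S p e" "vertex X 1 0 e = x" "p 1 e = s"
proof -
  let ?x = "(x, \<lambda>_\<in>{..0}. 0)"
  have c: "cocartesian_fibration (Q s) (std_simplex 1) (\<pi> s)"
    using F s by (simp add: locally_cocartesian_fibration_def)
  have x': "?x \<in> Simp (Q s) 0" using x by (simp add: Simp_edge_pullback vertex_def)
  have v: "vertex (std_simplex 1) 1 0 (delta_id 1) = (\<lambda>_\<in>{..0}. 0)"
    by (rule ext) (auto simp: vertex_def compose_def)
  have "(\<pi> s) 0 ?x = vertex (std_simplex 1) 1 0 (delta_id 1)"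
    unfolding v edge_pullback_proj_apply[OF x'] by simp
  then obtain e where e: "cocartesian_edge (Q s) (std_simplex 1) (\<pi> s) e" "vertex (Q s) 1 0 e = ?x" "(\<pi> s) 1 e = delta_id 1"
    using c x' unfolding cocartesian_fibration_def by (metis Simp_std delta_id_in)
  have eQ: "e \<in> Simp (Q s) 1" using e(1) by (simp add: cocartesian_edge_def)
  have e2: "snd e = delta_id 1" using e(3) edge_pullback_proj_apply[OF eQ] by simp
  have eX: "fst e \<in> Simp X 1" using eQ by (simp add: Simp_edge_pullback)
  have pe: "p 1 (fst e) = s" using eQ e2 Act_id[OF S s] by (simp add: Simp_edge_pullback)
  have "e = (fst e, delta_id 1)" using e2 by (simp add: prod_eq_iff)
  then have "locally_cocartesian_edge X S p (fst e)"
    using e(1) eX pe unfolding locally_cocartesian_edge_def by metis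
  moreover have "vertex X 1 0 (fst e) = x" using e(2) by (simp add: vertex_def)
  ultimately show ?thesis using that pe lc_edge_iff by blast
qed

lemma inner_fibration_edge_pullback:
  assumes I: "inner_fibration X S p" and s: "s \<in> Simp S 1"
  shows "inner_fibration (Q s) (std_simplex 1) (\<pi> s)"
  unfolding inner_fibration_def
proof (intro conjI allI impI)
  fix n k u v
  assume *: "0 < k \<and> k < n \<and> lifting_problem (horn n k) (std_simplex n) (Q s) (std_simplex 1) (\<pi> s) u v"
  then have k: "0 < k" "k < n" "k \<le> n" by auto
  note P = pullback_lifting[OF s k(3) *[THEN conjunct2, THEN conjunct2]]
  let ?\<gamma> = "v n (delta_id n)" and ?u = "\<lambda>m. \<lambda>\<alpha>\<in>Simp (horn n k) m. fst (u m \<alpha>)"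
  have s': "Act S n 1 ?\<gamma> s \<in> Simp S n" by (rule Act_in[OF S P(1) s])
  show "has_solution (horn n k) (std_simplex n) (Q s) (std_simplex 1) (\<pi> s) u v"
  proof (rule inner_fibration_fill[OF I k(1,2) P(2) s'])
    fix m \<alpha> assume a: "\<alpha> \<in> Simp (horn n k) m"
    show "p m (?u m \<alpha>) = Act S m n \<alpha> (Act S n 1 ?\<gamma> s)"
      using P(4)[OF a] Act_comp[OF S horn_delta[OF a] P(1) s] by simp
  qed (rule P(5))
qed (use s simplicial_edge_pullback edge_pullback_proj_hom in auto)

end

section \<open>Extension of maps along cells\<close>

text \<open>
  A map defined on part of \<open>Z\<close> is represented by its graph, a set of triples consisting of a
  dimension, a simplex and its value.
\<close>

definition partial_map ::
  "'z sset \<Rightarrow> (nat \<Rightarrow> 'z \<Rightarrow> 's) \<Rightarrow> 'c sset \<Rightarrow> (nat \<Rightarrow> 'c \<Rightarrow> 's) \<Rightarrow> (nat \<times> 'z \<times> 'c) set \<Rightarrow> bool" where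
  "partial_map Z p C q G \<longleftrightarrow>
     (\<forall>k z c. (k, z, c) \<in> G \<longrightarrow> z \<in> Simp Z k \<and> c \<in> Simp C k \<and> q k c = p k z) \<and>
     (\<forall>k z c c'. (k, z, c) \<in> G \<longrightarrow> (k, z, c') \<in> G \<longrightarrow> c = c') \<and>
     (\<forall>k z c m. \<forall>\<alpha> \<in> delta_hom m k. (k, z, c) \<in> G \<longrightarrow> (m, Act Z m k \<alpha> z, Act C m k \<alpha> c) \<in> G)"

definition gdom :: "(nat \<times> 'z \<times> 'c) set \<Rightarrow> (nat \<times> 'z) set" where
  "gdom G = {(k, z). \<exists>c. (k, z, c) \<in> G}"

definition gval :: "(nat \<times> 'z \<times> 'c) set \<Rightarrow> nat \<Rightarrow> 'z \<Rightarrow> 'c" where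
  "gval G k z = (THE c. (k, z, c) \<in> G)"

lemma partial_mapD:
  assumes "partial_map Z p C q G"
  shows "(k, z, c) \<in> G \<Longrightarrow> z \<in> Simp Z k" "(k, z, c) \<in> G \<Longrightarrow> c \<in> Simp C k"
    "(k, z, c) \<in> G \<Longrightarrow> q k c = p k z" "(k, z, c) \<in> G \<Longrightarrow> (k, z, c') \<in> G \<Longrightarrow> c = c'"
    "(k, z, c) \<in> G \<Longrightarrow> \<alpha> \<in> delta_hom m k \<Longrightarrow> (m, Act Z m k \<alpha> z, Act C m k \<alpha> c) \<in> G"
  using assms unfolding partial_map_def by blast+

lemma gval_eq: "partial_map Z p C q G \<Longrightarrow> (k, z, c) \<in> G \<Longrightarrow> gval G k z = c"
  unfolding gval_def by (rule the_equality) (auto dest: partial_mapD)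

lemma gval_in: "partial_map Z p C q G \<Longrightarrow> (k, z) \<in> gdom G \<Longrightarrow> (k, z, gval G k z) \<in> G"
  by (auto simp: gdom_def gval_eq)

lemma gdomI: "(k, z, c) \<in> G \<Longrightarrow> (k, z) \<in> gdom G"
  by (auto simp: gdom_def)

lemma gdom_Act:
  "partial_map Z p C q G \<Longrightarrow> (k, z) \<in> gdom G \<Longrightarrow> \<alpha> \<in> delta_hom m k \<Longrightarrow> (m, Act Z m k \<alpha> z) \<in> gdom G"
  by (auto simp: gdom_def dest: partial_mapD)

text \<open>The graph, on the simplicial subset generated by \<open>x\<close>, of the map that
  classifies \<open>c\<close>. It is single-valued once distinct operators take distinct values on
  \<open>x\<close>, that is, once \<open>x\<close> is an embedded simplex.\<close>

definition orbit :: "'z sset \<Rightarrow> 'c sset \<Rightarrow> nat \<Rightarrow> 'z \<Rightarrow> 'c \<Rightarrow> (nat \<times> 'z \<times> 'c) set" where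
  "orbit Z C n x c = {(l, Act Z l n \<alpha> x, Act C l n \<alpha> c) | l \<alpha>. \<alpha> \<in> delta_hom l n}"

text \<open>By \<open>free\<close> the faces of \<open>x\<close> inherit unambiguous values from
  \<open>c\<close>, and by \<open>comp\<close> these agree with \<open>G\<close> where both are
  defined. For a cell the first comes from its vertices being distinct, the second from
  \<open>c\<close> filling its horn.\<close>

lemma partial_map_attach:
  assumes Z: "sset_over Z S p" and C: "sset_over C S q" and G: "partial_map Z p C q G"
    and x: "x \<in> Simp Z n" and c: "c \<in> Simp C n" "q n c = p n x"
    and free: "\<And>l \<alpha> \<beta>. \<alpha> \<in> delta_hom l n \<Longrightarrow> \<beta> \<in> delta_hom l n \<Longrightarrow> Act Z l n \<alpha> x = Act Z l n \<beta> x \<Longrightarrow> \<alpha> = \<beta>"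
    and comp: "\<And>l \<alpha>. \<alpha> \<in> delta_hom l n \<Longrightarrow> (l, Act Z l n \<alpha> x) \<in> gdom G \<Longrightarrow> (l, Act Z l n \<alpha> x, Act C l n \<alpha> c) \<in> G"
  shows "partial_map Z p C q (G \<union> orbit Z C n x c)"
proof -
  note Zs = sset_over.X[OF Z] sset_over.p[OF Z] and Cs = sset_over.X[OF C] sset_over.p[OF C]
  show ?thesis
    unfolding partial_map_def
  proof (intro conjI allI impI ballI)
    fix k z c' assume "(k, z, c') \<in> G \<union> orbit Z C n x c"
    then have "(k, z, c') \<in> G \<or> (\<exists>\<alpha>\<in>delta_hom k n. z = Act Z k n \<alpha> x \<and> c' = Act C k n \<alpha> c)"
      by (auto simp: orbit_def)
    then show "z \<in> Simp Z k" "c' \<in> Simp C k" "q k c' = p k z"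
      using partial_mapD[OF G] Act_in[OF Zs(1) _ x] Act_in[OF Cs(1) _ c(1)] sset_hom_nat[OF Zs(2) _ x]
        sset_hom_nat[OF Cs(2) _ c(1)] c(2) by auto
  next
    fix k z a b assume ab: "(k, z, a) \<in> G \<union> orbit Z C n x c" "(k, z, b) \<in> G \<union> orbit Z C n x c"
    have key: "\<exists>\<alpha>\<in>delta_hom k n. z = Act Z k n \<alpha> x \<and> a = Act C k n \<alpha> c"
      if "(k, z, a) \<in> orbit Z C n x c" for a
      using that by (auto simp: orbit_def)
    have GO: "a = b" if a: "(k, z, a) \<in> G" and b: "(k, z, b) \<in> orbit Z C n x c" for a b
    proof -
      obtain \<alpha> where \<alpha>: "\<alpha> \<in> delta_hom k n" "z = Act Z k n \<alpha> x" "b = Act C k n \<alpha> c" using key[OF b] by auto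
      have "(k, z, b) \<in> G" using comp[OF \<alpha>(1)] gdomI[OF a] \<alpha> by simp
      then show ?thesis using a partial_mapD(4)[OF G] by blast
    qed
    have OO: "a = b" if "(k, z, a) \<in> orbit Z C n x c" "(k, z, b) \<in> orbit Z C n x c" for a b
      using key[OF that(1)] key[OF that(2)] free by metis
    show "a = b" using ab GO[of a b] GO[of b a] OO[of a b] partial_mapD(4)[OF G, of k z a b] by blast
  next
    fix k z c' m \<alpha> assume \<alpha>: "\<alpha> \<in> delta_hom m k" and z: "(k, z, c') \<in> G \<union> orbit Z C n x c"
    show "(m, Act Z m k \<alpha> z, Act C m k \<alpha> c') \<in> G \<union> orbit Z C n x c"
    proof (cases "(k, z, c') \<in> G")
      case False
      then obtain \<beta> where \<beta>: "\<beta> \<in> delta_hom k n" "z = Act Z k n \<beta> x" "c' = Act C k n \<beta> c"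
        using z by (auto simp: orbit_def)
      then have "Act Z m k \<alpha> z = Act Z m n (compose {..m} \<beta> \<alpha>) x" "Act C m k \<alpha> c' = Act C m n (compose {..m} \<beta> \<alpha>) c"
        using Act_comp[OF Zs(1) \<alpha> \<beta>(1) x] Act_comp[OF Cs(1) \<alpha> \<beta>(1) c(1)] by simp_all
      then show ?thesis using delta_compose[OF \<beta>(1) \<alpha>] unfolding orbit_def by blast
    qed (use partial_mapD(5)[OF G _ \<alpha>] in auto)
  qed
qed

lemma partial_map_Union:
  assumes "subset.chain \<A> \<C>" "\<And>G. G \<in> \<A> \<Longrightarrow> partial_map Z p C q G"
  shows "partial_map Z p C q (\<Union>\<C>)"
proof -
  have G: "partial_map Z p C q G" if "G \<in> \<C>" for G
    using that assms by (auto simp: subset.chain_def)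
  have common: "\<exists>G\<in>\<C>. a \<in> G \<and> b \<in> G" if "a \<in> \<Union>\<C>" "b \<in> \<Union>\<C>" for a b
    using that subset.chain_total[OF assms(1)] by blast
  show ?thesis
    unfolding partial_map_def
  proof (intro conjI allI impI ballI)
    fix k z c assume "(k, z, c) \<in> \<Union>\<C>"
    then show "z \<in> Simp Z k" "c \<in> Simp C k" "q k c = p k z" using partial_mapD[OF G] by auto
  next
    fix k z c c' assume "(k, z, c) \<in> \<Union>\<C>" "(k, z, c') \<in> \<Union>\<C>"
    then show "c = c'" using common partial_mapD(4)[OF G] by metis
  next
    fix k z c m \<alpha> assume "\<alpha> \<in> delta_hom m k" "(k, z, c) \<in> \<Union>\<C>"
    then show "(m, Act Z m k \<alpha> z, Act C m k \<alpha> c) \<in> \<Union>\<C>" using partial_mapD(5)[OF G] by blast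
  qed
qed

text \<open>
  The cell \<open>(m, x, i) \<in> B\<close> is the \<open>(m + 1)\<close>-simplex \<open>x\<close>, to be attached along its horn
  \<open>\<Lambda>\<^sup>m\<^sup>+\<^sup>1\<^sub>i\<close>. Edges in \<open>E\<close> must be sent to \<open>M\<close>; they are the initial edges of the outer horns.
\<close>

locale cell_extension =
  Z: sset_over Z S p + C: sset_over C S q
  for Z :: "'z sset" and S :: "'s sset" and p and C :: "'c sset" and q +
  fixes G0 :: "(nat \<times> 'z \<times> 'c) set" and B :: "(nat \<times> 'z \<times> nat) set"
    and R :: "(nat \<times> 'z \<times> nat) rel" and E :: "'z set" and M :: "'c set"
  assumes inner: "inner_fibration C S q"
    and G0: "partial_map Z p C q G0"
    and G0_marked: "\<And>z c. (1, z, c) \<in> G0 \<Longrightarrow> z \<in> E \<Longrightarrow> c \<in> M"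
    and M: "\<And>c. c \<in> M \<Longrightarrow> lc_edge C S q c"
    and wf_R: "wf R"
    and cell: "\<And>m x i. (m, x, i) \<in> B \<Longrightarrow> x \<in> Simp Z (Suc m)" "\<And>m x i. (m, x, i) \<in> B \<Longrightarrow> i \<le> m"
    and free: "\<And>m x i l \<alpha> \<beta>. (m, x, i) \<in> B \<Longrightarrow> \<alpha> \<in> delta_hom l (Suc m) \<Longrightarrow> \<beta> \<in> delta_hom l (Suc m) \<Longrightarrow>
      Act Z l (Suc m) \<alpha> x = Act Z l (Suc m) \<beta> x \<Longrightarrow> \<alpha> = \<beta>"
    and missing: "\<And>m x i. (m, x, i) \<in> B \<Longrightarrow> (m, Act Z m (Suc m) (coface m i) x) \<notin> gdom G0"
    and faces: "\<And>m x i j. (m, x, i) \<in> B \<Longrightarrow> j \<le> Suc m \<Longrightarrow> j \<noteq> i \<Longrightarrow>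
      (m, Act Z m (Suc m) (coface m j) x) \<in> gdom G0 \<or>
      (\<exists>m' x' i'. (m', x', i') \<in> B \<and> ((m', x', i'), (m, x, i)) \<in> R \<and>
         (\<exists>\<beta>\<in>delta_hom m (Suc m'). Act Z m (Suc m) (coface m j) x = Act Z m (Suc m') \<beta> x'))"
    \<comment> \<open>Attaching \<open>(m, x, i)\<close> adds simplices outside its horn. If one of
      them were the missing face of another cell, that cell would later find more than its horn
      present.\<close>
    and separate: "\<And>m x i m' x' i' \<alpha>. (m, x, i) \<in> B \<Longrightarrow> (m', x', i') \<in> B \<Longrightarrow> \<alpha> \<in> delta_hom m' (Suc m) \<Longrightarrow>
      \<alpha> \<notin> Simp (horn (Suc m) i) m' \<Longrightarrow>
      Act Z m' (Suc m') (coface m' i') x' = Act Z m' (Suc m) \<alpha> x \<Longrightarrow> m' = m \<and> x' = x"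
    \<comment> \<open>The last alternative takes care of degenerate simplices, by induction on the
      dimension.\<close>
    and cover: "\<And>k z. z \<in> Simp Z k \<Longrightarrow> (k, z) \<in> gdom G0 \<or>
      (\<exists>m x i. (m, x, i) \<in> B \<and> (\<exists>\<alpha>\<in>delta_hom k (Suc m). z = Act Z k (Suc m) \<alpha> x)) \<or>
      (\<exists>l<k. \<exists>y\<in>Simp Z l. \<exists>\<alpha>\<in>delta_hom k l. z = Act Z k l \<alpha> y)"
    and outer: "\<And>m x. (m, x, 0) \<in> B \<Longrightarrow> Act Z 1 (Suc m) (delta_id 1) x \<in> E"
      "\<And>m x. (m, x, 0) \<in> B \<Longrightarrow>
         p (Suc m) x = Act S (Suc m) 1 (collapse (Suc m)) (p 1 (Act Z 1 (Suc m) (delta_id 1) x))"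
    \<comment> \<open>For \<open>m = 0\<close> the horn is a single vertex, so the edge is not a
      horn filler but has to be found by lifting.\<close>
    and marked_lift: "\<And>x y. (0, x, 0) \<in> B \<Longrightarrow> y \<in> Simp C 0 \<Longrightarrow> q 0 y = vertex S 1 0 (p 1 x) \<Longrightarrow>
      \<exists>c\<in>M. q 1 c = p 1 x \<and> vertex C 1 0 c = y"
    \<comment> \<open>The only new edge that may have to be marked is a one-dimensional cell itself,
      whose value is chosen in \<open>M\<close> by \<open>marked_lift\<close>.\<close>
    and new_marked: "\<And>m x i \<alpha>. (m, x, i) \<in> B \<Longrightarrow> \<alpha> \<in> delta_hom 1 (Suc m) \<Longrightarrow>
      \<alpha> \<notin> Simp (horn (Suc m) i) 1 \<Longrightarrow> Act Z 1 (Suc m) \<alpha> x \<in> E \<Longrightarrow> m = 0 \<and> \<alpha> = delta_id 1"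
begin

text \<open>
  By the last clause the missing face of a cell is never present without the cell, so that the
  part of a least unattached cell that is present is exactly its horn.
\<close>

definition good :: "(nat \<times> 'z \<times> 'c) set \<Rightarrow> bool" where
  "good G \<longleftrightarrow> G0 \<subseteq> G \<and> partial_map Z p C q G \<and> (\<forall>z c. (1, z, c) \<in> G \<longrightarrow> z \<in> E \<longrightarrow> c \<in> M) \<and>
     (\<forall>m x i. (m, x, i) \<in> B \<longrightarrow> (m, Act Z m (Suc m) (coface m i) x) \<in> gdom G \<longrightarrow> (Suc m, x) \<in> gdom G)"

lemma goodD:
  assumes "good G"
  shows "G0 \<subseteq> G" "partial_map Z p C q G" "\<And>z c. (1, z, c) \<in> G \<Longrightarrow> z \<in> E \<Longrightarrow> c \<in> M"
    "\<And>m x i. (m, x, i) \<in> B \<Longrightarrow> (m, Act Z m (Suc m) (coface m i) x) \<in> gdom G \<Longrightarrow> (Suc m, x) \<in> gdom G"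
  using assms unfolding good_def by blast+

text \<open>The bound \<open>i \<le> m\<close> excludes the last horn. Three cases are left: an
  inner horn, an outer horn whose initial edge is already known to have a locally cocartesian value,
  and a vertex as the horn of an edge.\<close>

lemma fill:
  assumes G: "good G" and B: "(m, x, i) \<in> B"
    and dom: "\<And>l \<alpha>. \<alpha> \<in> Simp (horn (Suc m) i) l \<Longrightarrow> (l, Act Z l (Suc m) \<alpha> x) \<in> gdom G"
  obtains c where "c \<in> Simp C (Suc m)" "q (Suc m) c = p (Suc m) x"
    "\<And>l \<alpha>. \<alpha> \<in> Simp (horn (Suc m) i) l \<Longrightarrow> (l, Act Z l (Suc m) \<alpha> x, Act C l (Suc m) \<alpha> c) \<in> G"
    "m = 0 \<Longrightarrow> c \<in> M"
proof -
  note fillI = that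
  note pm = goodD(2)[OF G]
  have x: "x \<in> Simp Z (Suc m)" and im: "i \<le> m" using cell[OF B] by auto
  let ?u = "\<lambda>l. \<lambda>\<alpha>\<in>Simp (horn (Suc m) i) l. gval G l (Act Z l (Suc m) \<alpha> x)"
  have uG: "(l, Act Z l (Suc m) \<alpha> x, ?u l \<alpha>) \<in> G" if "\<alpha> \<in> Simp (horn (Suc m) i) l" for l \<alpha>
    using gval_in[OF pm dom[OF that]] that by simp
  have u: "?u \<in> sset_hom (horn (Suc m) i) C"
  proof (rule sset_homI)
    show "?u l \<alpha> \<in> Simp C l" if "\<alpha> \<in> Simp (horn (Suc m) i) l" for l \<alpha>
      using partial_mapD(2)[OF pm uG[OF that]] .
    fix l k \<beta> \<alpha> assume \<beta>: "\<beta> \<in> delta_hom k l" and \<alpha>: "\<alpha> \<in> Simp (horn (Suc m) i) l"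
    have h: "compose {..k} \<alpha> \<beta> \<in> Simp (horn (Suc m) i) k" using \<alpha> \<beta> im by (intro horn_compose) auto
    have "(k, Act Z k (Suc m) (compose {..k} \<alpha> \<beta>) x, Act C k l \<beta> (?u l \<alpha>)) \<in> G"
      using partial_mapD(5)[OF pm uG[OF \<alpha>] \<beta>] Act_comp[OF Z.X \<beta> horn_delta[OF \<alpha>] x] by simp
    then have "?u k (compose {..k} \<alpha> \<beta>) = Act C k l \<beta> (?u l \<alpha>)"
      using uG[OF h] partial_mapD(4)[OF pm] by blast
    then show "?u k (Act (horn (Suc m) i) k l \<beta> \<alpha>) = Act C k l \<beta> (?u l \<alpha>)" by simp
  qed simp
  have px: "p (Suc m) x \<in> Simp S (Suc m)" using sset_hom_in[OF Z.p x] .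
  have qu: "q l (?u l \<alpha>) = Act S l (Suc m) \<alpha> (p (Suc m) x)" if "\<alpha> \<in> Simp (horn (Suc m) i) l" for l \<alpha>
    using partial_mapD(3)[OF pm uG[OF that]] sset_hom_nat[OF Z.p horn_delta[OF that] x] by simp
  have finish: thesis if "c \<in> Simp C (Suc m)" "q (Suc m) c = p (Suc m) x"
    "\<And>l \<alpha>. \<alpha> \<in> Simp (horn (Suc m) i) l \<Longrightarrow> Act C l (Suc m) \<alpha> c = ?u l \<alpha>" "m \<noteq> 0" for c
    by (rule fillI[of c]) (use that uG in auto)
  consider "0 < i" | "i = 0" "0 < m" | "i = 0" "m = 0" by auto
  then show thesis
  proof cases
    case 1
    have im': "i < Suc m" using im by simp
    show thesis
      by (rule inner_fibration_fill[OF inner 1 im' u px qu]) (use finish 1 im in auto)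
  next
    case 2
    let ?e = "Act Z 1 (Suc m) (delta_id 1) x"
    have h: "delta_id 1 \<in> Simp (horn (Suc m) i) 1" using initial_edge_horn[of "Suc m"] 2 by simp
    have B0: "(m, x, 0) \<in> B" using B 2 by simp
    have eM: "?u 1 (delta_id 1) \<in> M" using goodD(3)[OF G uG[OF h] outer(1)[OF B0]] .
    have qe: "q 1 (?u 1 (delta_id 1)) = p 1 ?e" using partial_mapD(3)[OF pm uG[OF h]] .
    have pe: "p 1 ?e \<in> Simp S 1"
      by (rule sset_hom_in[OF Z.p Act_in[OF Z.X horn_delta[OF h] x]])
    have u0: "?u \<in> sset_hom (horn (Suc m) 0) C" using u 2 by simp
    have m2: "2 \<le> Suc m" using 2 by simp
    obtain c where c: "c \<in> Simp C (Suc m)" "q (Suc m) c = Act S (Suc m) 1 (collapse (Suc m)) (q 1 (?u 1 (delta_id 1)))"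
      "\<And>l \<alpha>. \<alpha> \<in> Simp (horn (Suc m) 0) l \<Longrightarrow> Act C l (Suc m) \<alpha> c = ?u l \<alpha>"
    proof (rule lc_edgeD[OF M[OF eM] m2 u0 _ refl])
      fix l \<alpha> assume \<alpha>: "\<alpha> \<in> Simp (horn (Suc m) 0) l"
      then have "q l (?u l \<alpha>) = Act S l (Suc m) \<alpha> (Act S (Suc m) 1 (collapse (Suc m)) (p 1 ?e))"
        using qu[of \<alpha> l] 2(1) outer(2)[OF B0] by metis
      then show "q l (?u l \<alpha>) = Act S l 1 (compose {..l} (collapse (Suc m)) \<alpha>) (q 1 (?u 1 (delta_id 1)))"
        unfolding qe using Act_comp[OF C.S horn_delta[OF \<alpha>] collapse_in pe] by simp
    qed blast
    show thesis
    proof (rule finish[OF c(1)])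
      show "q (Suc m) c = p (Suc m) x" unfolding c(2) qe by (rule outer(2)[OF B0, symmetric])
      show "Act C l (Suc m) \<alpha> c = ?u l \<alpha>" if "\<alpha> \<in> Simp (horn (Suc m) i) l" for l \<alpha>
        by (rule c(3)) (use that 2 in simp)
    qed (use 2 in simp)
  next
    case 3
    have B0: "(0, x, 0) \<in> B" using B 3 by simp
    let ?v = "\<lambda>_\<in>{..0::nat}. 0::nat"
    have v: "?v \<in> Simp (horn (Suc m) i) 0"
      by (rule hornI[where j = 1]) (use 3 in auto)
    have "q 0 (?u 0 ?v) = vertex S 1 0 (p 1 x)"
      using qu[OF v] 3 by (simp add: vertex_def One_nat_def)
    moreover have "?u 0 ?v \<in> Simp C 0" using sset_hom_in[OF u v] .
    ultimately obtain c where c: "c \<in> M" "q 1 c = p 1 x" "vertex C 1 0 c = ?u 0 ?v"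
      using marked_lift[OF B0] by blast
    have c1: "c \<in> Simp C 1" using M[OF c(1)] by (rule lc_edge_in)
    \<comment> \<open>Here the horn is the vertex \<open>0\<close>, so each of its simplices is the
      degeneration along \<open>?w\<close> of \<open>?v\<close>, where \<open>c\<close> agrees with
      \<open>?u\<close> by the choice of its source.\<close>
    have "(l, Act Z l (Suc m) \<alpha> x, Act C l (Suc m) \<alpha> c) \<in> G" if \<alpha>: "\<alpha> \<in> Simp (horn (Suc m) i) l" for l \<alpha>
    proof -
      let ?w = "\<lambda>_\<in>{..l}. 0::nat"
      have w: "?w \<in> delta_hom l 0" by simp
      obtain j where "j \<le> Suc m" "j \<noteq> i" "j \<notin> \<alpha> ` {..l}"
        using hornE[OF \<alpha>] im by auto
      moreover from this have "j = 1" using 3 by (simp add: One_nat_def)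
      ultimately have "1 \<notin> \<alpha> ` {..l}" by simp
      have \<alpha>0: "\<alpha> a = 0" if "a \<le> l" for a
      proof -
        have "\<alpha> a \<le> 1" using delta_hom_le[OF horn_delta[OF \<alpha>] that] 3 by (simp add: One_nat_def)
        moreover have "\<alpha> a \<noteq> 1" using \<open>1 \<notin> \<alpha> ` {..l}\<close> that by (metis atMost_iff image_eqI)
        ultimately show ?thesis by linarith
      qed
      have "\<alpha> = compose {..l} ?v ?w"
        by (rule delta_hom_eqI[OF horn_delta[OF \<alpha>] delta_compose[OF delta_const_in[OF le0] w]])
          (simp add: compose_def \<alpha>0)
      moreover have "(l, Act Z l 0 ?w (Act Z 0 (Suc m) ?v x), Act C l 0 ?w (?u 0 ?v)) \<in> G"
        by (rule partial_mapD(5)[OF pm uG[OF v] w])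
      ultimately show ?thesis
        using Act_comp[OF Z.X w horn_delta[OF v] x] Act_comp[OF C.X w _ c1, of ?v] c(3) 3
        by (simp add: vertex_def One_nat_def)
    qed
    then show thesis using fillI[of c] c c1 3 by (simp add: One_nat_def)
  qed
qed

text \<open>By induction along \<open>R\<close> the other faces of a cell are present, hence its
  horn. If the cell were absent, \<open>good\<close> would exclude the missing face, so by
  \<open>nonhorn_section\<close> nothing outside the horn is present; a filler can then be attached,
  against maximality.\<close>

lemma cell_in_maximal:
  assumes G: "good G" and max: "\<And>G'. good G' \<Longrightarrow> G \<subseteq> G' \<Longrightarrow> G' = G"
    and B: "(m, x, i) \<in> B"
  shows "(Suc m, x) \<in> gdom G"
  using B
proof (induction "(m, x, i)" arbitrary: m x i rule: wf_induct_rule[OF wf_R])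
  case (1 m x i)
  note pm = goodD(2)[OF G]
  have B: "(m, x, i) \<in> B" by fact
  have x: "x \<in> Simp Z (Suc m)" and im: "i \<le> m" using cell[OF B] by auto
  then have iSm: "i \<le> Suc m" by simp
  show ?case
  proof (rule ccontr)
    assume no: "(Suc m, x) \<notin> gdom G"
    have face: "(m, Act Z m (Suc m) (coface m j) x) \<in> gdom G" if j: "j \<le> Suc m" "j \<noteq> i" for j
      using faces[OF B j]
    proof
      assume "(m, Act Z m (Suc m) (coface m j) x) \<in> gdom G0"
      then show ?thesis using goodD(1)[OF G] by (auto simp: gdom_def)
    next
      assume "\<exists>m' x' i'. (m', x', i') \<in> B \<and> ((m', x', i'), (m, x, i)) \<in> R \<and>
         (\<exists>\<beta>\<in>delta_hom m (Suc m'). Act Z m (Suc m) (coface m j) x = Act Z m (Suc m') \<beta> x')"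
      then obtain m' x' i' \<beta> where *: "(m', x', i') \<in> B" "((m', x', i'), (m, x, i)) \<in> R"
        "\<beta> \<in> delta_hom m (Suc m')" "Act Z m (Suc m) (coface m j) x = Act Z m (Suc m') \<beta> x'" by blast
      have "(Suc m', x') \<in> gdom G" using 1(1)[OF *(2,1)] .
      then show ?thesis using gdom_Act[OF pm _ *(3)] *(4) by simp
    qed
    have dom: "(l, Act Z l (Suc m) \<alpha> x) \<in> gdom G" if \<alpha>: "\<alpha> \<in> Simp (horn (Suc m) i) l" for l \<alpha>
    proof -
      obtain j \<beta> where "j \<le> Suc m" "j \<noteq> i" and \<beta>: "\<beta> \<in> delta_hom l m" "\<alpha> = compose {..l} (coface m j) \<beta>"
        using horn_factor[OF \<alpha> iSm] .
      then have "(l, Act Z l m \<beta> (Act Z m (Suc m) (coface m j) x)) \<in> gdom G"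
        using gdom_Act[OF pm face] by blast
      then show ?thesis using Act_comp[OF Z.X \<beta>(1) coface_in x] \<beta>(2) by simp
    qed
    obtain c where c: "c \<in> Simp C (Suc m)" "q (Suc m) c = p (Suc m) x"
      "\<And>l \<alpha>. \<alpha> \<in> Simp (horn (Suc m) i) l \<Longrightarrow> (l, Act Z l (Suc m) \<alpha> x, Act C l (Suc m) \<alpha> c) \<in> G"
      "m = 0 \<Longrightarrow> c \<in> M"
      using fill[OF G B dom] by blast
    have miss: "(l, Act Z l (Suc m) \<alpha> x) \<notin> gdom G"
      if \<alpha>: "\<alpha> \<in> delta_hom l (Suc m)" "\<alpha> \<notin> Simp (horn (Suc m) i) l" for l \<alpha>
    proof
      assume in': "(l, Act Z l (Suc m) \<alpha> x) \<in> gdom G"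
      obtain \<beta> where \<beta>: "\<beta> \<in> delta_hom m l" "compose {..m} \<alpha> \<beta> = coface m i"
        using nonhorn_section[OF \<alpha> iSm] .
      have "(m, Act Z m (Suc m) (coface m i) x) \<in> gdom G"
        using gdom_Act[OF pm in' \<beta>(1)] Act_comp[OF Z.X \<beta>(1) \<alpha>(1) x] \<beta>(2) by simp
      then show False using goodD(4)[OF G B] no by simp
    qed
    let ?O = "orbit Z C (Suc m) x c"
    have pm': "partial_map Z p C q (G \<union> ?O)"
      by (rule partial_map_attach[OF Z.sset_over_axioms C.sset_over_axioms pm x c(1,2) free[OF B]])
        (use c(3) miss in blast)+
    have xO: "(Suc m, x, c) \<in> ?O"
      using Act_id[OF Z.X x] Act_id[OF C.X c(1)] unfolding orbit_def
      by (intro CollectI exI[of _ "Suc m"] exI[of _ "delta_id (Suc m)"]) auto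
    have "good (G \<union> ?O)"
      unfolding good_def
    proof (intro conjI allI impI pm')
      show "G0 \<subseteq> G \<union> ?O" using goodD(1)[OF G] by auto
    next
      fix z a assume "(1, z, a) \<in> G \<union> ?O" "z \<in> E"
      show "a \<in> M"
      proof (cases "(1, z, a) \<in> G")
        case True
        then show ?thesis using goodD(3)[OF G] \<open>z \<in> E\<close> by blast
      next
        case False
        then obtain \<alpha> where \<alpha>: "\<alpha> \<in> delta_hom 1 (Suc m)" "z = Act Z 1 (Suc m) \<alpha> x" "a = Act C 1 (Suc m) \<alpha> c"
          using \<open>(1, z, a) \<in> G \<union> ?O\<close> by (auto simp: orbit_def)
        have "\<alpha> \<notin> Simp (horn (Suc m) i) 1" using c(3) False \<alpha> by blast
        then have *: "m = 0" "\<alpha> = delta_id 1" using new_marked[OF B \<alpha>(1)] \<alpha>(2) \<open>z \<in> E\<close> by auto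
        have "a = c" unfolding \<alpha>(3) *(2) using Act_id[OF C.X c(1)] *(1) by (simp add: One_nat_def)
        then show ?thesis using c(4) * by simp
      qed
    next
      fix m' x' i' assume B': "(m', x', i') \<in> B"
        and d: "(m', Act Z m' (Suc m') (coface m' i') x') \<in> gdom (G \<union> ?O)"
      show "(Suc m', x') \<in> gdom (G \<union> ?O)"
      proof (cases "(m', Act Z m' (Suc m') (coface m' i') x') \<in> gdom G")
        case True
        then show ?thesis using goodD(4)[OF G B'] by (auto simp: gdom_def)
      next
        case False
        then obtain \<alpha> where \<alpha>: "\<alpha> \<in> delta_hom m' (Suc m)"
          "Act Z m' (Suc m') (coface m' i') x' = Act Z m' (Suc m) \<alpha> x"
          using d by (auto simp: gdom_def orbit_def)
        \<comment> \<open>A missing face that appears only now cannot come from the horn of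
          \<open>x\<close>, which was present before; by \<open>separate\<close> it belongs to
          \<open>x\<close> itself.\<close>
        have "\<alpha> \<notin> Simp (horn (Suc m) i) m'" using dom False \<alpha>(2) by metis
        then have "m' = m \<and> x' = x" using separate[OF B B' \<alpha>(1) _ \<alpha>(2)] by blast
        then show ?thesis using xO by (auto simp: gdom_def)
      qed
    qed
    then have "G \<union> ?O = G" using max by blast
    then show False using xO no by (auto simp: gdom_def)
  qed
qed

text \<open>A nonempty chain of \<open>good\<close> graphs has a \<open>good\<close> union, since
  each condition concerns at most two triples at a time. A maximal graph contains all cells, and any
  other simplex lies in the start, in a cell, or is degenerate.\<close>

theorem extension:
  obtains f where "f \<in> sset_hom Z C" "\<And>k z. z \<in> Simp Z k \<Longrightarrow> q k (f k z) = p k z"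
    "\<And>k z c. (k, z, c) \<in> G0 \<Longrightarrow> f k z = c" "\<And>z. z \<in> Simp Z 1 \<Longrightarrow> z \<in> E \<Longrightarrow> f 1 z \<in> M"
proof -
  have g0: "good G0" unfolding good_def using G0 G0_marked missing by auto
  have "\<exists>G\<in>Collect good. \<forall>X\<in>Collect good. G \<subseteq> X \<longrightarrow> X = G"
  proof (rule subset_Zorn_nonempty)
    show "Collect good \<noteq> {}" using g0 by auto
    fix \<C> assume ne: "\<C> \<noteq> {}" and ch: "subset.chain (Collect good) \<C>"
    have g: "good G" if "G \<in> \<C>" for G using that ch by (auto simp: subset.chain_def)
    have "good (\<Union>\<C>)"
      unfolding good_def
    proof (intro conjI allI impI)
      show "G0 \<subseteq> \<Union>\<C>" using ne goodD(1)[OF g] by blast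
      show "partial_map Z p C q (\<Union>\<C>)" by (rule partial_map_Union[OF ch]) (use goodD(2) in auto)
      show "c \<in> M" if "(1, z, c) \<in> \<Union>\<C>" "z \<in> E" for z c using goodD(3)[OF g] that by blast
      fix m x i assume "(m, x, i) \<in> B" "(m, Act Z m (Suc m) (coface m i) x) \<in> gdom (\<Union>\<C>)"
      then obtain G where G: "G \<in> \<C>" "(m, Act Z m (Suc m) (coface m i) x) \<in> gdom G" by (auto simp: gdom_def)
      have "(Suc m, x) \<in> gdom G" using goodD(4)[OF g[OF G(1)] \<open>(m, x, i) \<in> B\<close> G(2)] .
      then show "(Suc m, x) \<in> gdom (\<Union>\<C>)" using G(1) by (auto simp: gdom_def)
    qed
    then show "\<Union>\<C> \<in> Collect good" by simp
  qed
  then obtain G where G: "good G" and max: "\<And>G'. good G' \<Longrightarrow> G \<subseteq> G' \<Longrightarrow> G' = G" by blast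
  note pm = goodD(2)[OF G]
  have total: "(k, z) \<in> gdom G" if "z \<in> Simp Z k" for k z
    using that
  proof (induction k arbitrary: z rule: less_induct)
    case (less k)
    consider "(k, z) \<in> gdom G0" | m x i \<alpha> where "(m, x, i) \<in> B" "\<alpha> \<in> delta_hom k (Suc m)" "z = Act Z k (Suc m) \<alpha> x"
      | l y \<alpha> where "l < k" "y \<in> Simp Z l" "\<alpha> \<in> delta_hom k l" "z = Act Z k l \<alpha> y"
      using cover[OF less.prems] by blast
    then show ?case
    proof cases
      case 1
      then show ?thesis using goodD(1)[OF G] by (auto simp: gdom_def)
    next
      case 2
      then show ?thesis using gdom_Act[OF pm cell_in_maximal[OF G max]] by blast
    next
      case 3
      then show ?thesis using gdom_Act[OF pm less.IH] by blast
    qed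
  qed
  let ?f = "\<lambda>k. \<lambda>z\<in>Simp Z k. gval G k z"
  have fG: "(k, z, ?f k z) \<in> G" if "z \<in> Simp Z k" for k z
    using gval_in[OF pm total[OF that]] that by simp
  show ?thesis
  proof (rule that)
    show "?f \<in> sset_hom Z C"
    proof (rule sset_homI)
      show "?f k z \<in> Simp C k" if "z \<in> Simp Z k" for k z using partial_mapD(2)[OF pm fG[OF that]] .
      fix m k \<alpha> z assume \<alpha>: "\<alpha> \<in> delta_hom m k" and z: "z \<in> Simp Z k"
      show "?f m (Act Z m k \<alpha> z) = Act C m k \<alpha> (?f k z)"
        using partial_mapD(4)[OF pm fG[OF Act_in[OF Z.X \<alpha> z]] partial_mapD(5)[OF pm fG[OF z] \<alpha>]] .
    qed simp
    show "q k (?f k z) = p k z" if "z \<in> Simp Z k" for k z using partial_mapD(3)[OF pm fG[OF that]] .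
    show "?f 1 z \<in> M" if "z \<in> Simp Z 1" "z \<in> E" for z using goodD(3)[OF G fG[OF that(1)] that(2)] .
    fix k z c assume *: "(k, z, c) \<in> G0"
    then have "z \<in> Simp Z k" "(k, z, c) \<in> G" using partial_mapD(1)[OF G0] goodD(1)[OF G] by auto
    then show "?f k z = c" using partial_mapD(4)[OF pm fG] by blast
  qed
qed

end

section \<open>Degenerate edges\<close>

definition codegeneracy :: "nat \<Rightarrow> nat \<Rightarrow> nat \<Rightarrow> nat" where
  "codegeneracy m j = (\<lambda>k\<in>{..Suc m}. if k \<le> j then k else k - 1)"

lemma codegeneracy_in [simp, intro]: "j \<le> m \<Longrightarrow> codegeneracy m j \<in> delta_hom (Suc m) m"
  by (rule delta_homI) (auto simp: codegeneracy_def)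

text \<open>Stated for bare functions, so that it applies to operators and, with the same
  \<open>j\<close>, to both components of a chain in a product.\<close>

lemma degenerate_factor:
  assumes "f \<in> extensional {..Suc m}" "f j = f (Suc j)" "j \<le> m"
  shows "f = compose {..Suc m} (compose {..m} f (coface m j)) (codegeneracy m j)"
proof (rule extensionalityI[OF assms(1) compose_extensional])
  fix k assume "k \<in> {..Suc m}"
  then show "f k = compose {..Suc m} (compose {..m} f (coface m j)) (codegeneracy m j) k"
    using assms by (cases "k = Suc j") (auto simp: compose_def coface_def codegeneracy_def)
qed

definition insert_at :: "nat \<Rightarrow> nat \<Rightarrow> 'a \<Rightarrow> (nat \<Rightarrow> 'a) \<Rightarrow> nat \<Rightarrow> 'a" where
  "insert_at m i a f = (\<lambda>j\<in>{..Suc m}. if j < i then f j else if j = i then a else f (j - 1))"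

lemma insert_at_coface:
  assumes "f \<in> extensional {..m}" "i \<le> Suc m"
  shows "compose {..m} (insert_at m i a f) (coface m i) = f"
proof (rule extensionalityI[OF compose_extensional assms(1)])
  fix k assume "k \<in> {..m}"
  then show "compose {..m} (insert_at m i a f) (coface m i) k = f k"
    using assms by (auto simp: compose_def coface_def insert_at_def)
qed

lemma delta_strict:
  assumes "z \<in> delta_hom k n" "\<And>j. j < k \<Longrightarrow> z j \<noteq> z (Suc j)" "i < j" "j \<le> k"
  shows "z i < z j"
proof -
  have "z i \<le> z (Suc i)" using assms by (intro delta_hom_mono[OF assms(1)]) auto
  moreover have "z (Suc i) \<le> z j" using assms by (intro delta_hom_mono[OF assms(1)]) auto
  ultimately show ?thesis using assms(2)[of i] assms(3,4) by linarith
qed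

lemma strict_imp_inj:
  fixes f :: "nat \<Rightarrow> nat"
  assumes "\<And>i j. i < j \<Longrightarrow> j \<le> m \<Longrightarrow> f i < f j"
  shows "inj_on f {..m}"
proof (rule inj_onI)
  fix i j assume "i \<in> {..m}" "j \<in> {..m}" "f i = f j"
  then show "i = j" using assms[of i j] assms[of j i] by (cases i j rule: linorder_cases) auto
qed

lemma compose_inj_cancel:
  assumes "inj_on x {..n}" "\<alpha> \<in> delta_hom l n" "\<beta> \<in> delta_hom l n" "compose {..l} x \<alpha> = compose {..l} x \<beta>"
  shows "\<alpha> = \<beta>"
proof (rule delta_hom_eqI[OF assms(2,3)])
  fix i assume i: "i \<le> l"
  then have "x (\<alpha> i) = x (\<beta> i)" using fun_cong[OF assms(4), of i] by (simp add: compose_def)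
  then show "\<alpha> i = \<beta> i" using assms(1) delta_hom_le[OF assms(2) i] delta_hom_le[OF assms(3) i] by (auto dest: inj_onD)
qed

lemma compose_inj_imp_inj:
  "inj_on (compose {..l} x \<alpha>) {..l} \<Longrightarrow> inj_on \<alpha> {..l}"
  by (auto simp: inj_on_def compose_def)

text \<open>
  Let \<open>k : w \<rightarrow> x\<close> be locally cocartesian over \<open>s\<close>. A horn \<open>\<Lambda>\<^sup>n\<^sub>0\<close> whose initial edge is degenerate
  at \<open>x\<close> is placed on the vertices \<open>1, \<dots>, n + 1\<close> of \<open>\<Delta>\<^sup>n\<^sup>+\<^sup>1\<close>, and \<open>k\<close> on the edges from \<open>0\<close> to
  \<open>1\<close> and \<open>2\<close>. A cell is a face containing \<open>0\<close> and a vertex above \<open>2\<close>: those containing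
  \<open>{2..n+1}\<close> are attached along a \<open>0\<close>-horn with initial edge \<open>k\<close>, and the others, provided
  that they contain \<open>1\<close>, along an inner horn.
\<close>

locale degenerate_horn = sset_over C S q for C :: "'c sset" and S :: "'s sset" and q +
  fixes k n u
  assumes inner: "inner_fibration C S q" and k: "lc_edge C S q k" and n: "2 \<le> n"
    and u: "u \<in> sset_hom (horn n 0) C"
    and qu: "\<And>m \<alpha>. \<alpha> \<in> Simp (horn n 0) m \<Longrightarrow> q m (u m \<alpha>) = Act S m 1 (\<lambda>_\<in>{..m}. 1) (q 1 k)"
    and u_init: "u 1 (delta_id 1) = Act C 1 1 (\<lambda>_\<in>{..1}. 1) k"
begin

abbreviation "\<Delta> \<equiv> std_simplex (Suc n)"

definition base :: "nat \<Rightarrow> (nat \<Rightarrow> nat) \<Rightarrow> 's" where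
  "base = yoneda S (Suc n) (Act S (Suc n) 1 (collapse (Suc n)) (q 1 k))"

text \<open>Identifies the face on the vertices \<open>1, ..., n + 1\<close> with
  \<open>[n]\<close>. Truncated subtraction also sends \<open>0\<close> to \<open>0\<close>, so
  \<open>start\<close> guards it by \<open>0 < \<alpha> 0\<close>.\<close>

definition shift :: "nat \<Rightarrow> (nat \<Rightarrow> nat) \<Rightarrow> nat \<Rightarrow> nat" where
  "shift m \<alpha> = (\<lambda>i\<in>{..m}. \<alpha> i - 1)"

text \<open>The first part is the triangle on the vertices \<open>0, 1, 2\<close>, the degeneration
  of \<open>k\<close> that collapses the edge from \<open>1\<close> to \<open>2\<close>; the
  condition \<open>\<alpha> m \<le> 2\<close> says that the operator lands there. The second part is
  the shifted horn.\<close>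

definition start :: "(nat \<times> (nat \<Rightarrow> nat) \<times> 'c) set" where
  "start = {(m, \<alpha>, Act C m 1 (compose {..m} (collapse (Suc n)) \<alpha>) k) | m \<alpha>.
              \<alpha> \<in> delta_hom m (Suc n) \<and> \<alpha> m \<le> 2} \<union>
           {(m, \<alpha>, u m (shift m \<alpha>)) | m \<alpha>. \<alpha> \<in> delta_hom m (Suc n) \<and> 0 < \<alpha> 0 \<and> shift m \<alpha> \<in> Simp (horn n 0) m}"

text \<open>For an operator avoiding \<open>0\<close> this says that its shift lies outside the
  horn.\<close>

definition full :: "nat \<Rightarrow> (nat \<Rightarrow> nat) \<Rightarrow> bool" where
  "full m x \<longleftrightarrow> {2..Suc n} \<subseteq> x ` {..m}"

definition cells :: "(nat \<times> (nat \<Rightarrow> nat) \<times> nat) set" where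
  "cells = {(m, x, i). x \<in> delta_hom (Suc m) (Suc n) \<and> (\<forall>i j. i < j \<longrightarrow> j \<le> Suc m \<longrightarrow> x i < x j) \<and>
     x 0 = 0 \<and> 2 < x (Suc m) \<and> (if full (Suc m) x then i = 0 else i = 1 \<and> x 1 = 1)}"

section \<open>The starting data and the matching of the missing faces of the
  \<open>n + 1\<close>-simplex\<close>

lemma kC: "k \<in> Simp C 1" using lc_edge_in[OF k] .

lemma qk: "q 1 k \<in> Simp S 1" using sset_hom_in[OF p kC] .

lemma base_hom: "base \<in> sset_hom \<Delta> S"
  unfolding base_def by (rule yoneda_hom[OF S Act_in[OF S collapse_in qk]])

lemma base_apply: "\<alpha> \<in> delta_hom m (Suc n) \<Longrightarrow> base m \<alpha> = Act S m 1 (compose {..m} (collapse (Suc n)) \<alpha>) (q 1 k)"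
  unfolding base_def yoneda_def by (simp add: Act_comp[OF S _ collapse_in qk])

lemma shift_in:
  assumes "\<alpha> \<in> delta_hom m (Suc N)"
  shows "shift m \<alpha> \<in> delta_hom m N"
proof (rule delta_homI)
  fix i assume "i \<le> m"
  then show "shift m \<alpha> i \<le> N" using delta_hom_le[OF assms, of i] by (simp add: shift_def)
next
  fix i j assume "i \<le> j" "j \<le> m"
  then show "shift m \<alpha> i \<le> shift m \<alpha> j" using delta_hom_mono[OF assms, of i j] by (simp add: shift_def)
qed (simp add: shift_def)

lemma shift_compose:
  "\<beta> \<in> delta_hom l m \<Longrightarrow> shift l (compose {..l} \<alpha> \<beta>) = compose {..l} (shift m \<alpha>) \<beta>"
  by (rule ext) (auto simp: shift_def compose_def delta_hom_le)

lemma collapse_pos: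
  assumes "\<alpha> \<in> delta_hom m (Suc n)" "0 < \<alpha> 0"
  shows "compose {..m} (collapse (Suc n)) \<alpha> = (\<lambda>_\<in>{..m}. 1)"
proof
  fix i show "compose {..m} (collapse (Suc n)) \<alpha> i = (\<lambda>_\<in>{..m}. 1) i"
    using delta_hom_le[OF assms(1), of i] delta_hom_mono[OF assms(1), of 0 i] assms(2)
    by (auto simp: compose_def collapse_def min_def One_nat_def)
qed

text \<open>The two parts meet in the edge from \<open>1\<close> to \<open>2\<close>. There the
  degenerate triangle has the identity at the target of \<open>k\<close>, and so does the horn, by
  \<open>u_init\<close>.\<close>

lemma start_overlap:
  assumes \<alpha>: "\<alpha> \<in> delta_hom m (Suc n)" "\<alpha> m \<le> 2" "0 < \<alpha> 0" "shift m \<alpha> \<in> Simp (horn n 0) m"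
  shows "u m (shift m \<alpha>) = Act C m 1 (compose {..m} (collapse (Suc n)) \<alpha>) k"
proof -
  have le: "\<alpha> i \<le> 2" if "i \<le> m" for i using delta_hom_mono[OF \<alpha>(1) that] \<alpha>(2) by simp
  have "\<alpha> \<in> delta_hom m (Suc 1)"
    by (rule delta_homI) (use le delta_hom_mono[OF \<alpha>(1)] delta_hom_ext[OF \<alpha>(1)] in \<open>auto simp: One_nat_def numeral_2_eq_2\<close>)
  then have s1: "shift m \<alpha> \<in> delta_hom m 1" by (rule shift_in)
  have "compose {..m} (delta_id 1) (shift m \<alpha>) = shift m \<alpha>" using s1 by simp
  then have "u m (shift m \<alpha>) = Act C m 1 (shift m \<alpha>) (u 1 (delta_id 1))"
    using sset_hom_nat[OF u s1 initial_edge_horn[OF n]] by simp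
  also have "\<dots> = Act C m 1 (compose {..m} (\<lambda>_\<in>{..1}. 1) (shift m \<alpha>)) k"
    unfolding u_init by (rule Act_comp[OF X s1 _ kC]) simp
  also have "compose {..m} (\<lambda>_\<in>{..1}. 1) (shift m \<alpha>) = compose {..m} (collapse (Suc n)) \<alpha>"
    unfolding collapse_pos[OF \<alpha>(1,3)] by (rule compose_const[OF s1])
  finally show ?thesis .
qed

lemma start_dom:
  "(m, \<alpha>) \<in> gdom start \<longleftrightarrow> \<alpha> \<in> delta_hom m (Suc n) \<and> (\<alpha> m \<le> 2 \<or> 0 < \<alpha> 0 \<and> shift m \<alpha> \<in> Simp (horn n 0) m)"
  by (auto simp: gdom_def start_def)

lemma start_map: "partial_map \<Delta> base C q start"
  unfolding partial_map_def
proof (intro conjI allI impI ballI)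
  fix m \<alpha> c assume "(m, \<alpha>, c) \<in> start"
  then consider "\<alpha> \<in> delta_hom m (Suc n)" "\<alpha> m \<le> 2" "c = Act C m 1 (compose {..m} (collapse (Suc n)) \<alpha>) k"
    | "\<alpha> \<in> delta_hom m (Suc n)" "0 < \<alpha> 0" "shift m \<alpha> \<in> Simp (horn n 0) m" "c = u m (shift m \<alpha>)"
    by (auto simp: start_def)
  note cs = this
  show "\<alpha> \<in> Simp \<Delta> m" by (rule cs) auto
  show "c \<in> Simp C m" by (rule cs) (auto intro!: Act_in[OF X _ kC] sset_hom_in[OF u])
  show "q m c = base m \<alpha>"
  proof (rule cs)
    assume *: "\<alpha> \<in> delta_hom m (Suc n)" "c = Act C m 1 (compose {..m} (collapse (Suc n)) \<alpha>) k"
    then show ?thesis using sset_hom_nat[OF p delta_compose[OF collapse_in *(1)] kC] by (simp add: base_apply)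
  next
    assume "\<alpha> \<in> delta_hom m (Suc n)" "0 < \<alpha> 0" "shift m \<alpha> \<in> Simp (horn n 0) m" "c = u m (shift m \<alpha>)"
    then show ?thesis using qu[of "shift m \<alpha>" m] by (simp add: base_apply collapse_pos)
  qed
  fix l \<beta> assume \<beta>: "\<beta> \<in> delta_hom l m"
  show "(l, Act \<Delta> l m \<beta> \<alpha>, Act C l m \<beta> c) \<in> start"
  proof (rule cs)
    assume *: "\<alpha> \<in> delta_hom m (Suc n)" "\<alpha> m \<le> 2" "c = Act C m 1 (compose {..m} (collapse (Suc n)) \<alpha>) k"
    have "\<alpha> (\<beta> l) \<le> 2" using delta_hom_mono[OF *(1) delta_hom_le[OF \<beta>, of l]] *(2) by simp
    then have "compose {..l} \<alpha> \<beta> \<in> delta_hom l (Suc n) \<and> compose {..l} \<alpha> \<beta> l \<le> 2"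
      using *(1) \<beta> by (auto simp: compose_eq)
    moreover have "Act C l m \<beta> c = Act C l 1 (compose {..l} (collapse (Suc n)) (compose {..l} \<alpha> \<beta>)) k"
      using Act_comp[OF X \<beta> delta_compose[OF collapse_in *(1)] kC] *(3) by (simp add: delta_compose_assoc[OF \<beta>])
    ultimately show ?thesis unfolding start_def by auto
  next
    assume *: "\<alpha> \<in> delta_hom m (Suc n)" "0 < \<alpha> 0" "shift m \<alpha> \<in> Simp (horn n 0) m" "c = u m (shift m \<alpha>)"
    have "0 < \<alpha> (\<beta> 0)" using delta_hom_mono[OF *(1) _ delta_hom_le[OF \<beta>, of 0], of 0] *(2) by simp
    then have "compose {..l} \<alpha> \<beta> \<in> delta_hom l (Suc n) \<and> 0 < compose {..l} \<alpha> \<beta> 0"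
      using *(1) \<beta> by (auto simp: compose_eq)
    moreover have "shift l (compose {..l} \<alpha> \<beta>) \<in> Simp (horn n 0) l"
      using horn_compose[OF *(3) \<beta>] shift_compose[OF \<beta>] by simp
    moreover have "Act C l m \<beta> c = u l (shift l (compose {..l} \<alpha> \<beta>))"
      using sset_hom_nat[OF u \<beta> *(3)] *(4) shift_compose[OF \<beta>] by simp
    ultimately show ?thesis unfolding start_def by auto
  qed
next
  fix m \<alpha> c c' assume "(m, \<alpha>, c) \<in> start" "(m, \<alpha>, c') \<in> start"
  then show "c = c'" using start_overlap[of \<alpha> m] unfolding start_def by auto
qed

lemma cellsD:
  assumes "(m, x, i) \<in> cells"
  shows "x \<in> delta_hom (Suc m) (Suc n)" "\<And>i j. i < j \<Longrightarrow> j \<le> Suc m \<Longrightarrow> x i < x j" "x 0 = 0" "2 < x (Suc m)"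
    "full (Suc m) x \<and> i = 0 \<or> \<not> full (Suc m) x \<and> i = 1 \<and> x 1 = 1 \<and> 1 \<le> m" "inj_on x {..Suc m}"
proof -
  show *: "x \<in> delta_hom (Suc m) (Suc n)" "\<And>i j. i < j \<Longrightarrow> j \<le> Suc m \<Longrightarrow> x i < x j" "x 0 = 0" "2 < x (Suc m)"
    using assms by (auto simp: cells_def)
  show "full (Suc m) x \<and> i = 0 \<or> \<not> full (Suc m) x \<and> i = 1 \<and> x 1 = 1 \<and> 1 \<le> m"
    using assms *(4) by (cases m) (auto simp: cells_def One_nat_def split: if_splits)
  show "inj_on x {..Suc m}" by (rule strict_imp_inj) (rule *(2))
qed

lemma cellsI:
  assumes "x \<in> delta_hom (Suc m) (Suc n)" "\<And>i j. i < j \<Longrightarrow> j \<le> Suc m \<Longrightarrow> x i < x j" "x 0 = 0" "2 < x (Suc m)"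
    "full (Suc m) x \<and> i = 0 \<or> \<not> full (Suc m) x \<and> i = 1 \<and> x 1 = 1"
  shows "(m, x, i) \<in> cells"
  using assms by (auto simp: cells_def)

lemma insert_at_strict:
  assumes z: "z \<in> delta_hom m (Suc n)" "\<forall>i j. i < j \<longrightarrow> j \<le> m \<longrightarrow> z i < z j"
    and a: "a \<le> Suc n" "i \<le> Suc m" "\<And>j. j < i \<Longrightarrow> z j < a" "\<And>j. i \<le> j \<Longrightarrow> j \<le> m \<Longrightarrow> a < z j"
  shows "insert_at m i a z \<in> delta_hom (Suc m) (Suc n)"
    "\<And>j l. j < l \<Longrightarrow> l \<le> Suc m \<Longrightarrow> insert_at m i a z j < insert_at m i a z l"
proof -
  show *: "insert_at m i a z j < insert_at m i a z l" if "j < l" "l \<le> Suc m" for j l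
    using that z(2)[rule_format, of j l] z(2)[rule_format, of j "l - 1"]
      z(2)[rule_format, of "j - 1" "l - 1"] a(2) a(3)[of j] a(4)[of "l - 1"]
    by (auto simp: insert_at_def)
  show "insert_at m i a z \<in> delta_hom (Suc m) (Suc n)"
  proof (rule delta_homI)
    fix j assume "j \<le> Suc m"
    then show "insert_at m i a z j \<le> Suc n"
      using a(1,2) delta_hom_le[OF z(1), of j] delta_hom_le[OF z(1), of "j - 1"] by (auto simp: insert_at_def)
  next
    fix j l assume "j \<le> l" "l \<le> Suc m"
    then show "insert_at m i a z j \<le> insert_at m i a z l" using *[of j l] by (cases "j = l") auto
  qed (simp add: insert_at_def)
qed

text \<open>The matching: a missing face containing \<open>{2..Suc n}\<close> is paired by adding or
  removing the vertex \<open>0\<close>; any other missing face contains \<open>0\<close> and is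
  paired by adding or removing the vertex \<open>1\<close>.\<close>

lemma classify:
  assumes z: "z \<in> delta_hom m (Suc n)" "\<forall>i j. i < j \<longrightarrow> j \<le> m \<longrightarrow> z i < z j" "(m, z) \<notin> gdom start"
  obtains (cell) l i where "m = Suc l" "(l, z, i) \<in> cells"
  | (face0) x where "0 < z 0" "(m, x, 0) \<in> cells" "z = compose {..m} x (coface m 0)"
  | (face1) x where "z 0 = 0" "z 1 \<noteq> 1" "\<not> full m z" "(m, x, 1) \<in> cells" "z = compose {..m} x (coface m 1)"
proof -
  have big: "2 < z m" and sh: "0 < z 0 \<Longrightarrow> shift m z \<notin> Simp (horn n 0) m" using z(1,3) start_dom by auto
  have zext: "z \<in> extensional {..m}" using delta_hom_ext[OF z(1)] .
  have image_ins: "z ` {..m} \<subseteq> insert_at m i a z ` {..Suc m}" if "i \<le> Suc m" for i a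
  proof
    fix b assume "b \<in> z ` {..m}"
    then obtain j where j: "j \<le> m" "b = z j" by auto
    show "b \<in> insert_at m i a z ` {..Suc m}"
      by (rule image_eqI[of _ _ "if j < i then j else Suc j"]) (use j in \<open>auto simp: insert_at_def\<close>)
  qed
  show thesis
  proof (cases "z 0 = 0")
    case False
    then have z0: "0 < z 0" by simp
    have sd: "shift m z \<in> delta_hom m n" by (rule shift_in[OF z(1)])
    have im: "{..n} - {0} \<subseteq> shift m z ` {..m}" by (rule nonhorn_image[OF sd sh[OF z0]])
    have fl: "full m z"
      unfolding full_def
    proof
      fix a assume "a \<in> {2..Suc n}"
      then have "a - 1 \<in> shift m z ` {..m}" using im by auto
      then obtain j where j: "j \<le> m" "a - 1 = z j - 1" by (auto simp: shift_def)
      have "0 < z j" using z0 z(2)[rule_format, of 0 j] j by (cases "j = 0") auto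
      then have "a = z j" using j \<open>a \<in> {2..Suc n}\<close> by auto
      then show "a \<in> z ` {..m}" using j by auto
    qed
    let ?x = "insert_at m 0 0 z"
    have pos: "0 < z j" if "j \<le> m" for j using z0 z(2)[rule_format, of 0 j] that by (cases "j = 0") auto
    have "(m, ?x, 0) \<in> cells"
    proof (rule cellsI)
      show "?x \<in> delta_hom (Suc m) (Suc n)" "\<And>i j. i < j \<Longrightarrow> j \<le> Suc m \<Longrightarrow> ?x i < ?x j"
        using insert_at_strict[OF z(1,2), of 0 0] pos by auto
      show "?x 0 = 0" "2 < ?x (Suc m)" using big by (auto simp: insert_at_def)
      show "full (Suc m) ?x \<and> 0 = 0 \<or> \<not> full (Suc m) ?x \<and> 0 = 1 \<and> ?x 1 = 1"
        using fl image_ins[of 0 0] by (auto simp: full_def)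
    qed
    then show thesis using face0[of ?x] z0 insert_at_coface[OF zext, of 0 0] by simp
  next
    case z0: True
    then obtain l where l: "m = Suc l" using big by (cases m) auto
    show thesis
    proof (cases "full m z \<or> z 1 = 1")
      case True
      have "(l, z, if full m z then 0 else 1) \<in> cells"
        by (rule cellsI) (use True l z z0 big in auto)
      with l show thesis by (rule cell)
    next
      case False
      let ?x = "insert_at m 1 1 z"
      have ge: "1 < z j" if "1 \<le> j" "j \<le> m" for j
      proof -
        have "z 1 \<le> z j" using that by (intro delta_hom_mono[OF z(1)]) auto
        moreover have "z 0 < z 1" using z(2)[rule_format, of 0 1] l by (simp add: One_nat_def)
        ultimately show ?thesis using False z0 by linarith
      qed
      have "(m, ?x, 1) \<in> cells"
      proof (rule cellsI)
        show "?x \<in> delta_hom (Suc m) (Suc n)" "\<And>i j. i < j \<Longrightarrow> j \<le> Suc m \<Longrightarrow> ?x i < ?x j"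
          using insert_at_strict[OF z(1,2), of 1 1] ge z0 by (auto simp: One_nat_def)
        show "?x 0 = 0" "2 < ?x (Suc m)" using big z0 l by (auto simp: insert_at_def)
        have "\<not> full (Suc m) ?x"
        proof
          assume f: "full (Suc m) ?x"
          have "full m z"
            unfolding full_def
          proof
            fix a assume a: "a \<in> {2..Suc n}"
            then obtain j where j: "j \<le> Suc m" "a = ?x j" using f by (auto simp: full_def)
            then have "a = z j \<and> j \<le> m \<or> a = z (j - 1) \<and> j - 1 \<le> m" using a by (auto simp: insert_at_def split: if_splits)
            then show "a \<in> z ` {..m}" by auto
          qed
          then show False using False by simp
        qed
        then show "full (Suc m) ?x \<and> 1 = 0 \<or> \<not> full (Suc m) ?x \<and> (1::nat) = 1 \<and> ?x 1 = 1"
          by (auto simp: insert_at_def One_nat_def)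
      qed
      then show thesis using face1[of ?x] False z0 insert_at_coface[OF zext, of 1 1] by (simp add: One_nat_def)
    qed
  qed
qed

text \<open>The two edges of the triangle that carry \<open>k\<close>. Every cell attached along an
  outer horn begins with one of them.\<close>

definition edges :: "(nat \<Rightarrow> nat) set" where
  "edges = {\<alpha>. \<alpha> 0 = 0 \<and> (\<alpha> 1 = 1 \<or> \<alpha> 1 = 2)}"

text \<open>Dimension counts first. The correction is for the cell on
  \<open>{0, 2, ..., n + 1}\<close>: a face of it through \<open>0\<close> can be the missing face
  of a cell of the same dimension that contains \<open>1\<close>, and this one must come
  earlier.\<close>

definition weight :: "nat \<times> (nat \<Rightarrow> nat) \<times> nat \<Rightarrow> nat" where
  "weight = (\<lambda>(m, x, i). 2 * m + (if x 1 = 1 then 0 else 1))"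

lemma face_strict:
  assumes "(m, x, i) \<in> cells"
  shows "compose {..m} x (coface m j) \<in> delta_hom m (Suc n)"
    "\<And>a b. a < b \<Longrightarrow> b \<le> m \<Longrightarrow> compose {..m} x (coface m j) a < compose {..m} x (coface m j) b"
proof -
  note c = cellsD[OF assms]
  show "compose {..m} x (coface m j) \<in> delta_hom m (Suc n)" by (rule delta_compose[OF c(1) coface_in])
  show "compose {..m} x (coface m j) a < compose {..m} x (coface m j) b" if "a < b" "b \<le> m" for a b
    using that by (auto simp: compose_def coface_def intro!: c(2))
qed

text \<open>The top vertex exceeds \<open>2\<close>, so only the shifted horn could contain the
  missing face. The face avoids \<open>0\<close> only for a full cell, and then it still contains
  \<open>{2..Suc n}\<close>.\<close>

lemma cell_missing:
  assumes B: "(m, x, i) \<in> cells"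
  shows "(m, compose {..m} x (coface m i)) \<notin> gdom start"
proof
  note c = cellsD[OF B]
  let ?z = "compose {..m} x (coface m i)"
  assume "(m, ?z) \<in> gdom start"
  then have "?z m \<le> 2 \<or> 0 < ?z 0 \<and> shift m ?z \<in> Simp (horn n 0) m" by (simp add: start_dom)
  moreover have "?z m = x (Suc m)" using c(5) by (auto simp: compose_def coface_def)
  ultimately have z: "0 < ?z 0" "shift m ?z \<in> Simp (horn n 0) m" using c(4) by auto
  then have i0: "i = 0" "full (Suc m) x" using c(3,5) by (auto simp: compose_def coface_def split: if_splits)
  obtain j where j: "j \<le> n" "j \<noteq> 0" "j \<notin> shift m ?z ` {..m}" using hornE[OF z(2)] by auto
  have "Suc j \<in> x ` {..Suc m}" using i0(2) j by (auto simp: full_def)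
  then obtain a where a: "a \<le> Suc m" "Suc j = x a" by auto
  then have "a \<noteq> 0" using c(3) by (cases a) auto
  then have "j = shift m ?z (a - 1)" using a i0 by (auto simp: shift_def compose_def coface_def)
  then show False using j(3) a \<open>a \<noteq> 0\<close> by auto
qed

text \<open>A new face is a cell of lower dimension, or it omits the vertex \<open>1\<close> and is
  matched upwards; in the latter case the given cell cannot contain \<open>1\<close> and has the
  larger weight. Omitting \<open>0\<close> from a cell that is not full lands in the horn.\<close>

lemma cell_faces:
  assumes B: "(m, x, i) \<in> cells" and j: "j \<le> Suc m" "j \<noteq> i"
  shows "(m, compose {..m} x (coface m j)) \<in> gdom start \<or>
    (\<exists>m' x' i'. (m', x', i') \<in> cells \<and> weight (m', x', i') < weight (m, x, i) \<and>
       (\<exists>\<beta>\<in>delta_hom m (Suc m'). compose {..m} x (coface m j) = compose {..m} x' \<beta>))"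
proof (cases "(m, compose {..m} x (coface m j)) \<in> gdom start")
  case False
  note c = cellsD[OF B]
  let ?z = "compose {..m} x (coface m j)"
  have zx: "?z a = x (if a < j then a else Suc a)" if "a \<le> m" for a
    using that by (simp add: compose_def coface_apply)
  note fs = face_strict[OF B, where j = j]
  have strict: "\<forall>a b. a < b \<longrightarrow> b \<le> m \<longrightarrow> ?z a < ?z b" using fs(2) by blast
  show ?thesis
  proof (rule classify[OF fs(1) strict False], goal_cases)
    case cell: (1 l i')
    then have "weight (l, ?z, i') < weight (m, x, i)" by (simp add: weight_def)
    moreover have "?z = compose {..m} ?z (delta_id m)" using fs(1) by simp
    ultimately show ?thesis using cell by (metis delta_id_in)
  next
    case face0: (2 x')
    have "j = 0" using face0(1) c(3) zx[of 0] by (auto split: if_splits)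
    then have nf: "\<not> full (Suc m) x" using j(2) c(5) by auto
    then obtain a where a: "2 \<le> a" "a \<le> Suc n" "a \<notin> x ` {..Suc m}"
      unfolding full_def by (meson atLeastAtMost_iff subsetI)
    have "shift m ?z \<in> Simp (horn n 0) m"
    proof (rule hornI[where j = "a - 1"])
      show "shift m ?z \<in> delta_hom m n" by (rule shift_in[OF fs(1)])
      show "a - 1 \<le> n" "a - 1 \<noteq> 0" using a by auto
      show "a - 1 \<notin> shift m ?z ` {..m}"
      proof
        assume "a - 1 \<in> shift m ?z ` {..m}"
        then obtain b where b: "b \<le> m" "a - 1 = x (Suc b) - 1"
          using \<open>j = 0\<close> zx by (auto simp: shift_def)
        then have "a = x (Suc b)" using a by linarith
        then show False using a b by auto
      qed
    qed
    then have "(m, ?z) \<in> gdom start" using fs(1) face0(1) by (simp add: start_dom)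
    then show ?thesis by simp
  next
    case face1: (3 x')
    have x1: "x 1 \<noteq> 1"
    proof
      assume x1: "x 1 = 1"
      have "j \<noteq> 0" using face1(1) c(2)[of 0 1] zx[of 0] c(3) by (cases "j = 0") (auto simp: One_nat_def)
      moreover have "j = 1 \<or> j = 0" using face1(2) x1 zx[of 1] c(4) j(1) by (cases m; cases "1 < j") (auto simp: One_nat_def)
      ultimately have j1: "j = 1" by simp
      then have f: "full (Suc m) x" using c(5) j(2) by auto
      have "full m ?z"
        unfolding full_def
      proof
        fix a assume a: "a \<in> {2..Suc n}"
        then obtain b where b: "b \<le> Suc m" "a = x b" using f by (auto simp: full_def)
        then have "2 \<le> b" using a x1 c(3) by (cases "b = 0"; cases "b = 1") auto
        then have "a = ?z (b - 1)" using zx[of "b - 1"] b j1 by (auto simp: One_nat_def)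
        then show "a \<in> ?z ` {..m}" using b by auto
      qed
      then show False using face1(3) by simp
    qed
    moreover have "x' 1 = 1" using cellsD(5)[OF face1(4)] by auto
    ultimately have "weight (m, x', 1) < weight (m, x, i)" by (simp add: weight_def)
    then show ?thesis using face1 coface_in by blast
  qed
qed simp

text \<open>A missing face is never a cell: cells contain \<open>0\<close>, and those without
  \<open>1\<close> are full, whereas a missing face through \<open>0\<close> lacks \<open>1\<close>
  and is not full. A missing face determines its cell, since the deleted vertex is \<open>0\<close>
  if the face avoids \<open>0\<close> and \<open>1\<close> otherwise.\<close>

lemma cell_separate:
  assumes B: "(m, x, i) \<in> cells" "(m', x', i') \<in> cells" and \<alpha>: "\<alpha> \<in> delta_hom m' (Suc m)"
    "\<alpha> \<notin> Simp (horn (Suc m) i) m'" and eq: "compose {..m'} x' (coface m' i') = compose {..m'} x \<alpha>"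
  shows "m' = m \<and> x' = x"
proof -
  note c = cellsD[OF B(1)] and c' = cellsD[OF B(2)]
  have iSm: "i \<le> Suc m" using c(5) by auto
  let ?z = "compose {..m'} x' (coface m' i')"
  have zx: "?z a = x' (if a < i' then a else Suc a)" if "a \<le> m'" for a
    using that by (simp add: compose_def coface_apply)
  have "inj_on ?z {..m'}" by (rule strict_imp_inj) (rule face_strict(2)[OF B(2)])
  then have "inj_on \<alpha> {..m'}" unfolding eq by (rule compose_inj_imp_inj)
  from \<alpha> iSm this show ?thesis
  proof (cases rule: nonhorn_injective)
    case 1
    then have zx': "?z = x" using eq delta_compose_id(1)[OF c(1)] by simp
    have "?z 0 = 0" using zx' c(3) by simp
    then have i': "i' = 1" using c'(2)[of 0 1] c'(3,5) zx[of 0] by (auto simp: One_nat_def)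
    have "\<not> full (Suc m) x"
    proof
      assume "full (Suc m) x"
      moreover have "?z ` {..m'} \<subseteq> x' ` {..Suc m'}" using zx by auto
      ultimately show False using c'(5) i' zx' 1 by (auto simp: full_def)
    qed
    then have "?z 1 = 1" using c(5) zx' by auto
    moreover have "?z 1 > 1" using zx[of 1] i' c'(2)[of 1 2] c'(5) by (auto simp: numeral_2_eq_2 One_nat_def)
    ultimately show ?thesis by simp
  next
    case 2
    have xz: "?z a = x (if a < i then a else Suc a)" if "a \<le> m" for a
      using that 2 eq by (simp add: compose_def coface_apply)
    have "i = i'"
      using xz[of 0] zx[of 0] c(2)[of 0 1] c'(2)[of 0 1] c(3,5) c'(3,5) by (auto simp: One_nat_def)
    have "x' = x"
    proof (rule delta_hom_eqI)
      show "x' \<in> delta_hom (Suc m) (Suc n)" "x \<in> delta_hom (Suc m) (Suc n)" using c(1) c'(1) 2 by auto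
      fix a assume a: "a \<le> Suc m"
      show "x' a = x a"
      proof (cases "a = i")
        case True
        then show ?thesis using c(3,5) c'(3,5) \<open>i = i'\<close> by auto
      next
        case False
        let ?b = "if a < i then a else a - 1"
        have "?b \<le> m" "(if ?b < i then ?b else Suc ?b) = a" using False a iSm by auto
        then show ?thesis using xz[of ?b] zx[of ?b] 2 \<open>i = i'\<close> by (simp only:)
      qed
    qed
    then show ?thesis using 2 by simp
  qed
qed

lemma filler:
  obtains c where "c \<in> Simp C n" "q n c = Act S n 1 (\<lambda>_\<in>{..n}. 1) (q 1 k)"
    "\<And>m \<alpha>. \<alpha> \<in> Simp (horn n 0) m \<Longrightarrow> Act C m n \<alpha> c = u m \<alpha>"
proof -
  interpret cell_extension \<Delta> S base C q start cells "measure weight" edges "{k}"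
  proof
    show "simplicial_set \<Delta>" "simplicial_set S" by (simp_all add: S)
    show "base \<in> sset_hom \<Delta> S" by (rule base_hom)
    show "partial_map \<Delta> base C q start" by (rule start_map)
    show "c \<in> {k}" if "(1, z, c) \<in> start" "z \<in> edges" for z c
    proof -
      have z: "z \<in> delta_hom 1 (Suc n)" "c = Act C 1 1 (compose {..1} (collapse (Suc n)) z) k"
        using that by (auto simp: start_def edges_def)
      have "compose {..1} (collapse (Suc n)) z = delta_id 1"
        by (rule delta_hom_eqI[OF delta_compose[OF collapse_in z(1)] delta_id_in])
          (use that(2) n in \<open>auto simp: edges_def compose_def collapse_def One_nat_def le_Suc_eq\<close>)
      then show ?thesis using z Act_id[OF X kC] by simp
    qed
    show "lc_edge C S q c" if "c \<in> {k}" for c using k that by simp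
    show "inner_fibration C S q" by (rule inner)
    show "wf (measure weight)" by simp
    fix m x i assume B: "(m, x, i) \<in> cells"
    note c = cellsD[OF B]
    show "x \<in> Simp \<Delta> (Suc m)" using c(1) by simp
    show "i \<le> m" using c(5) by auto
    show "\<alpha> = \<beta>" if "\<alpha> \<in> delta_hom l (Suc m)" "\<beta> \<in> delta_hom l (Suc m)"
      "Act \<Delta> l (Suc m) \<alpha> x = Act \<Delta> l (Suc m) \<beta> x" for l \<alpha> \<beta>
      using compose_inj_cancel[OF c(6) that(1,2)] that(3) by simp
    show "(m, Act \<Delta> m (Suc m) (coface m i) x) \<notin> gdom start"
      using cell_missing[OF B] by simp
    show "(m, Act \<Delta> m (Suc m) (coface m j) x) \<in> gdom start \<or>
       (\<exists>m' x' i'. (m', x', i') \<in> cells \<and> ((m', x', i'), m, x, i) \<in> measure weight \<and>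
          (\<exists>\<beta>\<in>delta_hom m (Suc m'). Act \<Delta> m (Suc m) (coface m j) x =
             Act \<Delta> m (Suc m') \<beta> x'))" if "j \<le> Suc m" "j \<noteq> i" for j
      using cell_faces[OF B that] by simp
    show "m' = m \<and> x' = x" if "(m', x', i') \<in> cells" "\<alpha> \<in> delta_hom m' (Suc m)"
      "\<alpha> \<notin> Simp (horn (Suc m) i) m'"
      "Act \<Delta> m' (Suc m') (coface m' i') x' = Act \<Delta> m' (Suc m) \<alpha> x"
      for m' x' i' \<alpha>
      using cell_separate[OF B that(1-3)] that(4) by simp
    show "m = 0 \<and> \<alpha> = delta_id 1" if \<alpha>: "\<alpha> \<in> delta_hom 1 (Suc m)" "\<alpha> \<notin> Simp (horn (Suc m) i) 1"
      and e: "Act \<Delta> 1 (Suc m) \<alpha> x \<in> edges" for \<alpha>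
    proof -
      have xa: "x (\<alpha> 0) = 0" "x (\<alpha> 1) = 1 \<or> x (\<alpha> 1) = 2" using e by (auto simp: edges_def compose_def)
      then have "\<alpha> 0 \<noteq> \<alpha> 1" by auto
      then have inj: "inj_on \<alpha> {..1}" by (auto simp: inj_on_def le_Suc_eq One_nat_def)
      have iSm: "i \<le> Suc m" using c(5) by auto
      from \<alpha> iSm inj show ?thesis
      proof (cases rule: nonhorn_injective)
        case 1
        then show ?thesis by (simp add: One_nat_def)
      next
        case 2
        have "i = 0 \<or> i = 1" using c(5) by auto
        then show ?thesis
          using xa 2 c(2)[of 0 1] c(4) by (auto simp: coface_def One_nat_def numeral_2_eq_2)
      qed
    qed
  next
    fix m z assume "z \<in> Simp \<Delta> m"
    then have z: "z \<in> delta_hom m (Suc n)" by simp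
    let ?goal = "(m, z) \<in> gdom start \<or>
       (\<exists>l x i. (l, x, i) \<in> cells \<and> (\<exists>\<alpha>\<in>delta_hom m (Suc l). z = Act \<Delta> m (Suc l) \<alpha> x)) \<or>
       (\<exists>l<m. \<exists>y\<in>Simp \<Delta> l. \<exists>\<alpha>\<in>delta_hom m l. z = Act \<Delta> m l \<alpha> y)"
    show ?goal
    proof (cases "\<exists>j<m. z j = z (Suc j)")
      case True
      then obtain j where j: "j < m" "z j = z (Suc j)" by auto
      then obtain l where l: "m = Suc l" by (cases m) auto
      have "z = compose {..m} (compose {..l} z (coface l j)) (codegeneracy l j)"
        using degenerate_factor[of z l j] delta_hom_ext[OF z] j l by simp
      moreover have "compose {..l} z (coface l j) \<in> delta_hom l (Suc n)" using z l by blast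
      moreover have "codegeneracy l j \<in> delta_hom m l" using j l by auto
      ultimately show ?goal using l by (metis Simp_std Act_std lessI)
    next
      case False
      then have strict: "\<forall>i j. i < j \<longrightarrow> j \<le> m \<longrightarrow> z i < z j" using delta_strict[OF z] by blast
      show ?goal
      proof (cases "(m, z) \<in> gdom start")
        case False
        show ?goal
        proof (rule classify[OF z strict False], goal_cases)
          case cell: (1 l i)
          moreover have "z = compose {..m} z (delta_id m)" using z by simp
          ultimately show ?goal by (metis Act_std delta_id_in)
        next
          case (2 x)
          then show ?goal by (metis Act_std coface_in)
        next
          case (3 x)
          then show ?goal by (metis Act_std coface_in)
        qed
      qed simp
    qed
  next
    fix m x assume B: "(m, x, 0) \<in> cells"
    note c = cellsD[OF B]
    have f: "full (Suc m) x" using c(5) by auto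
    have e: "delta_id 1 \<in> delta_hom 1 (Suc m)" by (rule initial_edge_in) simp
    \<comment> \<open>A full cell contains the vertex \<open>2\<close>, so the vertex after
      \<open>0\<close> is \<open>1\<close> or \<open>2\<close> and the initial edge carries
      \<open>k\<close>.\<close>
    have x1: "x 1 \<le> 2"
    proof -
      have "2 \<in> x ` {..Suc m}" using f n by (auto simp: full_def)
      then obtain a where a: "a \<le> Suc m" "x a = 2" by auto
      then have "1 \<le> a" using c(3) by (cases a) (auto simp: One_nat_def)
      then show ?thesis using delta_hom_mono[OF c(1) _ a(1), of 1] a(2) by simp
    qed
    have x0: "0 < x 1" using c(2)[of 0 1] c(3) by (simp add: One_nat_def)
    show "Act \<Delta> 1 (Suc m) (delta_id 1) x \<in> edges"
      using c(3) x0 x1 by (auto simp: edges_def compose_def)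
    have cx: "compose {..Suc m} (collapse (Suc n)) x = collapse (Suc m)"
    proof (rule delta_hom_eqI[OF delta_compose[OF collapse_in c(1)] collapse_in])
      fix a assume a: "a \<le> Suc m"
      have "0 < a \<Longrightarrow> 0 < x a" using c(2)[of 0 a] a by simp
      then show "compose {..Suc m} (collapse (Suc n)) x a = collapse (Suc m) a"
        using a c(3) delta_hom_le[OF c(1) a] by (cases "a = 0") (auto simp: compose_def collapse_def min_def One_nat_def)
    qed
    have "compose {..1} (collapse (Suc n)) (compose {..1} x (delta_id 1)) = delta_id 1"
      using delta_compose_assoc[OF e, where \<alpha> = "collapse (Suc n)" and \<beta> = x] cx collapse_initial[of "Suc m"] by simp
    then have "base 1 (compose {..1} x (delta_id 1)) = q 1 k"
      using base_apply[OF delta_compose[OF c(1) e]] Act_id[OF S qk] by simp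
    then show "base (Suc m) x = Act S (Suc m) 1 (collapse (Suc m))
        (base 1 (Act \<Delta> 1 (Suc m) (delta_id 1) x))"
      using base_apply[OF c(1)] cx by simp
  next
    fix x y assume B: "(0, x, 0) \<in> cells"
    note c = cellsD[OF B]
    have "full (Suc 0) x" using c(5) by auto
    \<comment> \<open>As \<open>n \<ge> 2\<close>, a full cell has at least the vertices
      \<open>0, 2, 3\<close>, so it cannot be an edge.\<close>
    then have "2 \<in> x ` {..Suc 0}" "3 \<in> x ` {..Suc 0}" using n by (auto simp: full_def)
    then show "\<exists>c\<in>{k}. q 1 c = base 1 x \<and> vertex C 1 0 c = y"
      using c(3) by (auto simp: le_Suc_eq)
  qed
  obtain f where f: "f \<in> sset_hom \<Delta> C"
    "\<And>m z. z \<in> Simp \<Delta> m \<Longrightarrow> q m (f m z) = base m z"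
    "\<And>m z c. (m, z, c) \<in> start \<Longrightarrow> f m z = c"
    "\<And>z. z \<in> Simp \<Delta> 1 \<Longrightarrow> z \<in> edges \<Longrightarrow> f 1 z \<in> {k}"
    by (rule extension) (rule that)
  \<comment> \<open>The face opposite \<open>0\<close> is the original simplex after the shift; its
    value fills the given horn.\<close>
  have d: "coface n 0 \<in> Simp \<Delta> n" by simp
  show thesis
  proof (rule that)
    show "f n (coface n 0) \<in> Simp C n" by (rule sset_hom_in[OF f(1) d])
    have "compose {..n} (collapse (Suc n)) (coface n 0) = (\<lambda>_\<in>{..n}. 1)"
      by (rule collapse_pos[OF coface_in]) (simp add: coface_def)
    then show "q n (f n (coface n 0)) = Act S n 1 (\<lambda>_\<in>{..n}. 1) (q 1 k)"
      using f(2)[OF d] base_apply[OF coface_in] by simp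
    fix m \<alpha> assume \<alpha>: "\<alpha> \<in> Simp (horn n 0) m"
    let ?z = "compose {..m} (coface n 0) \<alpha>"
    have sh: "shift m ?z = \<alpha>"
      by (rule extensionalityI[OF _ delta_hom_ext[OF horn_delta[OF \<alpha>]]])
        (use delta_hom_le[OF horn_delta[OF \<alpha>]] in \<open>auto simp: shift_def compose_def coface_def\<close>)
    have "0 < ?z 0" using delta_hom_le[OF horn_delta[OF \<alpha>], of 0] by (simp add: compose_def coface_def)
    then have "(m, ?z, u m (shift m ?z)) \<in> start"
      using \<alpha> sh horn_delta[OF \<alpha>] unfolding start_def by auto
    then have "f m ?z = u m \<alpha>" using f(3) sh by simp
    then show "Act C m n \<alpha> (f n (coface n 0)) = u m \<alpha>"
      using sset_hom_nat[OF f(1) horn_delta[OF \<alpha>] d] by simp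
  qed
qed

end

text \<open>The identity at the target of \<open>k\<close> is \<open>k\<close> restricted along the
  constant operator \<open>1\<close>. It lies over a constant edge, whose restrictions along all
  operators are constant; this matches the base condition of the horn with the one in
  \<open>degenerate_horn\<close>.\<close>

lemma (in sset_over) lc_edge_degenerate_target:
  assumes inner: "inner_fibration X S p" and k: "lc_edge X S p k"
  shows "lc_edge X S p (Act X 1 0 (\<lambda>_\<in>{..1}. 0) (vertex X 1 1 k))"
proof -
  have kX: "k \<in> Simp X 1" using lc_edge_in[OF k] .
  have pk: "p 1 k \<in> Simp S 1" using sset_hom_in[OF p kX] .
  have c1: "(\<lambda>_\<in>{..1}. 0) \<in> delta_hom 1 0" "(\<lambda>_\<in>{..0}. 1) \<in> delta_hom 0 1" by auto
  have e: "Act X 1 0 (\<lambda>_\<in>{..1}. 0) (vertex X 1 1 k) = Act X 1 1 (\<lambda>_\<in>{..1}. 1) k" (is "?e = ?e'")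
    unfolding vertex_def using Act_comp[OF X c1 kX] by (simp add: compose_const[OF c1(1)])
  have one: "(\<lambda>_\<in>{..1}. 1) \<in> delta_hom 1 1" by auto
  have pe: "p 1 ?e' = Act S 1 1 (\<lambda>_\<in>{..1}. 1) (p 1 k)" by (rule sset_hom_nat[OF p one kX])
  have const: "Act S m 1 \<beta> (Act S 1 1 (\<lambda>_\<in>{..1}. 1) (p 1 k)) = Act S m 1 (\<lambda>_\<in>{..m}. 1) (p 1 k)"
    if "\<beta> \<in> delta_hom m 1" for m \<beta>
    using Act_comp[OF S that one pk] by (simp add: compose_const[OF that])
  show ?thesis
    unfolding e lc_edge_def
  proof (intro conjI allI impI ballI, goal_cases)
    case 1
    show ?case by (rule Act_in[OF X one kX])
  next
    case (2 n u)
    interpret degenerate_horn X S p k n u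
    proof
      show "p m (u m \<alpha>) = Act S m 1 (\<lambda>_\<in>{..m}. 1) (p 1 k)" if "\<alpha> \<in> Simp (horn n 0) m" for m \<alpha>
        using 2 that const[OF delta_compose[OF collapse_in horn_delta[OF that]]] pe by simp
    qed (use 2 inner k in auto)
    show ?case using filler const[OF collapse_in, of n] pe by metis
  qed
qed

section \<open>Strings\<close>

lemma subseq_set: "subseq s t \<Longrightarrow> set s \<subseteq> set t"
  by (metis subseq_conv_nths set_nths_subset)

lemma subseq_snocD: "subseq s (t @ [c]) \<Longrightarrow> c \<notin> set s \<Longrightarrow> subseq s t"
proof -
  assume c: "subseq s (t @ [c])" "c \<notin> set s"
  obtain s1 s2 where s: "s = s1 @ s2" "subseq s1 t" "subseq s2 [c]" using c(1) by (rule subseq_appendE)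
  have "set s2 \<subseteq> {c}" using subseq_set[OF s(3)] by simp
  then have "s2 = []" using c(2) s(1) by (cases s2) auto
  then show ?thesis using s by simp
qed

text \<open>Also used with \<open>P0\<close> in place of \<open>P\<close>, where \<open>A\<close>
  becomes the set of all strings in \<open>P0\<close>.\<close>

locale poset_strings =
  fixes P P0 :: "'p set" and r :: "'p rel"
  assumes refl: "\<And>a. a \<in> P \<Longrightarrow> (a, a) \<in> r" and trans: "trans r" and antisym: "antisym r" and sub: "P0 \<subseteq> P"
begin

abbreviation A :: "'p list set" where
  "A \<equiv> strings_from P r P0"

lemma A_D:
  assumes "s \<in> A"
  shows "s \<noteq> []" "set s \<subseteq> P" "sorted_wrt (\<lambda>a b. (a, b) \<in> r \<and> a \<noteq> b) s" "hd s \<in> P0"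
  using assms by (auto simp: strings_from_def strings_def)

lemma A_I: "s \<noteq> [] \<Longrightarrow> set s \<subseteq> P \<Longrightarrow> sorted_wrt (\<lambda>a b. (a, b) \<in> r \<and> a \<noteq> b) s \<Longrightarrow> hd s \<in> P0 \<Longrightarrow> s \<in> A"
  by (auto simp: strings_from_def strings_def)

lemma last_in: "s \<in> A \<Longrightarrow> last s \<in> P"
  using A_D by fastforce

lemma le_last:
  assumes "s \<in> A" "a \<in> set s"
  shows "(a, last s) \<in> r"
proof -
  have s: "s = butlast s @ [last s]" using A_D(1)[OF assms(1)] by simp
  then have "sorted_wrt (\<lambda>a b. (a, b) \<in> r \<and> a \<noteq> b) (butlast s @ [last s])" using A_D(3)[OF assms(1)] by simp
  moreover have "a \<in> set (butlast s @ [last s])" by (subst s[symmetric]) (rule assms(2))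
  ultimately show ?thesis
    using refl[OF last_in[OF assms(1)]] unfolding sorted_wrt_append by auto
qed

lemma last_mono: "s \<in> A \<Longrightarrow> t \<in> A \<Longrightarrow> subseq s t \<Longrightarrow> (last s, last t) \<in> r"
  using le_last[of t "last s"] subseq_set[of s t] last_in_set[OF A_D(1)[of s]] by auto

lemma last_notin_butlast:
  assumes "s \<in> A"
  shows "last s \<notin> set (butlast s)"
proof -
  have "sorted_wrt (\<lambda>a b. (a, b) \<in> r \<and> a \<noteq> b) (butlast s @ [last s])" using A_D[OF assms] by simp
  then show ?thesis unfolding sorted_wrt_append by auto
qed

lemma snoc_in:
  assumes "s \<in> A" "c \<in> P" "(last s, c) \<in> r" "last s \<noteq> c"
  shows "s @ [c] \<in> A" "c \<notin> set s"
proof -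
  have *: "(a, c) \<in> r \<and> a \<noteq> c" if "a \<in> set s" for a
    using le_last[OF assms(1) that] assms(3,4) trans antisym by (metis antisymD transD)
  then show "c \<notin> set s" by auto
  show "s @ [c] \<in> A"
    by (rule A_I) (use A_D[OF assms(1)] assms(2) * in \<open>auto simp: sorted_wrt_append\<close>)
qed

text \<open>A string that starts in \<open>P0\<close> and ends outside it has at least two entries,
  so dropping the last one keeps its origin.\<close>

lemma butlast_in:
  assumes "s \<in> A" "last s \<notin> P0"
  shows "butlast s \<in> A"
proof -
  have s: "s = butlast s @ [last s]" using A_D(1)[OF assms(1)] by simp
  have ne: "butlast s \<noteq> []"
  proof
    assume "butlast s = []"
    then have "hd s = last s" using s by (metis append_Nil list.sel(1))
    then show False using A_D(4)[OF assms(1)] assms(2) by simp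
  qed
  have "hd (butlast s) = hd s" using s ne by (metis hd_append2)
  moreover have "sorted_wrt (\<lambda>a b. (a, b) \<in> r \<and> a \<noteq> b) (butlast s @ [last s])" using A_D(3)[OF assms(1)] s by simp
  ultimately show ?thesis
    unfolding sorted_wrt_append
    using A_D[OF assms(1)] ne by (intro A_I) (auto dest: in_set_butlastD)
qed

text \<open>Each maximum bounds the other. Applied to the strings of a cell with
  \<open>i = 0\<close>, this puts the cell over a single edge of \<open>P\<close>.\<close>

lemma subseq_last:
  assumes "s \<in> A" "t \<in> A" "subseq s t" "last t \<in> set s"
  shows "last s = last t"
  using last_mono[OF assms(1-3)] le_last[OF assms(1,4)] antisym by (metis antisymD)

lemma subseq_butlast:
  assumes "s \<in> A" "t \<in> A" "subseq s t"
  shows "last t \<notin> set s \<Longrightarrow> subseq s (butlast t)"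
    "last t \<in> set s \<Longrightarrow> subseq (butlast s) (butlast t)"
proof -
  have t: "t = butlast t @ [last t]" and s: "s = butlast s @ [last s]"
    using A_D(1)[OF assms(1)] A_D(1)[OF assms(2)] by simp_all
  show "subseq s (butlast t)" if "last t \<notin> set s" using subseq_snocD that assms(3) t by metis
  show "subseq (butlast s) (butlast t)" if "last t \<in> set s"
    using subseq_last[OF assms that] assms(3) s t subseq_append[of "butlast s" "[last t]" "butlast t"] by metis
qed

text \<open>The universal property of appending: \<open>x @ [b]\<close> is the smallest string with
  maximum \<open>b\<close> that contains \<open>x\<close>. The lifting property of the edge from
  \<open>x\<close> to \<open>x @ [b]\<close> rests on it.\<close>

lemma snoc_subseq:
  assumes "x \<in> A" "z \<in> A" "subseq x z" "last z = b" "b \<notin> set x"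
  shows "subseq (x @ [b]) z"
proof -
  have "z = butlast z @ [b]" 
    using append_butlast_last_id[OF A_D(1)[OF assms(2)]] assms(4) by simp
  moreover have "subseq x (butlast z)" using subseq_butlast(1)[OF assms(1-3)] assms(4,5) by simp
  ultimately show ?thesis using subseq_append[of x "[b]" "butlast z"] by metis
qed

abbreviation X :: "(nat \<Rightarrow> 'p list) sset" where "X \<equiv> sd A"
abbreviation S :: "(nat \<Rightarrow> 'p) sset" where "S \<equiv> nerve P r"
abbreviation p :: "nat \<Rightarrow> (nat \<Rightarrow> 'p list) \<Rightarrow> nat \<Rightarrow> 'p" where "p \<equiv> sd_max A"

lemma p_hom: "p \<in> sset_hom X S"
  by (rule nerve_map_hom) (auto simp: string_incl_def last_in last_mono)

lemma p_apply: "\<sigma> \<in> Simp X n \<Longrightarrow> p n \<sigma> = compose {..n} last \<sigma>"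
  by (simp add: nerve_map_def)

lemma XD:
  assumes "\<sigma> \<in> Simp X n"
  shows "\<And>i. i \<le> n \<Longrightarrow> \<sigma> i \<in> A" "\<And>i j. i \<le> j \<Longrightarrow> j \<le> n \<Longrightarrow> subseq (\<sigma> i) (\<sigma> j)"
  using nerveD[OF assms] by (auto simp: string_incl_def)

sublocale sset_over X S p
  by unfold_locales (auto simp: p_hom)

end

section \<open>Horns in nerves\<close>

lemma horn_pair:
  fixes k n :: nat
  assumes "insert k {i, j} = {..n}" "2 \<le> n"
  shows "n = 2" "k \<noteq> i" "k \<noteq> j" "i \<noteq> j"
proof -
  have "Suc n = card (insert k {i, j})" using assms(1) by simp
  also have "\<dots> \<le> 3" by (simp add: card_insert_if)
  finally show n: "n = 2" using assms(2) by simp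
  have "card (insert k {i, j}) = 3" using assms(1) n by simp
  then show "k \<noteq> i" "k \<noteq> j" "i \<noteq> j" by (auto simp: card_insert_if split: if_splits)
qed

definition horn_vertex :: "(nat \<Rightarrow> (nat \<Rightarrow> nat) \<Rightarrow> nat \<Rightarrow> 'p) \<Rightarrow> nat \<Rightarrow> 'p" where
  "horn_vertex u i = u 0 (\<lambda>_\<in>{..0}. i) 0"

context
  fixes n k :: nat and A :: "'p set" and r :: "'p rel" and u
  assumes u: "u \<in> sset_hom (horn n k) (nerve A r)" and n: "2 \<le> n" and k: "k \<le> n"
begin

lemma vertex_horn: "i \<le> n \<Longrightarrow> (\<lambda>_\<in>{..0}. i) \<in> Simp (horn n k) 0"
proof -
  assume i: "i \<le> n"
  have "insert k {i} \<noteq> {..n}"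
  proof
    assume "insert k {i} = {..n}"
    then have "card (insert k {i}) = Suc n" by simp
    moreover have "card (insert k {i}) \<le> 2" by (auto simp: card_insert_if)
    ultimately show False using n by simp
  qed
  moreover have "(\<lambda>_\<in>{..0::nat}. i) ` {..0} = {i}" by auto
  ultimately show ?thesis using i by (simp add: Simp_horn)
qed

lemma horn_value:
  assumes "\<alpha> \<in> Simp (horn n k) m"
  shows "u m \<alpha> = (\<lambda>i\<in>{..m}. horn_vertex u (\<alpha> i))"
proof (rule extensionalityI[of _ "{..m}"])
  show "u m \<alpha> \<in> extensional {..m}" using nerveD(3)[OF sset_hom_in[OF u assms]] .
  fix i assume "i \<in> {..m}"
  then have i: "i \<le> m" by simp
  have "compose {..0::nat} \<alpha> (\<lambda>_\<in>{..0}. i) = (\<lambda>_\<in>{..0}. \<alpha> i)" by (rule ext) (auto simp: compose_def)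
  then have "u 0 (\<lambda>_\<in>{..0}. \<alpha> i) = compose {..0} (u m \<alpha>) (\<lambda>_\<in>{..0}. i)"
    using sset_hom_nat[OF u delta_const_in[OF i, of 0] assms] by simp
  then show "u m \<alpha> i = (\<lambda>i\<in>{..m}. horn_vertex u (\<alpha> i)) i" using i by (simp add: horn_vertex_def compose_def)
qed simp

lemma horn_vertex_in: "i \<le> n \<Longrightarrow> horn_vertex u i \<in> A"
  unfolding horn_vertex_def using nerveD(1)[OF sset_hom_in[OF u vertex_horn]] by blast

lemma horn_vertex_rel:
  assumes "i \<le> j" "j \<le> n" "insert k {i, j} \<noteq> {..n}"
  shows "(horn_vertex u i, horn_vertex u j) \<in> r"
proof -
  let ?\<alpha> = "\<lambda>a\<in>{..1::nat}. if a = 0 then i else j"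
  have im: "?\<alpha> ` {..1} = {i, j}" 
  proof -
    have one: "{..1} = {0, 1::nat}" by auto
    show ?thesis unfolding one by auto
  qed
  have \<alpha>: "?\<alpha> \<in> Simp (horn n k) 1"
    unfolding Simp_horn mem_Collect_eq im
    using assms by (auto intro!: delta_homI)
  show ?thesis
    using nerveD(2)[OF sset_hom_in[OF u \<alpha>], of 0 1] unfolding horn_value[OF \<alpha>] by simp
qed

text \<open>A simplex of a nerve consists of its vertices and the relations between pairs of them. A
  horn of dimension at least two has all vertices, and by \<open>horn_pair\<close> it lacks a
  relation only in dimension two, the one opposite the vertex \<open>k\<close>.\<close>

lemma nerve_horn_fill:
  assumes "\<forall>i j. i \<le> j \<longrightarrow> j \<le> n \<longrightarrow> insert k {i, j} = {..n} \<longrightarrow> (horn_vertex u i, horn_vertex u j) \<in> r"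
  shows "restrict (horn_vertex u) {..n} \<in> Simp (nerve A r) n"
    "\<alpha> \<in> Simp (horn n k) m \<Longrightarrow> Act (nerve A r) m n \<alpha> (restrict (horn_vertex u) {..n}) = u m \<alpha>"
proof -
  show "restrict (horn_vertex u) {..n} \<in> Simp (nerve A r) n"
  proof (rule nerveI)
    show "(restrict (horn_vertex u) {..n} i, restrict (horn_vertex u) {..n} j) \<in> r" if "i \<le> j" "j \<le> n" for i j
      using horn_vertex_rel[OF that] assms that by force
  qed (use horn_vertex_in in auto)
  show "Act (nerve A r) m n \<alpha> (restrict (horn_vertex u) {..n}) = u m \<alpha>" if "\<alpha> \<in> Simp (horn n k) m"
    unfolding horn_value[OF that] using delta_hom_le[OF horn_delta[OF that]]
    by (auto simp: compose_def intro!: restrict_ext)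
qed

end

context poset_strings
begin

section \<open>The subdivision over the poset\<close>

text \<open>The filler is the one in the nerve, and its image in \<open>S\<close> is determined by
  vertices. The premise \<open>ex\<close> asks for the one missing inclusion and may use everything
  that the horn provides.\<close>

lemma sd_fill:
  assumes u: "u \<in> sset_hom (horn n k) X" and n: "2 \<le> n" and k: "k \<le> n" and \<tau>: "\<tau> \<in> Simp S n"
    and pu: "\<And>m \<alpha>. \<alpha> \<in> Simp (horn n k) m \<Longrightarrow> p m (u m \<alpha>) = Act S m n \<alpha> \<tau>"
    and ex: "\<And>i j. i \<le> j \<Longrightarrow> j \<le> n \<Longrightarrow> insert k {i, j} = {..n} \<Longrightarrow>
      (\<And>a. a \<le> n \<Longrightarrow> horn_vertex u a \<in> A \<and> last (horn_vertex u a) = \<tau> a) \<Longrightarrow>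
      (\<And>a b. a \<le> b \<Longrightarrow> b \<le> n \<Longrightarrow> insert k {a, b} \<noteq> {..n} \<Longrightarrow> subseq (horn_vertex u a) (horn_vertex u b)) \<Longrightarrow>
      subseq (horn_vertex u i) (horn_vertex u j)"
  obtains c where "c \<in> Simp X n" "p n c = \<tau>" "\<And>m \<alpha>. \<alpha> \<in> Simp (horn n k) m \<Longrightarrow> Act X m n \<alpha> c = u m \<alpha>"
proof -
  have v: "horn_vertex u a \<in> A \<and> last (horn_vertex u a) = \<tau> a" if a: "a \<le> n" for a
  proof -
    have vh: "(\<lambda>_\<in>{..0}. a) \<in> Simp (horn n k) 0" by (rule vertex_horn[OF u n k a])
    have "p 0 (u 0 (\<lambda>_\<in>{..0}. a)) 0 = last (horn_vertex u a)"
      unfolding p_apply[OF sset_hom_in[OF u vh]] by (simp add: compose_def horn_vertex_def)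
    moreover have "Act S 0 n (\<lambda>_\<in>{..0}. a) \<tau> 0 = \<tau> a" by (simp add: compose_def)
    ultimately show ?thesis using pu[OF vh] horn_vertex_in[OF u n k a] by simp
  qed
  have rel: "subseq (horn_vertex u a) (horn_vertex u b)" if "a \<le> b" "b \<le> n" "insert k {a, b} \<noteq> {..n}" for a b
    using horn_vertex_rel[OF u n k that] by (simp add: string_incl_def)
  have "\<forall>i j. i \<le> j \<longrightarrow> j \<le> n \<longrightarrow> insert k {i, j} = {..n} \<longrightarrow> (horn_vertex u i, horn_vertex u j) \<in> string_incl"
    using ex v rel by (simp add: string_incl_def)
  note F = nerve_horn_fill[OF u n k this]
  show ?thesis
  proof (rule that[OF F(1)])
    show "p n (restrict (horn_vertex u) {..n}) = \<tau>"
      unfolding p_apply[OF F(1)]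
      by (rule extensionalityI[OF _ nerveD(3)[OF \<tau>]]) (auto simp: compose_def v)
  qed (rule F(2))
qed

text \<open>The edge missing from an inner triangle horn is a composite, so transitivity of
  inclusion suffices.\<close>

lemma inner_fibration_sd: "inner_fibration X S p"
  unfolding inner_fibration_def
proof (intro conjI allI impI)
  fix n k u v assume "0 < k \<and> k < n \<and> lifting_problem (horn n k) (std_simplex n) X S p u v"
  then have k: "0 < k" "k < n" "k \<le> n" "2 \<le> n" and u: "u \<in> sset_hom (horn n k) X"
    and v: "v \<in> sset_hom (std_simplex n) S" and c: "\<And>m \<alpha>. \<alpha> \<in> Simp (horn n k) m \<Longrightarrow> p m (u m \<alpha>) = v m \<alpha>"
    by (auto simp: lifting_problem_def)
  have \<tau>: "v n (delta_id n) \<in> Simp S n" using sset_hom_in[OF v] by simp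
  have pu: "p m (u m \<alpha>) = Act S m n \<alpha> (v n (delta_id n))" if "\<alpha> \<in> Simp (horn n k) m" for m \<alpha>
    using c[OF that] sset_hom_nat[OF v horn_delta[OF that], of "delta_id n"] horn_delta[OF that] by simp
  show "has_solution (horn n k) (std_simplex n) X S p u v"
  proof (rule sd_fill[OF u k(4,3) \<tau> pu])
    fix i j assume ij: "i \<le> j" "j \<le> n" "insert k {i, j} = {..n}"
      and *: "\<And>a b. a \<le> b \<Longrightarrow> b \<le> n \<Longrightarrow> insert k {a, b} \<noteq> {..n} \<Longrightarrow> subseq (horn_vertex u a) (horn_vertex u b)"
    have n2: "n = 2" "k = 1" using horn_pair[OF ij(3) k(4)] k by auto
    have "i \<in> {0,2}" "j \<in> {0,2}" using ij horn_pair[OF ij(3) k(4)] n2 by auto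
    then have ij': "i = 0" "j = 2" using ij(1) horn_pair(4)[OF ij(3) k(4)] by auto
    have ne: "insert k {0, 1} \<noteq> {..n}" "insert k {1, 2} \<noteq> {..n}" using horn_pair[OF _ k(4)] n2 by blast+
    have "subseq (horn_vertex u 0) (horn_vertex u 1)" "subseq (horn_vertex u 1) (horn_vertex u 2)"
      using *[of 0 1, OF _ _ ne(1)] *[of 1 2, OF _ _ ne(2)] n2 by auto
    then show "subseq (horn_vertex u i) (horn_vertex u j)" unfolding ij' by (rule subseq_order.order_trans)
  next
    fix c assume "c \<in> Simp X n" "p n c = v n (delta_id n)" "\<And>m \<alpha>. \<alpha> \<in> Simp (horn n k) m \<Longrightarrow> Act X m n \<alpha> c = u m \<alpha>"
    then show ?thesis using horn_delta by (intro solutionI[OF _ p_hom v]) auto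
  qed auto
qed (auto simp: p_hom)

text \<open>The missing inclusion goes from the target of the leading edge to the vertex
  \<open>2\<close>. If the leading edge appends \<open>\<tau> 1\<close>, it is the universal
  property \<open>snoc_subseq\<close>, which applies because the vertex \<open>2\<close> lies over
  the same point; if the leading edge is an identity, it is part of the horn.\<close>

lemma sd_outer_fill:
  assumes u: "u \<in> sset_hom (horn n 0) X" and n: "2 \<le> n" and \<tau>: "\<tau> \<in> Simp S n"
    and pu: "\<And>m \<alpha>. \<alpha> \<in> Simp (horn n 0) m \<Longrightarrow> p m (u m \<alpha>) = Act S m n \<alpha> \<tau>"
    and e: "u 1 (delta_id 1) 1 = u 1 (delta_id 1) 0 \<or>
      u 1 (delta_id 1) 1 = u 1 (delta_id 1) 0 @ [\<tau> 1] \<and> \<tau> 1 \<notin> set (u 1 (delta_id 1) 0) \<and> \<tau> 2 = \<tau> 1"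
  obtains c where "c \<in> Simp X n" "p n c = \<tau>" "\<And>m \<alpha>. \<alpha> \<in> Simp (horn n 0) m \<Longrightarrow> Act X m n \<alpha> c = u m \<alpha>"
proof (rule sd_fill[OF u n le0 \<tau> pu])
  fix i j assume ij: "i \<le> j" "j \<le> n" "insert 0 {i, j} = {..n}"
    and v: "\<And>a. a \<le> n \<Longrightarrow> horn_vertex u a \<in> A \<and> last (horn_vertex u a) = \<tau> a"
    and *: "\<And>a b. a \<le> b \<Longrightarrow> b \<le> n \<Longrightarrow> insert 0 {a, b} \<noteq> {..n} \<Longrightarrow> subseq (horn_vertex u a) (horn_vertex u b)"
  note hp = horn_pair[OF ij(3) n]
  have ij': "i = 1" "j = 2" using ij(1,2) hp by auto
  have "insert 0 {0, 2} \<noteq> {..n}" using horn_pair(2)[OF _ n] by blast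
  then have s: "subseq (horn_vertex u 0) (horn_vertex u 2)" using *[of 0 2] n by simp
  have "u 1 (delta_id 1) 0 = horn_vertex u 0" "u 1 (delta_id 1) 1 = horn_vertex u 1"
    unfolding horn_value[OF u n le0 initial_edge_horn[OF n]] by auto
  then show "subseq (horn_vertex u i) (horn_vertex u j)"
    unfolding ij' using e s snoc_subseq[of "horn_vertex u 0" "horn_vertex u 2"] v[of 0] v[of 2] n by auto
qed (assumption | rule that)+

text \<open>If the edge of \<open>P\<close> given by \<open>s\<close> and \<open>\<beta>\<close> is
  constant, nothing may be appended and the lift is an identity. Otherwise \<open>\<beta>\<close> is
  the identity operator, and the lift appends the target.\<close>

lemma cocartesian_lift_sd:
  assumes s: "s \<in> Simp S 1" and \<beta>: "\<beta> \<in> delta_hom 1 1" and x: "x \<in> A" "last x = s (\<beta> 0)"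
  defines "e \<equiv> \<lambda>i\<in>{..1::nat}. if i = 0 \<or> s (\<beta> 0) = s (\<beta> 1) then x else x @ [s (\<beta> 1)]"
  shows "e \<in> Simp X 1" "p 1 e = Act S 1 1 \<beta> s"
    "cocartesian_edge (Q s) (std_simplex 1) (\<pi> s) (e, \<beta>)"
proof -
  have b: "\<beta> 0 \<le> \<beta> 1" "\<beta> 0 \<le> 1" "\<beta> 1 \<le> 1"
    using delta_hom_mono[OF \<beta>, of 0 1] delta_hom_le[OF \<beta>] by auto
  have sb: "(s (\<beta> 0), s (\<beta> 1)) \<in> r" using nerveD(2)[OF s b(1,3)] .
  have sn: "x @ [s (\<beta> 1)] \<in> A" "s (\<beta> 1) \<notin> set x" if "s (\<beta> 0) \<noteq> s (\<beta> 1)"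
    using snoc_in[OF x(1) nerveD(1)[OF s b(3)]] x(2) sb that by auto
  show eX: "e \<in> Simp X 1"
    by (rule nerveI) (use sn x in \<open>auto simp: e_def string_incl_def subseq_rev_drop_many\<close>)
  show pe: "p 1 e = Act S 1 1 \<beta> s"
    unfolding p_apply[OF eX]
    by (rule ext) (use x(2) in \<open>auto simp: compose_def e_def One_nat_def le_Suc_eq\<close>)
  show "cocartesian_edge (Q s) (std_simplex 1) (\<pi> s) (e, \<beta>)"
    unfolding cocartesian_pullback_iff[OF s eX \<beta> pe]
  proof (intro allI impI ballI, elim conjE)
    fix n \<gamma> u
    assume n: "2 \<le> n" and \<gamma>: "\<gamma> \<in> delta_hom n 1" and u: "u \<in> sset_hom (horn n 0) X"
      and pu: "horn_over S p n u \<gamma> s"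
      and ue: "u 1 (delta_id 1) = e" and g: "compose {..1} \<gamma> (delta_id 1) = \<beta>"
    have g01: "\<gamma> 0 = \<beta> 0" "\<gamma> 1 = \<beta> 1" using fun_cong[OF g, of 0] fun_cong[OF g, of 1] by (auto simp: compose_def)
    have \<tau>: "Act S n 1 \<gamma> s \<in> Simp S n" by (rule Act_in[OF simplicial_nerve \<gamma> s])
    have \<tau>a: "Act S n 1 \<gamma> s a = s (\<gamma> a)" if "a \<le> n" for a using that by (simp add: compose_def)
    have ea: "e 0 = x" "e 1 = (if s (\<beta> 0) = s (\<beta> 1) then x else x @ [s (\<beta> 1)])" by (auto simp: e_def)
    have "\<gamma> 2 = \<gamma> 1" if "s (\<beta> 0) \<noteq> s (\<beta> 1)"
    proof -
      have "\<beta> 0 \<noteq> \<beta> 1" using that by auto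
      then have "\<beta> 1 = 1" using b by linarith
      moreover have "\<gamma> 1 \<le> \<gamma> 2" "\<gamma> 2 \<le> 1" using delta_hom_mono[OF \<gamma>, of 1 2] delta_hom_le[OF \<gamma>, of 2] n by auto
      ultimately show ?thesis using g01 by simp
    qed
    then have e': "u 1 (delta_id 1) 1 = u 1 (delta_id 1) 0 \<or>
      u 1 (delta_id 1) 1 = u 1 (delta_id 1) 0 @ [Act S n 1 \<gamma> s 1] \<and>
      Act S n 1 \<gamma> s 1 \<notin> set (u 1 (delta_id 1) 0) \<and> Act S n 1 \<gamma> s 2 = Act S n 1 \<gamma> s 1"
      unfolding ue ea using \<tau>a[of 1] \<tau>a[of 2] n g01 sn(2) by auto
    have pu': "p m (u m \<alpha>) = Act S m n \<alpha> (Act S n 1 \<gamma> s)" if "\<alpha> \<in> Simp (horn n 0) m" for m \<alpha>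
      using pu that Act_comp[OF simplicial_nerve horn_delta[OF that] \<gamma> s] by simp
    show "horn_filler X S p n u \<gamma> s"
      by (rule sd_outer_fill[OF u n \<tau> pu' e']) auto
  qed
qed

theorem locally_cocartesian_sd: "locally_cocartesian_fibration X S p"
  unfolding locally_cocartesian_fibration_def cocartesian_fibration_def
proof (intro conjI ballI allI impI)
  show "inner_fibration X S p" by (rule inner_fibration_sd)
  fix s assume s: "s \<in> Simp S 1"
  show "inner_fibration (Q s) (std_simplex 1) (\<pi> s)"
    by (rule inner_fibration_edge_pullback[OF inner_fibration_sd s])
  fix \<beta> z assume "\<beta> \<in> Simp (std_simplex 1) 1" and z: "z \<in> Simp (Q s) 0"
    and v: "\<pi> s 0 z = vertex (std_simplex 1) 1 0 \<beta>"
  then have \<beta>: "\<beta> \<in> delta_hom 1 1" by simp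
  let ?x = "fst z 0"
  have zX: "fst z \<in> Simp X 0" "p 0 (fst z) = Act S 0 1 (snd z) s" using z by (auto simp: Simp_edge_pullback)
  have sz: "snd z = compose {..0} \<beta> (\<lambda>_\<in>{..0}. 0)"
    using v edge_pullback_proj_apply[OF z] by (simp add: vertex_def)
  have x: "?x \<in> A" "last ?x = s (\<beta> 0)"
    using XD(1)[OF zX(1)] zX(2) unfolding p_apply[OF zX(1)] sz by (auto simp: compose_def dest!: fun_cong[of _ _ 0])
  let ?e = "\<lambda>i\<in>{..1::nat}. if i = 0 \<or> s (\<beta> 0) = s (\<beta> 1) then ?x else ?x @ [s (\<beta> 1)]"
  note L = cocartesian_lift_sd[OF s \<beta> x]
  have eQ: "(?e, \<beta>) \<in> Simp (Q s) 1" using L(1,2) \<beta> by (simp add: Simp_edge_pullback)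
  have "compose {..0} ?e (\<lambda>_\<in>{..0}. 0) = fst z"
    by (rule extensionalityI[OF compose_extensional nerveD(3)[OF zX(1)]]) (auto simp: compose_def)
  then have "vertex (Q s) 1 0 (?e, \<beta>) = z"
    using sz by (simp add: vertex_def prod_eq_iff)
  moreover have "\<pi> s 1 (?e, \<beta>) = \<beta>"
    using edge_pullback_proj_apply[OF eQ] by simp
  ultimately show "\<exists>e. cocartesian_edge (Q s) (std_simplex 1) (\<pi> s) e \<and>
      vertex (Q s) 1 0 e = z \<and> \<pi> s 1 e = \<beta>"
    using L(3) by blast
qed

text \<open>Compare with the canonical lift \<open>g\<close>: the horn formed by \<open>e\<close>
  and the inclusion of \<open>e 0\<close> in \<open>g\<close> lies over the right edge, and its
  filler puts \<open>e 1\<close> inside \<open>g\<close>. The converse inclusion is given by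
  \<open>e\<close> itself or by \<open>snoc_subseq\<close>, and inclusion is antisymmetric.\<close>

lemma lc_edge_sd_imp:
  assumes "lc_edge X S p e"
  shows "e 1 = e 0 \<or> e 1 = e 0 @ [last (e 1)]"
proof -
  have e: "e \<in> Simp X 1" using lc_edge_in[OF assms] .
  have eA: "e 0 \<in> A" "e 1 \<in> A" "subseq (e 0) (e 1)" using XD[OF e] by auto
  have s: "p 1 e \<in> Simp S 1" by (rule sset_hom_in[OF p_hom e])
  have lr: "(last (e 0), last (e 1)) \<in> r" using last_mono[OF eA] .
  define g where "g = (if last (e 0) = last (e 1) then e 0 else e 0 @ [last (e 1)])"
  have g: "g \<in> A" "subseq (e 0) g" "last g = last (e 1)"
    using eA snoc_in(1)[OF eA(1) last_in[OF eA(2)] lr] by (auto simp: g_def subseq_rev_drop_many)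
  define f where "f = (\<lambda>i::nat. if i = 0 then e 0 else if i = 1 then e 1 else g)"
  let ?u = "\<lambda>m. \<lambda>\<alpha>\<in>Simp (horn 2 0) m. compose {..m} f \<alpha>"
  have uX: "?u m \<alpha> \<in> Simp X m" if \<alpha>: "\<alpha> \<in> Simp (horn 2 0) m" for m \<alpha>
  proof -
    obtain j where j: "\<alpha> \<in> delta_hom m 2" "j \<le> 2" "j \<noteq> 0" "j \<notin> \<alpha> ` {..m}" using hornE[OF \<alpha>] by auto
    have "compose {..m} f \<alpha> \<in> Simp X m"
    proof (rule nerveI)
      show "compose {..m} f \<alpha> i \<in> A" if "i \<le> m" for i using that eA g by (auto simp: compose_def f_def)
      show "(compose {..m} f \<alpha> a, compose {..m} f \<alpha> b) \<in> string_incl" if ab: "a \<le> b" "b \<le> m" for a b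
      proof -
        have "\<alpha> a \<le> \<alpha> b" using delta_hom_mono[OF j(1) ab] .
        moreover have "\<alpha> b \<le> 2" using delta_hom_le[OF j(1) ab(2)] .
        moreover have "\<alpha> a \<noteq> j" "\<alpha> b \<noteq> j" using j(4) ab by auto
        ultimately have "\<alpha> a = \<alpha> b \<or> \<alpha> a = 0" using j(2,3) by linarith
        then show ?thesis using ab eA g by (auto simp: compose_def f_def string_incl_def)
      qed
    qed simp
    then show ?thesis using \<alpha> by simp
  qed
  have u: "?u \<in> sset_hom (horn 2 0) X"
  proof (rule sset_homI[OF uX])
    fix l m \<alpha> \<beta> assume \<beta>: "\<beta> \<in> delta_hom l m" and \<alpha>: "\<alpha> \<in> Simp (horn 2 0) m"
    show "?u l (Act (horn 2 0) l m \<beta> \<alpha>) = Act X l m \<beta> (?u m \<alpha>)"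
      using horn_compose[OF \<alpha> \<beta>] \<alpha> by (simp add: delta_compose_assoc[OF \<beta>])
  qed (assumption | rule restrict_extensional)+
  have ue: "?u 1 (delta_id 1) = e"
    using initial_edge_horn[of 2]
    by (intro extensionalityI[OF _ nerveD(3)[OF e]]) (auto simp: compose_def f_def One_nat_def le_Suc_eq)
  have pu: "p m (?u m \<alpha>) = Act S m 1 (compose {..m} (collapse 2) \<alpha>) (p 1 e)" if \<alpha>: "\<alpha> \<in> Simp (horn 2 0) m" for m \<alpha>
  proof -
    have "last (f (\<alpha> i)) = p 1 e (collapse 2 (\<alpha> i))" if "i \<le> m" for i
      using delta_hom_le[OF horn_delta[OF \<alpha>] that] g(3)
      unfolding p_apply[OF e]
      by (cases "\<alpha> i = 0"; cases "\<alpha> i = 1") (auto simp: f_def collapse_def compose_def min_def)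
    then show ?thesis unfolding p_apply[OF uX[OF \<alpha>]] using \<alpha> by (auto simp: compose_def intro!: restrict_ext)
  qed
  obtain c where c: "c \<in> Simp X 2" "\<And>m \<alpha>. \<alpha> \<in> Simp (horn 2 0) m \<Longrightarrow> Act X m 2 \<alpha> c = ?u m \<alpha>"
    by (rule lc_edgeD[OF assms order_refl u pu ue]) (assumption | rule that)+
  have cv: "c i = f i" if "i \<le> 2" for i
  proof -
    have v: "(\<lambda>_\<in>{..0}. i) \<in> Simp (horn 2 0) 0" by (rule vertex_horn[OF u _ _ that]) auto
    show ?thesis using fun_cong[OF c(2)[OF v], of 0] v by (simp add: compose_def)
  qed
  have "subseq (c 1) (c 2)" using XD(2)[OF c(1), of 1 2] by simp
  then have sg: "subseq (e 1) g" using cv[of 1] cv[of 2] by (simp add: f_def)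
  show ?thesis
  proof (cases "last (e 0) = last (e 1)")
    case True
    then show ?thesis using sg eA(3) subseq_order.antisym by (auto simp: g_def)
  next
    case False
    then have n: "last (e 1) \<notin> set (e 0)" using snoc_in(2)[OF eA(1) last_in[OF eA(2)] lr] by simp
    have "subseq (e 0 @ [last (e 1)]) (e 1)" using snoc_subseq[OF eA _ n] by simp
    then show ?thesis using sg False subseq_order.antisym by (auto simp: g_def)
  qed
qed

lemma lc_edge_sdI:
  assumes e: "e \<in> Simp X 1" and e1: "e 1 = e 0 \<or> e 1 = e 0 @ [last (e 1)]"
  shows "lc_edge X S p e"
proof -
  have eA: "e 0 \<in> A" "e 1 \<in> A" using XD[OF e] by auto
  have s: "p 1 e \<in> Simp S 1" by (rule sset_hom_in[OF p_hom e])
  show ?thesis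
    unfolding lc_edge_def
  proof (intro conjI e allI impI ballI, elim conjE)
    fix n u assume n: "2 \<le> n" and u: "u \<in> sset_hom (horn n 0) X"
      and pu: "horn_over S p n u (collapse n) (p 1 e)"
      and ue: "u 1 (delta_id 1) = e"
    let ?\<tau> = "Act S n 1 (collapse n) (p 1 e)"
    have \<tau>: "?\<tau> \<in> Simp S n" by (rule Act_in[OF simplicial_nerve collapse_in s])
    have pu': "p m (u m \<alpha>) = Act S m n \<alpha> ?\<tau>" if "\<alpha> \<in> Simp (horn n 0) m" for m \<alpha>
      using pu that Act_comp[OF simplicial_nerve horn_delta[OF that] collapse_in s] by simp
    have \<tau>a: "?\<tau> 1 = last (e 1)" "?\<tau> 2 = last (e 1)"
      unfolding p_apply[OF e] using n by (auto simp: compose_def collapse_def)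
    have nin: "last (e 1) \<notin> set (e 0)" if "e 1 = e 0 @ [last (e 1)]"
      using last_notin_butlast[OF eA(2)] that by (metis butlast_snoc)
    have e': "u 1 (delta_id 1) 1 = u 1 (delta_id 1) 0 \<or>
      u 1 (delta_id 1) 1 = u 1 (delta_id 1) 0 @ [?\<tau> 1] \<and> ?\<tau> 1 \<notin> set (u 1 (delta_id 1) 0) \<and> ?\<tau> 2 = ?\<tau> 1"
      unfolding ue \<tau>a using e1 nin by blast
    show "\<exists>c\<in>Simp X n. p n c = ?\<tau> \<and> (\<forall>m. \<forall>\<alpha>\<in>Simp (horn n 0) m. Act X m n \<alpha> c = u m \<alpha>)"
      by (rule sd_outer_fill[OF u n \<tau> pu' e']) auto
  qed
qed

lemma lc_edge_sd_iff: "lc_edge X S p e \<longleftrightarrow> e \<in> Simp X 1 \<and> (e 1 = e 0 \<or> e 1 = e 0 @ [last (e 1)])"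
  by (metis lc_edge_sd_imp lc_edge_sdI lc_edge_in)

end

section \<open>Functors over the base\<close>

lemma Simp_Fun_over:
  "F \<in> Simp (Fun_over X p C q) n \<longleftrightarrow> F \<in> sset_hom (sset_prod X (std_simplex n)) C \<and>
     (\<forall>k. \<forall>x \<in> Simp X k. \<forall>\<alpha> \<in> delta_hom k n. q k (F k (x, \<alpha>)) = p k x)"
  by (simp add: Fun_over_def)

lemma Act_Fun_over:
  "Act (Fun_over X p C q) m n \<theta> F k =
     (\<lambda>z\<in>Simp X k \<times> delta_hom k m. F k (fst z, compose {..k} \<theta> (snd z)))"
  by (simp add: Fun_over_def)

lemma Act_Fun_over_apply:
  "x \<in> Simp X k \<Longrightarrow> \<alpha> \<in> delta_hom k m \<Longrightarrow> Act (Fun_over X p C q) m n \<theta> F k (x, \<alpha>) = F k (x, compose {..k} \<theta> \<alpha>)"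
  by (simp add: Act_Fun_over)

lemma Fun_over_nat:
  assumes F: "F \<in> Simp (Fun_over X p C q) n" and \<theta>: "\<theta> \<in> delta_hom l k"
    and x: "x \<in> Simp X k" and \<alpha>: "\<alpha> \<in> delta_hom k n"
  shows "F l (Act X l k \<theta> x, compose {..l} \<alpha> \<theta>) = Act C l k \<theta> (F k (x, \<alpha>))"
proof -
  have "F \<in> sset_hom (sset_prod X (std_simplex n)) C" using F by (simp add: Simp_Fun_over)
  from sset_hom_nat[OF this \<theta>, of "(x, \<alpha>)"] show ?thesis using x \<alpha> by simp
qed

lemma Fun_over_in:
  "F \<in> Simp (Fun_over X p C q) n \<Longrightarrow> x \<in> Simp X k \<Longrightarrow> \<alpha> \<in> delta_hom k n \<Longrightarrow> F k (x, \<alpha>) \<in> Simp C k"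
  unfolding Simp_Fun_over by (rule sset_hom_in[of F "sset_prod X (std_simplex n)"]) auto

lemma Fun_over_eqI:
  assumes "F \<in> Simp (Fun_over X p C q) n" "G \<in> Simp (Fun_over X p C q) n"
    "\<And>k x \<alpha>. x \<in> Simp X k \<Longrightarrow> \<alpha> \<in> delta_hom k n \<Longrightarrow> F k (x, \<alpha>) = G k (x, \<alpha>)"
  shows "F = G"
  by (rule sset_hom_eqI[of F "sset_prod X (std_simplex n)" C G C]) (use assms in \<open>auto simp: Simp_Fun_over\<close>)

lemma simplicial_Fun_over:
  assumes X: "simplicial_set X"
  shows "simplicial_set (Fun_over X p C q)"
proof -
  have in': "Act (Fun_over X p C q) m n \<theta> F \<in> Simp (Fun_over X p C q) m"
    if \<theta>: "\<theta> \<in> delta_hom m n" and F: "F \<in> Simp (Fun_over X p C q) n" for m n \<theta> F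
    unfolding Simp_Fun_over
  proof (intro conjI sset_homI allI ballI)
    fix k z assume z: "z \<in> Simp (sset_prod X (std_simplex m)) k"
    then have *: "fst z \<in> Simp X k" "snd z \<in> delta_hom k m" by auto
    show "Act (Fun_over X p C q) m n \<theta> F k z \<in> Simp C k"
      using Fun_over_in[OF F *(1) delta_compose[OF \<theta> *(2)]] Act_Fun_over_apply[OF *, of p C q n \<theta> F] by simp
    fix l \<beta> assume \<beta>: "\<beta> \<in> delta_hom l k"
    have "Act (Fun_over X p C q) m n \<theta> F l (Act X l k \<beta> (fst z), compose {..l} (snd z) \<beta>) =
        F l (Act X l k \<beta> (fst z), compose {..l} (compose {..k} \<theta> (snd z)) \<beta>)"
      using Act_Fun_over_apply[OF Act_in[OF X \<beta> *(1)] delta_compose[OF *(2) \<beta>], of p C q n \<theta> F]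
      by (simp add: delta_compose_assoc[OF \<beta>])
    also have "\<dots> = Act C l k \<beta> (Act (Fun_over X p C q) m n \<theta> F k (fst z, snd z))"
      unfolding Fun_over_nat[OF F \<beta> *(1) delta_compose[OF \<theta> *(2)]] Act_Fun_over_apply[OF *] ..
    finally show "Act (Fun_over X p C q) m n \<theta> F l (Act (sset_prod X (std_simplex m)) l k \<beta> z) =
        Act C l k \<beta> (Act (Fun_over X p C q) m n \<theta> F k z)" by simp
  next
    fix k x \<alpha> assume "x \<in> Simp X k" "\<alpha> \<in> delta_hom k m"
    then show "q k (Act (Fun_over X p C q) m n \<theta> F k (x, \<alpha>)) = p k x"
      using F delta_compose[OF \<theta>] by (simp add: Act_Fun_over_apply Simp_Fun_over)
  qed (simp add: Act_Fun_over)
  show ?thesis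
  proof (rule simplicial_setI[OF in'])
    show "Act (Fun_over X p C q) n n (delta_id n) F = F" if F: "F \<in> Simp (Fun_over X p C q) n" for n F
      by (rule Fun_over_eqI[OF in'[OF delta_id_in F] F]) (simp add: Act_Fun_over_apply)
    fix l m n \<alpha> \<beta> F assume \<beta>: "\<beta> \<in> delta_hom l m" and \<alpha>: "\<alpha> \<in> delta_hom m n" and F: "F \<in> Simp (Fun_over X p C q) n"
    show "Act (Fun_over X p C q) l m \<beta> (Act (Fun_over X p C q) m n \<alpha> F) = Act (Fun_over X p C q) l n (compose {..l} \<alpha> \<beta>) F"
      by (rule Fun_over_eqI[OF in'[OF \<beta> in'[OF \<alpha> F]] in'[OF delta_compose[OF \<alpha> \<beta>] F]])
        (use \<beta> in \<open>simp add: Act_Fun_over_apply delta_compose_assoc\<close>)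
  qed
qed

lemma simplicial_Fun_cocart:
  "simplicial_set X \<Longrightarrow> simplicial_set (Fun_cocart S X p C q)"
  unfolding Fun_cocart_def by (intro simplicial_full simplicial_Fun_over)

lemma Act_Fun_cocart [simp]: "Act (Fun_cocart S X p C q) = Act (Fun_over X p C q)"
  by (simp add: Fun_cocart_def)

text \<open>The \<open>i\<close>-th vertex of \<open>F\<close> is a map on the product with a point;
  on the degenerate edge of the point it has the value of \<open>F\<close> on the constant edge at
  \<open>i\<close>. Preservation thus becomes a condition on constant edges.\<close>

lemma Simp_Fun_cocart:
  assumes X: "sset_over X S p" and C: "sset_over C S q"
  shows "F \<in> Simp (Fun_cocart S X p C q) n \<longleftrightarrow> F \<in> Simp (Fun_over X p C q) n \<and>
    (\<forall>i\<le>n. \<forall>e. lc_edge X S p e \<longrightarrow> lc_edge C S q (F 1 (e, \<lambda>_\<in>{..1}. i)))"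
proof -
  have "vertex (Fun_over X p C q) n i F 1 (e, \<lambda>_\<in>{..1}. 0) = F 1 (e, \<lambda>_\<in>{..1}. i)"
    if "i \<le> n" "lc_edge X S p e" for i e
    unfolding vertex_def
    using Act_Fun_over_apply[OF lc_edge_in[OF that(2)], of "\<lambda>_\<in>{..1}. 0" 0 p C q n "\<lambda>_\<in>{..0}. i" F]
      compose_const[of "\<lambda>_\<in>{..1}. 0" 1 0 i] by simp
  moreover have "vertex (Fun_over X p C q) n i F \<in> Simp (Fun_over X p C q) 0"
    if "i \<le> n" "F \<in> Simp (Fun_over X p C q) n" for i
    by (rule vertex_in[OF simplicial_Fun_over[OF sset_over.X[OF X]] that(2,1)])
  ultimately show ?thesis
    unfolding Fun_cocart_def Simp_full preserves_locally_cocartesian_def mem_Collect_eq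
      sset_over.lc_edge_iff[OF X] sset_over.lc_edge_iff[OF C] by (metis (no_types, lifting))
qed

section \<open>Restriction of the base\<close>

locale base_restriction = sset_over C "nerve P r" q
  for C :: "'c sset" and P :: "'p set" and r :: "'p rel" and q +
  fixes P0 :: "'p set"
  assumes P0: "P0 \<subseteq> P"
begin

abbreviation T :: "(nat \<Rightarrow> 'p) sset" where "T \<equiv> nerve P0 r"
abbreviation C' :: "('c \<times> (nat \<Rightarrow> 'p)) sset" where "C' \<equiv> restrict_base C q T"
abbreviation q' :: "nat \<Rightarrow> 'c \<times> (nat \<Rightarrow> 'p) \<Rightarrow> nat \<Rightarrow> 'p" where "q' \<equiv> restrict_base_proj C q T"

lemma T_sub: "s \<in> Simp T n \<Longrightarrow> s \<in> Simp (nerve P r) n"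
  using P0 by (auto simp: Simp_nerve PiE_def)

lemma incl_hom: "sset_incl T \<in> sset_hom T (nerve P r)"
  by (rule sset_homI)
    (use Act_in[OF simplicial_nerve, of _ _ _ _ P0 r] in \<open>auto simp: sset_incl_def T_sub\<close>)

lemma Simp_C': "Simp C' n = {z. fst z \<in> Simp C n \<and> snd z \<in> Simp T n \<and> q n (fst z) = snd z}"
  by (auto simp: restrict_base_def Simp_fibre_prod sset_incl_def)

lemma Act_C' [simp]: "Act C' m n \<alpha> z = (Act C m n \<alpha> (fst z), compose {..m} (snd z) \<alpha>)"
  by (simp add: restrict_base_def)

lemma q'_apply: "z \<in> Simp C' n \<Longrightarrow> q' n z = snd z"
  by (simp add: restrict_base_def restrict_base_proj_def fibre_prod_proj_def)

lemma sset_over_C': "sset_over C' T q'"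
proof
  show "simplicial_set C'"
    unfolding restrict_base_def by (rule simplicial_fibre_prod[OF X _ p incl_hom]) simp
  show "q' \<in> sset_hom C' T"
    unfolding restrict_base_def restrict_base_proj_def by (rule fibre_prod_proj_hom[OF X _ p incl_hom]) simp
qed simp

text \<open>A horn over a degeneration of an edge of \<open>T\<close> lies over \<open>T\<close>.
  Hence horns of \<open>C\<close> with leading edge \<open>fst e\<close> correspond to horns of
  \<open>C'\<close> with leading edge \<open>e\<close>, the second components being forced.\<close>

lemma lc_edge_C'_iff:
  assumes e: "e \<in> Simp C' 1"
  shows "lc_edge C' T q' e \<longleftrightarrow> lc_edge C (nerve P r) q (fst e)"
proof
  have eC: "fst e \<in> Simp C 1" "q 1 (fst e) = snd e" and eT: "snd e \<in> Simp T 1" using e by (auto simp: Simp_C')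
  have T: "compose {..m} (snd e) \<beta> \<in> Simp T m" if "\<beta> \<in> delta_hom m 1" for m \<beta>
    using Act_in[OF simplicial_nerve that eT] by simp
  {
    assume L: "lc_edge C' T q' e"
    show "lc_edge C (nerve P r) q (fst e)"
      unfolding lc_edge_def
    proof (intro conjI eC(1) allI impI ballI, elim conjE)
      fix n u assume n: "2 \<le> n" and u: "u \<in> sset_hom (horn n 0) C"
        and qu: "horn_over (nerve P r) q n u (collapse n) (q 1 (fst e))"
        and ue: "u 1 (delta_id 1) = fst e"
      let ?s = "\<lambda>m \<alpha>. compose {..m} (snd e) (compose {..m} (collapse n) \<alpha>)"
      let ?u = "\<lambda>m. \<lambda>\<alpha>\<in>Simp (horn n 0) m. (u m \<alpha>, ?s m \<alpha>)"
      have uin: "?u m \<alpha> \<in> Simp C' m" if "\<alpha> \<in> Simp (horn n 0) m" for m \<alpha>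
        using that qu sset_hom_in[OF u that] T[OF delta_compose[OF collapse_in horn_delta[OF that]]] eC(2)
        by (simp add: Simp_C')
      have u': "?u \<in> sset_hom (horn n 0) C'"
      proof (rule sset_homI[OF uin])
        fix l m \<alpha> \<beta> assume \<beta>: "\<beta> \<in> delta_hom l m" and \<alpha>: "\<alpha> \<in> Simp (horn n 0) m"
        show "?u l (Act (horn n 0) l m \<beta> \<alpha>) = Act C' l m \<beta> (?u m \<alpha>)"
          using horn_compose[OF \<alpha> \<beta>] \<alpha> sset_hom_nat[OF u \<beta> \<alpha>] by (simp add: delta_compose_assoc[OF \<beta>])
      qed (assumption | rule restrict_extensional)+
      have "compose {..1} (collapse n) (delta_id 1) = delta_id 1" using collapse_initial n by simp
      then have ue': "?u 1 (delta_id 1) = e"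
        using initial_edge_horn[OF n] ue Act_id[OF simplicial_nerve eT] by (simp add: prod_eq_iff)
      have qu': "q' m (?u m \<alpha>) = Act T m 1 (compose {..m} (collapse n) \<alpha>) (q' 1 e)"
        if "\<alpha> \<in> Simp (horn n 0) m" for m \<alpha>
        using q'_apply[OF uin[OF that]] q'_apply[OF e] that by simp
      obtain c where c: "c \<in> Simp C' n" "q' n c = Act T n 1 (collapse n) (q' 1 e)"
        "\<And>m \<alpha>. \<alpha> \<in> Simp (horn n 0) m \<Longrightarrow> Act C' m n \<alpha> c = ?u m \<alpha>"
        by (rule lc_edgeD[OF L n u' qu' ue']) (assumption | rule that)+
      have "fst c \<in> Simp C n" "q n (fst c) = Act (nerve P r) n 1 (collapse n) (q 1 (fst e))"
        using c(1,2) q'_apply[OF c(1)] q'_apply[OF e] eC by (auto simp: Simp_C')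
      moreover have "Act C m n \<alpha> (fst c) = u m \<alpha>" if "\<alpha> \<in> Simp (horn n 0) m" for m \<alpha>
        using c(3)[OF that] that by simp
      ultimately show "horn_filler C (nerve P r) q n u (collapse n) (q 1 (fst e))" by blast
    qed
  }
  assume L: "lc_edge C (nerve P r) q (fst e)"
  show "lc_edge C' T q' e"
    unfolding lc_edge_def
  proof (intro conjI e allI impI ballI, elim conjE)
    fix n u assume n: "2 \<le> n" and u: "u \<in> sset_hom (horn n 0) C'"
      and qu: "horn_over T q' n u (collapse n) (q' 1 e)"
      and ue: "u 1 (delta_id 1) = e"
    let ?u = "\<lambda>m. \<lambda>\<alpha>\<in>Simp (horn n 0) m. fst (u m \<alpha>)"
    have uu: "u m \<alpha> = (?u m \<alpha>, compose {..m} (snd e) (compose {..m} (collapse n) \<alpha>))"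
      if "\<alpha> \<in> Simp (horn n 0) m" for m \<alpha>
      using qu that q'_apply[OF sset_hom_in[OF u that]] q'_apply[OF e] by (simp add: prod_eq_iff)
    have uin: "?u m \<alpha> \<in> Simp C m" if "\<alpha> \<in> Simp (horn n 0) m" for m \<alpha>
      using sset_hom_in[OF u that] that by (simp add: Simp_C')
    have u': "?u \<in> sset_hom (horn n 0) C"
    proof (rule sset_homI[OF uin])
      fix l m \<alpha> \<beta> assume \<beta>: "\<beta> \<in> delta_hom l m" and \<alpha>: "\<alpha> \<in> Simp (horn n 0) m"
      show "?u l (Act (horn n 0) l m \<beta> \<alpha>) = Act C l m \<beta> (?u m \<alpha>)"
        using horn_compose[OF \<alpha> \<beta>] \<alpha> sset_hom_nat[OF u \<beta> \<alpha>] by simp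
    qed (assumption | rule restrict_extensional)+
    have ue': "?u 1 (delta_id 1) = fst e" using initial_edge_horn[OF n] ue by simp
    have qu': "q m (?u m \<alpha>) = Act (nerve P r) m 1 (compose {..m} (collapse n) \<alpha>) (q 1 (fst e))"
      if "\<alpha> \<in> Simp (horn n 0) m" for m \<alpha>
      using sset_hom_in[OF u that] arg_cong[OF uu[OF that], of snd] that eC(2) by (simp add: Simp_C')
    obtain c where c: "c \<in> Simp C n" "q n c = Act (nerve P r) n 1 (collapse n) (q 1 (fst e))"
      "\<And>m \<alpha>. \<alpha> \<in> Simp (horn n 0) m \<Longrightarrow> Act C m n \<alpha> c = ?u m \<alpha>"
      by (rule lc_edgeD[OF L n u' qu' ue']) (assumption | rule that)+
    let ?c = "(c, compose {..n} (snd e) (collapse n))"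
    have c': "?c \<in> Simp C' n" using c(1,2) T[OF collapse_in] eC(2) by (simp add: Simp_C')
    moreover have "q' n ?c = Act T n 1 (collapse n) (q' 1 e)" using q'_apply[OF c'] q'_apply[OF e] by simp
    moreover have "Act C' m n \<alpha> ?c = u m \<alpha>" if "\<alpha> \<in> Simp (horn n 0) m" for m \<alpha>
      by (subst uu[OF that]) (use c(3)[OF that] in \<open>simp add: delta_compose_assoc[OF horn_delta[OF that]]\<close>)
    ultimately show "horn_filler C' T q' n u (collapse n) (q' 1 e)" by blast
  qed
qed

end

section \<open>The restriction functor\<close>

lemma (in poset_strings) strings_eq: "strings P0 r = strings_from P0 r P0"
  by (auto simp: strings_from_def strings_def)

locale sieve_restriction = poset_strings P P0 r + C: sset_over C "nerve P r" q
  for P P0 :: "'p set" and r :: "'p rel" and C :: "'c sset" and q +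
  assumes sieve: "\<And>a b. b \<in> P0 \<Longrightarrow> a \<in> P \<Longrightarrow> (a, b) \<in> r \<Longrightarrow> a \<in> P0"
begin

sublocale C': base_restriction C P r q P0
  by unfold_locales (rule sub)

sublocale Y: poset_strings P0 P0 r
  by unfold_locales (use refl sub trans antisym in auto)

abbreviation "Y \<equiv> sd (strings P0 r)"
abbreviation "pY \<equiv> sd_max (strings P0 r)"
abbreviation "D \<equiv> Fun_cocart S X p C q"
abbreviation "D' \<equiv> Fun_cocart C'.T Y pY C'.C' C'.q'"
abbreviation "\<rho> \<equiv> restriction_functor D Y pY"

lemma Y_over: "sset_over Y C'.T pY"
  using Y.sset_over_axioms by (simp add: strings_eq)

text \<open>All entries of a string lie below the last one, so in a sieve the last entry decides.
  The maxima along a chain of strings increase, and the same argument gives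
  \<open>Y_iff\<close>.\<close>

lemma Y_A_iff: "s \<in> strings P0 r \<longleftrightarrow> s \<in> A \<and> last s \<in> P0"
proof
  assume "s \<in> strings P0 r"
  then have s: "s \<in> Y.A" by (simp add: strings_eq)
  then show "s \<in> A \<and> last s \<in> P0"
    using Y.A_D[OF s] Y.last_in[OF s] sub by (auto intro!: A_I)
next
  assume s: "s \<in> A \<and> last s \<in> P0"
  have "set s \<subseteq> P0"
  proof
    fix a assume a: "a \<in> set s"
    then show "a \<in> P0" using sieve[OF _ _ le_last] s A_D(2) by blast
  qed
  then show "s \<in> strings P0 r" using A_D[of s] s by (auto simp: strings_def)
qed

lemma Y_iff: "\<sigma> \<in> Simp Y n \<longleftrightarrow> \<sigma> \<in> Simp X n \<and> last (\<sigma> n) \<in> P0"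
proof
  assume "\<sigma> \<in> Simp Y n"
  then show "\<sigma> \<in> Simp X n \<and> last (\<sigma> n) \<in> P0" by (auto simp: Simp_nerve PiE_def Y_A_iff)
next
  assume *: "\<sigma> \<in> Simp X n \<and> last (\<sigma> n) \<in> P0"
  have "\<sigma> i \<in> strings P0 r" if "i \<le> n" for i
  proof -
    have "(last (\<sigma> i), last (\<sigma> n)) \<in> r" using last_mono XD * that by auto
    then have "last (\<sigma> i) \<in> P0" using sieve last_in XD(1) * that by blast
    then show ?thesis using XD(1) * that by (auto simp: Y_A_iff)
  qed
  then show "\<sigma> \<in> Simp Y n" using * by (auto simp: Simp_nerve PiE_def)
qed

lemma pY_eq: "\<sigma> \<in> Simp Y n \<Longrightarrow> pY n \<sigma> = p n \<sigma>"
  using Y_iff by (simp add: nerve_map_def)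

text \<open>In both subdivisions these are the edges that append one element or none, a description
  that does not refer to the ambient poset.\<close>

lemma lc_edge_Y_iff: "lc_edge Y C'.T pY e \<longleftrightarrow> e \<in> Simp Y 1 \<and> lc_edge X S p e"
  using Y.lc_edge_sd_iff lc_edge_sd_iff Y_iff by (auto simp: strings_eq)

lemmas Simp_D = Simp_Fun_cocart[OF sset_over_axioms C.sset_over_axioms]
lemmas Simp_D' = Simp_Fun_cocart[OF Y_over C'.sset_over_C']

lemma \<rho>_apply:
  "F \<in> Simp D n \<Longrightarrow> y \<in> Simp Y k \<Longrightarrow> \<alpha> \<in> delta_hom k n \<Longrightarrow> \<rho> n F k (y, \<alpha>) = (F k (y, \<alpha>), pY k y)"
  by (simp add: restriction_functor_def)

lemma \<rho>_in:
  assumes F: "F \<in> Simp D n"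
  shows "\<rho> n F \<in> Simp D' n"
proof -
  have FX: "F \<in> Simp (Fun_over X p C q) n" using F by (simp add: Simp_D)
  have in': "\<rho> n F k (y, \<alpha>) \<in> Simp C'.C' k" if y: "y \<in> Simp Y k" and \<alpha>: "\<alpha> \<in> delta_hom k n" for k y \<alpha>
  proof -
    have yX: "y \<in> Simp X k" using y Y_iff by simp
    show ?thesis
      unfolding \<rho>_apply[OF F y \<alpha>] C'.Simp_C'
      using Fun_over_in[OF FX yX \<alpha>] FX yX \<alpha> sset_hom_in[OF sset_over.p[OF Y_over] y] pY_eq[OF y]
      by (simp add: Simp_Fun_over)
  qed
  have "\<rho> n F \<in> Simp (Fun_over Y pY C'.C' C'.q') n"
    unfolding Simp_Fun_over
  proof (intro conjI sset_homI allI ballI)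
    fix k z assume z: "z \<in> Simp (sset_prod Y (std_simplex n)) k"
    then have y: "fst z \<in> Simp Y k" and \<alpha>: "snd z \<in> delta_hom k n" by auto
    show "\<rho> n F k z \<in> Simp C'.C' k" using in'[OF y \<alpha>] by simp
    fix l \<beta> assume \<beta>: "\<beta> \<in> delta_hom l k"
    have yX: "fst z \<in> Simp X k" using y Y_iff by simp
    have y': "Act Y l k \<beta> (fst z) \<in> Simp Y l" by (rule Act_in[OF simplicial_nerve \<beta> y])
    show "\<rho> n F l (Act (sset_prod Y (std_simplex n)) l k \<beta> z) = Act C'.C' l k \<beta> (\<rho> n F k z)"
      using \<rho>_apply[OF F y' delta_compose[OF \<alpha> \<beta>]] \<rho>_apply[OF F y \<alpha>] Fun_over_nat[OF FX \<beta> yX \<alpha>]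
        sset_hom_nat[OF sset_over.p[OF Y_over] \<beta> y] by simp
  next
    fix k show "\<rho> n F k \<in> extensional (Simp (sset_prod Y (std_simplex n)) k)"
      using F by (simp add: restriction_functor_def)
  next
    fix k y \<alpha> assume "y \<in> Simp Y k" "\<alpha> \<in> delta_hom k n"
    then show "C'.q' k (\<rho> n F k (y, \<alpha>)) = pY k y"
      using C'.q'_apply[OF in'] \<rho>_apply[OF F] by simp
  qed
  moreover have "lc_edge C'.C' C'.T C'.q' (\<rho> n F 1 (e, \<lambda>_\<in>{..1}. i))" if "i \<le> n" "lc_edge Y C'.T pY e" for i e
  proof -
    have e: "e \<in> Simp Y 1" "lc_edge X S p e" using that lc_edge_Y_iff by auto
    have c: "(\<lambda>_\<in>{..1}. i) \<in> delta_hom 1 n" using that by auto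
    show ?thesis
      unfolding C'.lc_edge_C'_iff[OF in'[OF e(1) c]] unfolding \<rho>_apply[OF F e(1) c]
      using F that e unfolding Simp_D by simp
  qed
  ultimately show ?thesis by (simp add: Simp_D')
qed

lemma \<rho>_hom: "\<rho> \<in> sset_hom D D'"
proof (rule sset_homI[OF \<rho>_in])
  show "\<rho> n \<in> extensional (Simp D n)" for n by (simp add: restriction_functor_def)
  fix m n \<alpha> F assume \<alpha>: "\<alpha> \<in> delta_hom m n" and F: "F \<in> Simp D n"
  have D: "simplicial_set D" "simplicial_set D'" by (auto intro: simplicial_Fun_cocart)
  have 1: "Act D m n \<alpha> F \<in> Simp D m" by (rule Act_in[OF D(1) \<alpha> F])
  have 2: "Act D' m n \<alpha> (\<rho> n F) \<in> Simp D' m" by (rule Act_in[OF D(2) \<alpha> \<rho>_in[OF F]])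
  show "\<rho> m (Act D m n \<alpha> F) = Act D' m n \<alpha> (\<rho> n F)"
  proof (rule Fun_over_eqI)
    show "\<rho> m (Act D m n \<alpha> F) \<in> Simp (Fun_over Y pY C'.C' C'.q') m" using \<rho>_in[OF 1] Simp_D' by blast
    show "Act D' m n \<alpha> (\<rho> n F) \<in> Simp (Fun_over Y pY C'.C' C'.q') m" using 2 Simp_D' by blast
    fix k y \<beta> assume y: "y \<in> Simp Y k" and \<beta>: "\<beta> \<in> delta_hom k m"
    have yX: "y \<in> Simp X k" using y Y_iff by simp
    show "\<rho> m (Act D m n \<alpha> F) k (y, \<beta>) = Act D' m n \<alpha> (\<rho> n F) k (y, \<beta>)"
      using \<rho>_apply[OF 1 y \<beta>] \<rho>_apply[OF F y delta_compose[OF \<alpha> \<beta>]]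
        Act_Fun_over_apply[OF yX \<beta>, of p C q n \<alpha> F] Act_Fun_over_apply[OF y \<beta>, of pY "C'.C'" "C'.q'" n \<alpha> "\<rho> n F"]
      by simp
  qed
qed assumption

end

section \<open>Cells of the subdivision times a simplex\<close>

locale sieve_lifting = sieve_restriction P P0 r C q
  for P P0 :: "'p set" and r :: "'p rel" and C :: "'c sset" and q +
  fixes n u v
  assumes lcf: "locally_cocartesian_fibration C S q"
    and u: "u \<in> sset_hom (boundary n) D" and v: "v \<in> sset_hom (std_simplex n) D'"
    and uv: "\<And>m \<alpha>. \<alpha> \<in> Simp (boundary n) m \<Longrightarrow> \<rho> m (u m \<alpha>) = v m \<alpha>"
begin

abbreviation Z :: "((nat \<Rightarrow> 'p list) \<times> (nat \<Rightarrow> nat)) sset" where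
  "Z \<equiv> sset_prod X (std_simplex n)"

definition pZ :: "nat \<Rightarrow> (nat \<Rightarrow> 'p list) \<times> (nat \<Rightarrow> nat) \<Rightarrow> nat \<Rightarrow> 'p" where
  "pZ = (\<lambda>k. \<lambda>z\<in>Simp Z k. p k (fst z))"

definition V :: "nat \<Rightarrow> (nat \<Rightarrow> 'p list) \<times> (nat \<Rightarrow> nat) \<Rightarrow> 'c \<times> (nat \<Rightarrow> 'p)" where
  "V = v n (delta_id n)"

text \<open>\<open>u k \<alpha>\<close> is itself a map on \<open>X\<close> times the
  \<open>k\<close>-simplex; evaluating it at the identity operator turns \<open>u\<close> into a map
  on \<open>X\<close> times the boundary. The value of \<open>v\<close> at the identity operator is
  the map \<open>V\<close> on \<open>Y\<close> times the whole simplex.\<close>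

definition start :: "(nat \<times> ((nat \<Rightarrow> 'p list) \<times> (nat \<Rightarrow> nat)) \<times> 'c) set" where
  "start = {(k, (\<sigma>, \<alpha>), u k \<alpha> k (\<sigma>, delta_id k)) | k \<sigma> \<alpha>. \<sigma> \<in> Simp X k \<and> \<alpha> \<in> Simp (boundary n) k} \<union>
           {(k, (\<sigma>, \<alpha>), fst (V k (\<sigma>, \<alpha>))) | k \<sigma> \<alpha>. \<sigma> \<in> Simp Y k \<and> \<alpha> \<in> delta_hom k n}"

lemma boundary_delta: "\<alpha> \<in> Simp (boundary n) k \<Longrightarrow> \<alpha> \<in> delta_hom k n"
  by (simp add: Simp_boundary)

lemma boundary_compose: "\<alpha> \<in> Simp (boundary n) k \<Longrightarrow> \<theta> \<in> delta_hom l k \<Longrightarrow> compose {..l} \<alpha> \<theta> \<in> Simp (boundary n) l"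
proof -
  assume \<alpha>: "\<alpha> \<in> Simp (boundary n) k" and \<theta>: "\<theta> \<in> delta_hom l k"
  have "compose {..l} \<alpha> \<theta> ` {..l} \<subseteq> \<alpha> ` {..k}" using delta_hom_le[OF \<theta>] by (auto simp: compose_def)
  moreover have "\<alpha> ` {..k} \<subset> {..n}" using \<alpha> by (auto simp: Simp_boundary delta_hom_le)
  ultimately show ?thesis using \<alpha> \<theta> by (auto simp: Simp_boundary)
qed

lemma uD: "\<alpha> \<in> Simp (boundary n) k \<Longrightarrow> u k \<alpha> \<in> Simp D k"
  by (rule sset_hom_in[OF u])

lemma uF: "\<alpha> \<in> Simp (boundary n) k \<Longrightarrow> u k \<alpha> \<in> Simp (Fun_over X p C q) k"
  using uD Simp_D by blast

lemma u_Act: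
  assumes "\<alpha> \<in> Simp (boundary n) k" "\<theta> \<in> delta_hom l k" "x \<in> Simp X m" "\<beta> \<in> delta_hom m l"
  shows "u l (compose {..l} \<alpha> \<theta>) m (x, \<beta>) = u k \<alpha> m (x, compose {..m} \<theta> \<beta>)"
  using sset_hom_nat[OF u assms(2,1)] Act_Fun_over_apply[OF assms(3,4), of p C q k \<theta> "u k \<alpha>"] by simp

lemma V_D: "V \<in> Simp D' n"
  unfolding V_def by (rule sset_hom_in[OF v]) simp

lemma V_F: "V \<in> Simp (Fun_over Y pY C'.C' C'.q') n"
  using V_D Simp_D' by blast

lemma v_eq: "\<alpha> \<in> delta_hom m n \<Longrightarrow> v m \<alpha> = Act D' m n \<alpha> V"
  unfolding V_def using sset_hom_nat[OF v, of \<alpha> m n "delta_id n"] by simp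

lemma V_in: "\<sigma> \<in> Simp Y k \<Longrightarrow> \<alpha> \<in> delta_hom k n \<Longrightarrow> V k (\<sigma>, \<alpha>) \<in> Simp C'.C' k"
  by (rule Fun_over_in[OF V_F])

lemma snd_V:
  assumes "\<sigma> \<in> Simp Y k" "\<alpha> \<in> delta_hom k n"
  shows "snd (V k (\<sigma>, \<alpha>)) = pY k \<sigma>"
  using V_F assms C'.q'_apply[OF V_in[OF assms]] by (simp add: Simp_Fun_over)

lemma start_overlap:
  assumes \<sigma>: "\<sigma> \<in> Simp Y k" and \<alpha>: "\<alpha> \<in> Simp (boundary n) k"
  shows "u k \<alpha> k (\<sigma>, delta_id k) = fst (V k (\<sigma>, \<alpha>))"
proof -
  have "\<rho> k (u k \<alpha>) k (\<sigma>, delta_id k) = V k (\<sigma>, \<alpha>)"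
    using uv[OF \<alpha>] v_eq[OF boundary_delta[OF \<alpha>]]
      Act_Fun_over_apply[OF \<sigma> delta_id_in, of pY "C'.C'" "C'.q'" n \<alpha> V] boundary_delta[OF \<alpha>] by simp
  then show ?thesis using \<rho>_apply[OF uD[OF \<alpha>] \<sigma> delta_id_in] by (metis fst_conv)
qed

lemma start_dom:
  "(k, (\<sigma>, \<alpha>)) \<in> gdom start \<longleftrightarrow>
     \<sigma> \<in> Simp X k \<and> \<alpha> \<in> delta_hom k n \<and> (\<alpha> ` {..k} \<noteq> {..n} \<or> last (\<sigma> k) \<in> P0)"
  unfolding gdom_def start_def using Y_iff[of \<sigma> k] by (auto simp: Simp_boundary)

lemma Z_over: "sset_over Z S pZ"
proof
  show "simplicial_set Z" by auto
  show "pZ \<in> sset_hom Z S"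
  proof (rule sset_homI)
    show "pZ k z \<in> Simp S k" if "z \<in> Simp Z k" for k z
      using that sset_hom_in[OF p_hom] by (auto simp: pZ_def)
    show "pZ k \<in> extensional (Simp Z k)" for k unfolding pZ_def by simp
    show "pZ m (Act Z m k \<alpha> z) = Act S m k \<alpha> (pZ k z)" if \<alpha>: "\<alpha> \<in> delta_hom m k" and z: "z \<in> Simp Z k" for m k \<alpha> z
    proof -
      have "Act Z m k \<alpha> z \<in> Simp Z m" by (rule Act_in[OF _ \<alpha> z]) auto
      moreover have "fst z \<in> Simp X k" using z by auto
      ultimately show ?thesis using sset_hom_nat[OF p_hom \<alpha>] z by (simp add: pZ_def)
    qed
  qed
qed simp

lemma pZ_apply: "\<sigma> \<in> Simp X k \<Longrightarrow> \<alpha> \<in> delta_hom k n \<Longrightarrow> pZ k (\<sigma>, \<alpha>) = p k \<sigma>"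
  by (simp add: pZ_def)

lemma start_map: "partial_map Z pZ C q start"
  unfolding partial_map_def
proof (intro conjI allI impI ballI)
  fix k z c assume "(k, z, c) \<in> start"
  then consider (b) \<sigma> \<alpha> where "z = (\<sigma>, \<alpha>)" "\<sigma> \<in> Simp X k" "\<alpha> \<in> Simp (boundary n) k" "c = u k \<alpha> k (\<sigma>, delta_id k)"
    | (y) \<sigma> \<alpha> where "z = (\<sigma>, \<alpha>)" "\<sigma> \<in> Simp Y k" "\<alpha> \<in> delta_hom k n" "c = fst (V k (\<sigma>, \<alpha>))"
    by (auto simp: start_def)
  note cs = this
  show "z \<in> Simp Z k" by (rule cs) (auto simp: boundary_delta Y_iff)
  show "c \<in> Simp C k"
  proof (rule cs)
    fix \<sigma> \<alpha> assume "\<sigma> \<in> Simp X k" "\<alpha> \<in> Simp (boundary n) k" "c = u k \<alpha> k (\<sigma>, delta_id k)"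
    then show ?thesis using Fun_over_in[OF uF] by blast
  next
    fix \<sigma> \<alpha> assume "\<sigma> \<in> Simp Y k" "\<alpha> \<in> delta_hom k n" "c = fst (V k (\<sigma>, \<alpha>))"
    then show ?thesis using V_in C'.Simp_C' by blast
  qed
  show "q k c = pZ k z"
  proof (rule cs)
    fix \<sigma> \<alpha> assume "z = (\<sigma>, \<alpha>)" "\<sigma> \<in> Simp X k" "\<alpha> \<in> Simp (boundary n) k" "c = u k \<alpha> k (\<sigma>, delta_id k)"
    then show ?thesis using uF[of \<alpha> k] pZ_apply[OF _ boundary_delta] by (simp add: Simp_Fun_over)
  next
    fix \<sigma> \<alpha> assume *: "z = (\<sigma>, \<alpha>)" "\<sigma> \<in> Simp Y k" "\<alpha> \<in> delta_hom k n" "c = fst (V k (\<sigma>, \<alpha>))"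
    have "q k c = snd (V k (\<sigma>, \<alpha>))" using V_in[OF *(2,3)] *(4) by (simp add: C'.Simp_C')
    then show ?thesis using snd_V[OF *(2,3)] pY_eq[OF *(2)] pZ_apply[of \<sigma> k \<alpha>] * Y_iff by simp
  qed
  fix m \<theta> assume \<theta>: "\<theta> \<in> delta_hom m k"
  show "(m, Act Z m k \<theta> z, Act C m k \<theta> c) \<in> start"
  proof (rule cs)
    fix \<sigma> \<alpha> assume *: "z = (\<sigma>, \<alpha>)" "\<sigma> \<in> Simp X k" "\<alpha> \<in> Simp (boundary n) k" "c = u k \<alpha> k (\<sigma>, delta_id k)"
    have X': "Act X m k \<theta> \<sigma> \<in> Simp X m" by (rule Act_in[OF simplicial_nerve \<theta> *(2)])
    have "Act C m k \<theta> c = u m (compose {..m} \<alpha> \<theta>) m (Act X m k \<theta> \<sigma>, delta_id m)"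
      using Fun_over_nat[OF uF[OF *(3)] \<theta> *(2) delta_id_in] u_Act[OF *(3) \<theta> X' delta_id_in] *(4) \<theta> by simp
    then show ?thesis using *(1) X' boundary_compose[OF *(3) \<theta>] unfolding start_def by auto
  next
    fix \<sigma> \<alpha> assume *: "z = (\<sigma>, \<alpha>)" "\<sigma> \<in> Simp Y k" "\<alpha> \<in> delta_hom k n" "c = fst (V k (\<sigma>, \<alpha>))"
    have Y': "Act Y m k \<theta> \<sigma> \<in> Simp Y m" by (rule Act_in[OF simplicial_nerve \<theta> *(2)])
    have "Act C m k \<theta> c = fst (V m (Act Y m k \<theta> \<sigma>, compose {..m} \<alpha> \<theta>))"
      using Fun_over_nat[OF V_F \<theta> *(2,3)] *(4) by simp
    then show ?thesis using *(1) Y' delta_compose[OF *(3) \<theta>] unfolding start_def by auto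
  qed
next
  fix k z c c' assume "(k, z, c) \<in> start" "(k, z, c') \<in> start"
  then show "c = c'" using start_overlap unfolding start_def by fastforce
qed

text \<open>Identity edges are left out although they are locally cocartesian in \<open>X\<close>:
  attaching a cell can create new ones, which would violate \<open>new_marked\<close>. They are
  treated once the extension exists.\<close>

definition edges :: "((nat \<Rightarrow> 'p list) \<times> (nat \<Rightarrow> nat)) set" where
  "edges = {(\<sigma>, \<alpha>). \<alpha> 0 = \<alpha> 1 \<and> (\<exists>b. \<sigma> 1 = \<sigma> 0 @ [b])}"

text \<open>A constant edge at \<open>i\<close> factors through the vertex \<open>i\<close> of the
  simplex. If that vertex is in the boundary, the value of \<open>u\<close> at it preserves locally
  cocartesian edges; over \<open>Y\<close> the vertices of \<open>V\<close> do.\<close>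

lemma start_marked:
  assumes c: "(1, (\<sigma>, \<lambda>_\<in>{..1}. i), c) \<in> start" and i: "i \<le> n" and \<sigma>: "lc_edge X S p \<sigma>"
  shows "lc_edge C S q c"
proof -
  let ?a = "\<lambda>_\<in>{..1::nat}. i"
  from c consider "\<sigma> \<in> Simp X 1" "?a \<in> Simp (boundary n) 1" "c = u 1 ?a 1 (\<sigma>, delta_id 1)"
    | "\<sigma> \<in> Simp Y 1" "c = fst (V 1 (\<sigma>, ?a))"
    unfolding start_def by auto
  then show ?thesis
  proof cases
    case 1
    let ?b = "\<lambda>_\<in>{..0::nat}. i" and ?o = "\<lambda>_\<in>{..1::nat}. 0::nat"
    have o: "?o \<in> delta_hom 1 0" by auto
    have "?a ` {..1::nat} = {i}" "?b ` {..0::nat} = {i}" by auto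
    then have b: "?b \<in> Simp (boundary n) 0" using 1(2) i by (simp add: Simp_boundary)
    have "compose {..1} ?b ?o = ?a" by (rule compose_const[OF o])
    then have "c = u 0 ?b 1 (\<sigma>, ?o)"
      using u_Act[OF b o 1(1) delta_id_in] 1(3) o by simp
    then show ?thesis using uD[OF b] \<sigma> unfolding Simp_D by simp
  next
    case 2
    have a: "?a \<in> delta_hom 1 n" using i by auto
    have "lc_edge Y C'.T pY \<sigma>" using 2 \<sigma> by (simp add: lc_edge_Y_iff)
    then have "lc_edge C'.C' C'.T C'.q' (V 1 (\<sigma>, ?a))" using V_D i unfolding Simp_D' by simp
    then show ?thesis using C'.lc_edge_C'_iff[OF V_in[OF 2(1) a]] 2(2) by simp
  qed
qed

text \<open>
  A cell is a chain \<open>(\<sigma>, w)\<close> in \<open>sd(P)\<^sub>0 \<times> [n]\<close> without repetitions, outside the starting data, in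
  which the first string containing the last element \<open>c\<close> of the top string is \<open>\<sigma>\<^sub>i\<^sub>+\<^sub>1 = \<sigma>\<^sub>i @ [c]\<close>,
  with the same \<open>[n]\<close>-component as \<open>\<sigma>\<^sub>i\<close>. The missing face omits \<open>\<sigma>\<^sub>i\<close>.
\<close>

definition cells :: "(nat \<times> ((nat \<Rightarrow> 'p list) \<times> (nat \<Rightarrow> nat)) \<times> nat) set" where
  "cells = {(m, (\<sigma>, w), i). \<sigma> \<in> Simp X (Suc m) \<and> w \<in> delta_hom (Suc m) n \<and> i \<le> m \<and>
     w ` {..Suc m} = {..n} \<and> last (\<sigma> (Suc m)) \<notin> P0 \<and>
     (\<forall>j\<le>m. (\<sigma> j, w j) \<noteq> (\<sigma> (Suc j), w (Suc j))) \<and>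
     \<sigma> (Suc i) = \<sigma> i @ [last (\<sigma> (Suc m))] \<and> w (Suc i) = w i}"

text \<open>The third entry puts cells with larger \<open>i\<close> first: if a face of a cell is
  the missing face of another cell whose top string has the same length, the index of the other cell
  is larger.\<close>

definition rank :: "nat \<times> ((nat \<Rightarrow> 'p list) \<times> (nat \<Rightarrow> nat)) \<times> nat \<Rightarrow> nat \<times> nat \<times> nat" where
  "rank = (\<lambda>(m, (\<sigma>, w), i). (length (\<sigma> (Suc m)), m, m - i))"

lemma cellsD:
  assumes "(m, (\<sigma>, w), i) \<in> cells"
  shows "\<sigma> \<in> Simp X (Suc m)" "w \<in> delta_hom (Suc m) n" "i \<le> m" "w ` {..Suc m} = {..n}"
    "last (\<sigma> (Suc m)) \<notin> P0" "\<And>j. j \<le> m \<Longrightarrow> (\<sigma> j, w j) \<noteq> (\<sigma> (Suc j), w (Suc j))"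
    "\<sigma> (Suc i) = \<sigma> i @ [last (\<sigma> (Suc m))]" "w (Suc i) = w i"
  using assms unfolding cells_def by auto

lemma chain_distinct:
  assumes \<sigma>: "\<sigma> \<in> Simp X m" and w: "w \<in> delta_hom m n"
    and ne: "\<And>j. j < m \<Longrightarrow> (\<sigma> j, w j) \<noteq> (\<sigma> (Suc j), w (Suc j))" and ab: "a < b" "b \<le> m"
  shows "(\<sigma> a, w a) \<noteq> (\<sigma> b, w b)"
proof
  assume eq: "(\<sigma> a, w a) = (\<sigma> b, w b)"
  have "subseq (\<sigma> a) (\<sigma> (Suc a))" "subseq (\<sigma> (Suc a)) (\<sigma> b)" using XD(2)[OF \<sigma>] ab by auto
  then have "\<sigma> (Suc a) = \<sigma> a" using eq subseq_order.antisym by auto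
  moreover have "w a \<le> w (Suc a)" "w (Suc a) \<le> w b" using delta_hom_mono[OF w] ab by auto
  then have "w (Suc a) = w a" using eq by simp
  ultimately show False using ne[of a] ab by simp
qed

lemma cell_distinct:
  assumes "(m, (\<sigma>, w), i) \<in> cells" "a \<le> Suc m" "b \<le> Suc m" "\<sigma> a = \<sigma> b" "w a = w b"
  shows "a = b"
proof -
  note c = cellsD[OF assms(1)]
  have "(\<sigma> a, w a) \<noteq> (\<sigma> b, w b)" if "a < b" "b \<le> Suc m" for a b
    by (rule chain_distinct[OF c(1,2) _ that]) (use c(6) in auto)
  then show ?thesis using assms(2-5) by (metis linorder_cases)
qed

text \<open>Inclusions along the chain carry the element upwards and its absence downwards. The
  index \<open>i\<close> is therefore determined by the chain of strings.\<close>

lemma cell_first: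
  assumes "(m, (\<sigma>, w), i) \<in> cells" "a \<le> Suc m"
  shows "last (\<sigma> (Suc m)) \<in> set (\<sigma> a) \<longleftrightarrow> i < a"
proof -
  note c = cellsD[OF assms(1)]
  have ci: "\<sigma> (Suc i) \<in> A" using XD(1)[OF c(1)] c(3) by simp
  have "last (\<sigma> (Suc m)) \<notin> set (\<sigma> i)" using last_notin_butlast[OF ci] c(7) by simp
  moreover have "set (\<sigma> a) \<subseteq> set (\<sigma> i)" if "a \<le> i" using subseq_set XD(2)[OF c(1) that] c(3) by auto
  moreover have "last (\<sigma> (Suc m)) \<in> set (\<sigma> (Suc i))" unfolding c(7) by simp
  moreover have "set (\<sigma> (Suc i)) \<subseteq> set (\<sigma> a)" if "i < a" using subseq_set XD(2)[OF c(1), of "Suc i" a] that assms(2) by auto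
  ultimately show ?thesis by (metis in_mono not_le)
qed

section \<open>The matching of missing chains with cells\<close>

lemma insert_chain:
  assumes \<sigma>: "\<sigma> \<in> Simp X m" and i: "i \<le> m" and s: "s \<in> A" "subseq s (\<sigma> i)" "\<And>j. j < i \<Longrightarrow> subseq (\<sigma> j) s"
  shows "insert_at m i s \<sigma> \<in> Simp X (Suc m)"
proof (rule nerveI)
  fix a assume "a \<le> Suc m"
  then show "insert_at m i s \<sigma> a \<in> A" using XD(1)[OF \<sigma>] s(1) i by (auto simp: insert_at_def)
next
  fix a b assume ab: "a \<le> b" "b \<le> Suc m"
  have si: "subseq s (\<sigma> k)" if "i \<le> k" "k \<le> m" for k
    using s(2) XD(2)[OF \<sigma> that] by (rule subseq_order.order_trans)
  show "(insert_at m i s \<sigma> a, insert_at m i s \<sigma> b) \<in> string_incl"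
    using ab i s(3)[of a] si[of "b - 1"] XD(2)[OF \<sigma>, of a b] XD(2)[OF \<sigma>, of a "b - 1"] XD(2)[OF \<sigma>, of "a - 1" "b - 1"]
    by (auto simp: insert_at_def string_incl_def)
qed (simp add: insert_at_def)

lemma insert_delta:
  assumes w: "w \<in> delta_hom m n" and i: "i \<le> m"
  shows "insert_at m i (w i) w \<in> delta_hom (Suc m) n" "insert_at m i (w i) w ` {..Suc m} = w ` {..m}"
proof -
  have eq: "insert_at m i (w i) w a = w (if a \<le> i then a else a - 1)" if "a \<le> Suc m" for a
    using that by (auto simp: insert_at_def)
  show "insert_at m i (w i) w \<in> delta_hom (Suc m) n"
  proof (rule delta_homI)
    fix a assume "a \<le> Suc m"
    then show "insert_at m i (w i) w a \<le> n" using delta_hom_le[OF w] i by (auto simp: eq)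
  next
    fix a b assume ab: "a \<le> b" "b \<le> Suc m"
    then show "insert_at m i (w i) w a \<le> insert_at m i (w i) w b"
      unfolding eq[OF ab(2)] eq[OF order_trans[OF ab]] by (intro delta_hom_mono[OF w]) (use i in auto)
  qed (simp add: insert_at_def)
  show "insert_at m i (w i) w ` {..Suc m} = w ` {..m}"
  proof
    show "insert_at m i (w i) w ` {..Suc m} \<subseteq> w ` {..m}" using i by (auto simp: eq)
    show "w ` {..m} \<subseteq> insert_at m i (w i) w ` {..Suc m}"
    proof
      fix y assume "y \<in> w ` {..m}"
      then obtain a where a: "a \<le> m" "y = w a" by auto
      show "y \<in> insert_at m i (w i) w ` {..Suc m}"
        by (rule image_eqI[of _ _ "if a \<le> i then a else Suc a"]) (use a in \<open>auto simp: eq\<close>)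
    qed
  qed
qed

text \<open>Let \<open>i\<close> be the first position whose string contains the last element of the
  top string. If the position before holds that string without this element, at the same place of
  \<open>[n]\<close>, the chain is a cell. Otherwise inserting the shorter string makes it one; this
  string is in \<open>A\<close> because the element is outside \<open>P0\<close>. The further
  conclusions of \<open>face\<close> are recorded for \<open>cell_faces\<close>.\<close>

lemma classify:
  assumes \<sigma>: "\<sigma> \<in> Simp X m" and w: "w \<in> delta_hom m n"
    and ne: "\<forall>j<m. (\<sigma> j, w j) \<noteq> (\<sigma> (Suc j), w (Suc j))" and new: "(m, (\<sigma>, w)) \<notin> gdom start"
  obtains (cell) l i where "m = Suc l" "(l, (\<sigma>, w), i) \<in> cells"
  | (face) \<sigma>' w' i where "(m, (\<sigma>', w'), i) \<in> cells" "\<sigma> = compose {..m} \<sigma>' (coface m i)"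
      "w = compose {..m} w' (coface m i)" "\<sigma>' (Suc m) = \<sigma> m" "last (\<sigma> m) \<in> set (\<sigma> i)"
      "\<forall>j<i. last (\<sigma> m) \<notin> set (\<sigma> j)" "\<forall>j. i = Suc j \<longrightarrow> \<sigma> i = \<sigma> j @ [last (\<sigma> m)] \<longrightarrow> w i \<noteq> w j"
proof -
  let ?c = "last (\<sigma> m)"
  have surj: "w ` {..m} = {..n}" and c: "?c \<notin> P0" using new \<sigma> w by (auto simp: start_dom)
  define i where "i = (LEAST i. ?c \<in> set (\<sigma> i))"
  have m\<sigma>: "\<sigma> m \<in> A" using XD(1)[OF \<sigma>] by simp
  have cm: "?c \<in> set (\<sigma> m)" using A_D(1)[OF m\<sigma>] by simp
  have ci: "?c \<in> set (\<sigma> i)" unfolding i_def by (rule LeastI[of "\<lambda>i. ?c \<in> set (\<sigma> i)", OF cm])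
  have im: "i \<le> m" unfolding i_def by (rule Least_le[of "\<lambda>i. ?c \<in> set (\<sigma> i)", OF cm])
  have ltI: "\<forall>j<i. ?c \<notin> set (\<sigma> j)" unfolding i_def using not_less_Least by blast
  have i\<sigma>: "\<sigma> i \<in> A" using XD(1)[OF \<sigma> im] .
  have li: "last (\<sigma> i) = ?c" using subseq_last[OF i\<sigma> m\<sigma> _ ci] XD(2)[OF \<sigma> im] by simp
  have si: "\<sigma> i = butlast (\<sigma> i) @ [?c]" using append_butlast_last_id[OF A_D(1)[OF i\<sigma>]] li by simp
  have bA: "butlast (\<sigma> i) \<in> A" using butlast_in[OF i\<sigma>] li c by simp
  show thesis
  proof (cases "\<exists>j. i = Suc j \<and> \<sigma> i = \<sigma> j @ [?c] \<and> w i = w j")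
    case True
    then obtain j where j: "i = Suc j" "\<sigma> i = \<sigma> j @ [?c]" "w i = w j" by auto
    then obtain l where l: "m = Suc l" using im by (cases m) auto
    have "(l, (\<sigma>, w), j) \<in> cells" using \<sigma> w ne surj c j l im by (auto simp: cells_def)
    with l show thesis by (rule cell)
  next
    case False
    let ?\<sigma> = "insert_at m i (butlast (\<sigma> i)) \<sigma>" and ?w = "insert_at m i (w i) w"
    have below: "subseq (\<sigma> j) (butlast (\<sigma> i))" if "j < i" for j
      using subseq_butlast(1)[OF _ i\<sigma>] XD[OF \<sigma>] that im ltI li by simp
    have bl: "subseq (butlast (\<sigma> i)) (\<sigma> i)" using si subseq_rev_drop_many[OF subseq_order.order_refl] by metis
    have "(m, (?\<sigma>, ?w), i) \<in> cells"
      unfolding cells_def mem_Collect_eq prod.case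
    proof (intro conjI allI impI)
      show "?\<sigma> \<in> Simp X (Suc m)" by (rule insert_chain[OF \<sigma> im bA bl below])
      show "?w \<in> delta_hom (Suc m) n" "?w ` {..Suc m} = {..n}" using insert_delta[OF w im] surj by auto
      show "i \<le> m" by (rule im)
      show "last (?\<sigma> (Suc m)) \<notin> P0" using c im by (simp add: insert_at_def)
      show "?\<sigma> (Suc i) = ?\<sigma> i @ [last (?\<sigma> (Suc m))]" using si im by (simp add: insert_at_def)
      show "?w (Suc i) = ?w i" using im by (simp add: insert_at_def)
      fix j assume j: "j \<le> m"
      consider "Suc j < i" | "Suc j = i" | "j = i" | "i < j" by linarith
      then show "(?\<sigma> j, ?w j) \<noteq> (?\<sigma> (Suc j), ?w (Suc j))"
      proof cases
        case 1
        then show ?thesis using ne j im by (auto simp: insert_at_def)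
      next
        case 2
        \<comment> \<open>Equality with the inserted pair would make position \<open>j\<close> the
          predecessor that this case excludes.\<close>
        have "\<not> (\<sigma> j = butlast (\<sigma> i) \<and> w j = w i)" using False si 2 by metis
        then show ?thesis using 2 j by (auto simp: insert_at_def)
      next
        case 3
        have "butlast (\<sigma> i) \<noteq> \<sigma> i" using si by (metis append_self_conv not_Cons_self2)
        then show ?thesis using 3 j by (auto simp: insert_at_def)
      next
        case 4
        then obtain a where "j = Suc a" by (cases j) auto
        then show ?thesis using 4 ne j by (auto simp: insert_at_def)
      qed
    qed
    moreover have "compose {..m} ?\<sigma> (coface m i) = \<sigma>" "compose {..m} ?w (coface m i) = w"
      using insert_at_coface[OF nerveD(3)[OF \<sigma>], of i] insert_at_coface[OF delta_hom_ext[OF w], of i] im by simp_all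
    moreover have "?\<sigma> (Suc m) = \<sigma> m" using im by (simp add: insert_at_def)
    ultimately show thesis using face[of ?\<sigma> ?w i] ci ltI False by metis
  qed
qed

text \<open>Deleting position \<open>i\<close> keeps the image in \<open>[n]\<close>, since the next
  position has the same component, and keeps the top string, since \<open>i \<le> m\<close>.\<close>

lemma cell_missing:
  assumes B: "(m, (\<sigma>, w), i) \<in> cells"
  shows "(m, (compose {..m} \<sigma> (coface m i), compose {..m} w (coface m i))) \<notin> gdom start"
proof -
  note c = cellsD[OF B]
  have "compose {..m} w (coface m i) ` {..m} = w ` {..Suc m}"
  proof
    show "w ` {..Suc m} \<subseteq> compose {..m} w (coface m i) ` {..m}"
    proof
      fix y assume "y \<in> w ` {..Suc m}"
      then obtain a where a: "a \<le> Suc m" "y = w a" by auto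
      show "y \<in> compose {..m} w (coface m i) ` {..m}"
        by (rule image_eqI[of _ _ "if a \<le> i then a else a - 1"]; cases a i rule: linorder_cases)
          (use a c(3,8) in \<open>auto simp: compose_def coface_def\<close>)
    qed
  qed (auto simp: compose_def coface_def)
  moreover have "compose {..m} \<sigma> (coface m i) m = \<sigma> (Suc m)" using c(3) by (simp add: compose_def coface_def)
  ultimately show ?thesis using c(4,5) by (simp add: start_dom)
qed

text \<open>A new face with a shorter top string leads to a cell of smaller rank, and so does one
  that is itself a cell. Otherwise it is the missing face of a cell with \<open>i' > i\<close>:
  deleting a position below \<open>i\<close> would leave the pair at \<open>i\<close> and
  \<open>i + 1\<close> intact, and the face would be a cell.\<close>

lemma cell_faces:
  assumes B: "(m, (\<sigma>, w), i) \<in> cells" and j: "j \<le> Suc m" "j \<noteq> i"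
  defines "z \<equiv> (compose {..m} \<sigma> (coface m j), compose {..m} w (coface m j))"
  shows "(m, z) \<in> gdom start \<or>
    (\<exists>m' x' i'. (m', x', i') \<in> cells \<and>
       (rank (m', x', i'), rank (m, (\<sigma>, w), i)) \<in> less_than <*lex*> less_than <*lex*> less_than \<and>
       (\<exists>\<beta>\<in>delta_hom m (Suc m'). z = (compose {..m} (fst x') \<beta>, compose {..m} (snd x') \<beta>)))"
proof (cases "(m, z) \<in> gdom start")
  case False
  note c = cellsD[OF B]
  let ?\<sigma> = "compose {..m} \<sigma> (coface m j)" and ?w = "compose {..m} w (coface m j)"
  have z: "?\<sigma> a = \<sigma> (if a < j then a else Suc a)" "?w a = w (if a < j then a else Suc a)" if "a \<le> m" for a
    using that by (auto simp: compose_def coface_apply)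
  have \<sigma>: "?\<sigma> \<in> Simp X m" using Act_in[OF simplicial_nerve coface_in c(1)] by simp
  have w: "?w \<in> delta_hom m n" by (rule delta_compose[OF c(2) coface_in])
  have ne: "\<forall>a<m. (?\<sigma> a, ?w a) \<noteq> (?\<sigma> (Suc a), ?w (Suc a))"
  proof (intro allI impI notI)
    fix a assume a: "a < m" and eq: "(?\<sigma> a, ?w a) = (?\<sigma> (Suc a), ?w (Suc a))"
    have "(if a < j then a else Suc a) = (if Suc a < j then Suc a else Suc (Suc a))"
      by (rule cell_distinct[OF B]) (use a eq z[of a] z[of "Suc a"] in auto)
    then show False by (auto split: if_splits)
  qed
  have top: "subseq (?\<sigma> m) (\<sigma> (Suc m))" using XD(2)[OF c(1)] z(1)[of m] by auto
  have len: "length (?\<sigma> m) \<le> length (\<sigma> (Suc m))" using top by (rule list_emb_length)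
  have False': "(m, (?\<sigma>, ?w)) \<notin> gdom start" using False unfolding z_def .
  show ?thesis
  proof (rule classify[OF \<sigma> w ne False'], goal_cases)
    case (1 l i')
    have "(rank (l, (?\<sigma>, ?w), i'), rank (m, (\<sigma>, w), i)) \<in> less_than <*lex*> less_than <*lex*> less_than"
      using len 1(1) unfolding rank_def by (auto simp: le_less)
    moreover have "z = (compose {..m} (fst (?\<sigma>, ?w)) (delta_id m), compose {..m} (snd (?\<sigma>, ?w)) (delta_id m))"
      using Act_id[OF simplicial_nerve \<sigma>] w unfolding z_def by simp
    moreover have "delta_id m \<in> delta_hom m (Suc l)" using 1(1) by simp
    ultimately show ?thesis using 1(2) by blast
  next
    case (2 \<sigma>' w' i')
    have im': "i' \<le> m" using cellsD(3)[OF 2(1)] .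
    have "i < i'" if eq: "length (?\<sigma> m) = length (\<sigma> (Suc m))"
    proof -
      have t: "?\<sigma> m = \<sigma> (Suc m)" by (rule subseq_same_length[OF top eq])
      have first: "last (\<sigma> (Suc m)) \<in> set (?\<sigma> a) \<longleftrightarrow> i < (if a < j then a else Suc a)" if "a \<le> m" for a
        unfolding z(1)[OF that] by (rule cell_first[OF B]) (use that in auto)
      show ?thesis
      proof (cases "j < i")
        case True
        then have i0: "0 < i" by simp
        have "i \<le> m" using c(3) .
        have "\<not> i < i'" using 2(6) first[of i] True c(3) unfolding t by auto
        moreover have "i \<le> i'" using 2(5) first[OF im'] True unfolding t by (auto split: if_splits)
        ultimately have ii: "i' = Suc (i - 1)" using i0 by simp
        \<comment> \<open>The pair at \<open>i\<close> and \<open>i + 1\<close> has moved down by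
          one position and is a predecessor of the kind that \<open>classify\<close> rules out
          here.\<close>
        have "?\<sigma> i' = ?\<sigma> (i - 1) @ [last (?\<sigma> m)]" "?w i' = ?w (i - 1)"
          using z[of i'] z[of "i - 1"] True ii c(3,7,8) i0 unfolding t by auto
        then show ?thesis using 2(7) ii by simp
      next
        case False
        then have "i < j" using j(2) by simp
        then show ?thesis using 2(5) first[OF im'] unfolding t by (auto split: if_splits)
      qed
    qed
    then have "(rank (m, (\<sigma>', w'), i'), rank (m, (\<sigma>, w), i)) \<in> less_than <*lex*> less_than <*lex*> less_than"
      using len im' unfolding rank_def prod.case 2(4) by (auto simp: le_less)
    moreover have "z = (compose {..m} (fst (\<sigma>', w')) (coface m i'), compose {..m} (snd (\<sigma>', w')) (coface m i'))"
      using 2(2,3) unfolding z_def by simp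
    ultimately show ?thesis using 2(1) coface_in by blast
  qed
qed simp

text \<open>First occurrences of the top element pin down the indices. If the whole cell were a
  missing face, then \<open>i' = i + 1\<close> and the deleted string would repeat the one at
  \<open>i\<close>, against distinctness. If the missing faces agree, so do the indices, and the
  deleted string is the next one without the top element.\<close>

lemma cell_separate:
  assumes B: "(m, (\<sigma>, w), i) \<in> cells" and B': "(m', (\<sigma>', w'), i') \<in> cells"
    and \<alpha>: "\<alpha> \<in> delta_hom m' (Suc m)" "\<alpha> \<notin> Simp (horn (Suc m) i) m'"
    and eq: "compose {..m'} \<sigma>' (coface m' i') = compose {..m'} \<sigma> \<alpha>"
      "compose {..m'} w' (coface m' i') = compose {..m'} w \<alpha>"
  shows "m' = m \<and> \<sigma>' = \<sigma> \<and> w' = w"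
proof -
  note c = cellsD[OF B] and c' = cellsD[OF B']
  have iSm: "i \<le> Suc m" using c(3) by simp
  let ?f = "\<lambda>a. if a < i' then a else Suc a"
  have z: "\<sigma>' (?f a) = \<sigma> (\<alpha> a)" "w' (?f a) = w (\<alpha> a)" if "a \<le> m'" for a
    using fun_cong[OF eq(1), of a] fun_cong[OF eq(2), of a] that by (auto simp: compose_def coface_apply)
  have "inj_on \<alpha> {..m'}"
  proof (rule inj_onI)
    fix a b assume ab: "a \<in> {..m'}" "b \<in> {..m'}" "\<alpha> a = \<alpha> b"
    have "?f a = ?f b" by (rule cell_distinct[OF B']) (use ab z[of a] z[of b] in auto)
    then show "a = b" by (auto split: if_splits)
  qed
  from \<alpha> iSm this show ?thesis
  proof (cases rule: nonhorn_injective)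
    case 1
    have z': "\<sigma>' (?f a) = \<sigma> a" "w' (?f a) = w a" if "a \<le> m'" for a using z[OF that] that 1 by auto
    have top: "\<sigma>' (Suc m') = \<sigma> (Suc m)" using z'(1)[of m'] c'(3) 1 by simp
    have first: "i < a \<longleftrightarrow> i' < ?f a" if "a \<le> m'" for a
      using cell_first[OF B, of a] cell_first[OF B', of "?f a"] z'(1)[OF that] that top 1 by auto
    have ii: "i' = Suc i" using first[of i'] first[of i] first[of "Suc i"] c(3) c'(3) 1 by (auto split: if_splits)
    have "\<sigma>' (Suc i') = \<sigma> (Suc i)" "w' (Suc i') = w (Suc i)" "\<sigma>' i = \<sigma> i" "w' i = w i"
      using z'[of i'] z'[of i] ii c(3) c'(3) 1 by auto
    then have "\<sigma>' i' = \<sigma>' i" "w' i' = w' i" using c(7,8) c'(7,8) top by auto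
    then show ?thesis using cell_distinct[OF B', of i' i] ii c'(3) by simp
  next
    case 2
    have z': "\<sigma>' (?f a) = \<sigma> (if a < i then a else Suc a)" "w' (?f a) = w (if a < i then a else Suc a)" if "a \<le> m" for a
      using z[of a] that 2 by (auto simp: coface_apply)
    have top: "\<sigma>' (Suc m) = \<sigma> (Suc m)" using z'(1)[of m] c(3) c'(3) 2 by simp
    have first: "i < (if a < i then a else Suc a) \<longleftrightarrow> i' < ?f a" if "a \<le> m" for a
      using cell_first[OF B, of "if a < i then a else Suc a"] cell_first[OF B', of "?f a"] z'(1)[OF that] that top 2 by auto
    have ii: "i' = i" using first[of i'] first[of i] c(3) c'(3) 2 by (auto split: if_splits)
    have other: "\<sigma>' a = \<sigma> a \<and> w' a = w a" if "a \<le> Suc m" "a \<noteq> i" for a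
      using z'[of a] z'[of "a - 1"] that ii iSm by (cases "a < i"; cases a) auto
    have "\<sigma>' i = \<sigma> i \<and> w' i = w i"
      using other[of "Suc i"] c(3,7,8) c'(7,8) top ii 2 by auto
    with other have all: "\<sigma>' a = \<sigma> a \<and> w' a = w a" if "a \<le> Suc m" for a using that by (cases "a = i") auto
    have "\<sigma>' = \<sigma>" by (rule nerve_eqI[of \<sigma>' A string_incl "Suc m" \<sigma> A string_incl]) (use c(1) c'(1) 2 all in auto)
    moreover have "w' = w" by (rule delta_hom_eqI[of w' "Suc m" n w n]) (use c(2) c'(2) 2 all in auto)
    ultimately show ?thesis using 2 by simp
  qed
qed

section \<open>The extension, and the lift it defines\<close>

lemma extension_exists:
  obtains f where "f \<in> sset_hom Z C" "\<And>k z. z \<in> Simp Z k \<Longrightarrow> q k (f k z) = pZ k z"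
    "\<And>k z c. (k, z, c) \<in> start \<Longrightarrow> f k z = c"
    "\<And>z. z \<in> Simp Z 1 \<Longrightarrow> z \<in> edges \<Longrightarrow> f 1 z \<in> Collect (lc_edge C S q)"
proof -
  interpret cell_extension Z S pZ C q start cells
    "inv_image (less_than <*lex*> less_than <*lex*> less_than) rank" edges "Collect (lc_edge C S q)"
  proof (intro cell_extension.intro cell_extension_axioms.intro)
    show "sset_over Z S pZ" "sset_over C S q" by (rule Z_over, rule C.sset_over_axioms)
    show "inner_fibration C S q" using lcf by (simp add: locally_cocartesian_fibration_def)
    show "partial_map Z pZ C q start" by (rule start_map)
    show "wf (inv_image (less_than <*lex*> less_than <*lex*> less_than) rank)" by auto
    show "lc_edge C S q c" if "c \<in> Collect (lc_edge C S q)" for c using that by simp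
    show "c \<in> Collect (lc_edge C S q)" if s: "(1, z, c) \<in> start" and e: "z \<in> edges" for z c
    proof -
      obtain \<sigma> \<alpha> where z: "z = (\<sigma>, \<alpha>)" by (cases z)
      have zZ: "\<sigma> \<in> Simp X 1" "\<alpha> \<in> delta_hom 1 n" using partial_mapD(1)[OF start_map s] z by auto
      have \<alpha>: "\<alpha> = (\<lambda>_\<in>{..1}. \<alpha> 0)"
        by (rule extensionalityI[OF delta_hom_ext[OF zZ(2)]]) (use e z in \<open>auto simp: edges_def One_nat_def le_Suc_eq\<close>)
      have "lc_edge X S p \<sigma>" using e z zZ(1) by (auto simp: edges_def lc_edge_sd_iff)
      then show ?thesis using start_marked[of \<sigma> "\<alpha> 0" c] s z \<alpha> delta_hom_le[OF zZ(2), of 0] by simp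
    qed
  next
    fix m x i assume B': "(m, x, i) \<in> cells"
    obtain \<sigma> w where x: "x = (\<sigma>, w)" by (cases x)
    have B: "(m, (\<sigma>, w), i) \<in> cells" using B' x by simp
    note c = cellsD[OF B]
    show "x \<in> Simp Z (Suc m)" using c(1,2) x by simp
    show "i \<le> m" by (rule c(3))
    show "\<alpha> = \<beta>" if \<alpha>: "\<alpha> \<in> delta_hom l (Suc m)" and \<beta>: "\<beta> \<in> delta_hom l (Suc m)"
      and eq: "Act Z l (Suc m) \<alpha> x = Act Z l (Suc m) \<beta> x" for l \<alpha> \<beta>
    proof (rule delta_hom_eqI[OF \<alpha> \<beta>])
      fix a assume a: "a \<le> l"
      have *: "compose {..l} \<sigma> \<alpha> = compose {..l} \<sigma> \<beta>" "compose {..l} w \<alpha> = compose {..l} w \<beta>" using eq x by auto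
      have "\<sigma> (\<alpha> a) = \<sigma> (\<beta> a)" "w (\<alpha> a) = w (\<beta> a)"
        using fun_cong[OF *(1), of a] fun_cong[OF *(2), of a] a by (auto simp: compose_def)
      then show "\<alpha> a = \<beta> a" using cell_distinct[OF B] delta_hom_le[OF \<alpha> a] delta_hom_le[OF \<beta> a] by blast
    qed
    show "(m, Act Z m (Suc m) (coface m i) x) \<notin> gdom start" using cell_missing[OF B] x by simp
    show "(m, Act Z m (Suc m) (coface m j) x) \<in> gdom start \<or>
      (\<exists>m' x' i'. (m', x', i') \<in> cells \<and>
         ((m', x', i'), (m, x, i)) \<in> inv_image (less_than <*lex*> less_than <*lex*> less_than) rank \<and>
         (\<exists>\<beta>\<in>delta_hom m (Suc m'). Act Z m (Suc m) (coface m j) x = Act Z m (Suc m') \<beta> x'))"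
      if "j \<le> Suc m" "j \<noteq> i" for j
      using cell_faces[OF B that] x by (simp add: in_inv_image)
    show "m' = m \<and> x' = x" if "(m', x', i') \<in> cells" "\<alpha> \<in> delta_hom m' (Suc m)"
      "\<alpha> \<notin> Simp (horn (Suc m) i) m'" "Act Z m' (Suc m') (coface m' i') x' = Act Z m' (Suc m) \<alpha> x" for m' x' i' \<alpha>
      using cell_separate[OF B, of m' "fst x'" "snd x'" i' \<alpha>] that x by (auto simp: prod_eq_iff)
    show "m = 0 \<and> \<alpha> = delta_id 1" if \<alpha>: "\<alpha> \<in> delta_hom 1 (Suc m)" "\<alpha> \<notin> Simp (horn (Suc m) i) 1"
      and e: "Act Z 1 (Suc m) \<alpha> x \<in> edges" for \<alpha>
    proof -
      obtain b where ea: "w (\<alpha> 0) = w (\<alpha> 1)" "\<sigma> (\<alpha> 1) = \<sigma> (\<alpha> 0) @ [b]"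
        using e x by (auto simp: edges_def compose_def)
      have "\<alpha> 0 \<noteq> \<alpha> 1" using ea(2) by auto
      then have inj: "inj_on \<alpha> {..1}" by (auto simp: inj_on_def le_Suc_eq One_nat_def)
      have iSm: "i \<le> Suc m" using c(3) by simp
      from \<alpha> iSm inj show ?thesis
      proof (cases rule: nonhorn_injective)
        case 1
        then show ?thesis by (simp add: One_nat_def)
      next
        case 2
        \<comment> \<open>The missing face of a triangle ends at the top string. If it were marked,
          it would append the top element to the string at \<open>0\<close>, so that the deleted
          vertex \<open>1\<close> would coincide with the vertex \<open>0\<close>.\<close>
        have top: "\<alpha> 1 = Suc m" using 2 c(3) by (simp add: coface_def)
        have b: "b = last (\<sigma> (Suc m))" using ea(2) top by simp
        have tA: "\<sigma> (\<alpha> 1) \<in> A" using XD(1)[OF c(1)] top by simp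
        have nin: "b \<notin> set (\<sigma> (\<alpha> 0))" using last_notin_butlast[OF tA] ea(2) by simp
        have "\<not> i < \<alpha> 0" using nin cell_first[OF B, of "\<alpha> 0"] delta_hom_le[OF \<alpha>(1), of 0] b by simp
        then have i1: "i = 1" "\<alpha> 0 = 0" using 2 c(3) by (auto simp: coface_def One_nat_def split: if_splits)
        have t2: "\<alpha> 1 = Suc i" using top i1 2 by simp
        have "\<sigma> i = \<sigma> 0" using c(7) ea(2) b i1 unfolding t2 by simp
        moreover have "w i = w 0" using c(8) ea(1) i1 unfolding t2 by simp
        ultimately show ?thesis using cell_distinct[OF B, of i 0] i1 c(3) by simp
      qed
    qed
  next
    fix k z assume zZ: "z \<in> Simp Z k"
    obtain \<sigma> w where z: "z = (\<sigma>, w)" by (cases z)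
    have \<sigma>: "\<sigma> \<in> Simp X k" and w: "w \<in> delta_hom k n" using zZ z by auto
    let ?goal = "(k, z) \<in> gdom start \<or>
      (\<exists>m x i. (m, x, i) \<in> cells \<and> (\<exists>\<alpha>\<in>delta_hom k (Suc m). z = Act Z k (Suc m) \<alpha> x)) \<or>
      (\<exists>l<k. \<exists>y\<in>Simp Z l. \<exists>\<alpha>\<in>delta_hom k l. z = Act Z k l \<alpha> y)"
    show ?goal
    proof (cases "\<exists>j<k. (\<sigma> j, w j) = (\<sigma> (Suc j), w (Suc j))")
      case True
      then obtain j where j: "j < k" "\<sigma> j = \<sigma> (Suc j)" "w j = w (Suc j)" by auto
      then obtain l where l: "k = Suc l" by (cases k) auto
      have y: "Act Z l k (coface l j) z \<in> Simp Z l" using l by (intro Act_in[OF _ _ zZ]) auto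
      have "z = Act Z k l (codegeneracy l j) (Act Z l k (coface l j) z)"
        using degenerate_factor[of \<sigma> l j] degenerate_factor[of w l j] nerveD(3)[OF \<sigma>] delta_hom_ext[OF w] j l z by simp
      moreover have "codegeneracy l j \<in> delta_hom k l" using j l by auto
      ultimately show ?goal using l y by blast
    next
      case False
      then have ne: "\<forall>j<k. (\<sigma> j, w j) \<noteq> (\<sigma> (Suc j), w (Suc j))" by blast
      show ?goal
      proof (cases "(k, (\<sigma>, w)) \<in> gdom start")
        case False
        show ?goal
        proof (rule classify[OF \<sigma> w ne False], goal_cases)
          case (1 l i)
          have "z = Act Z k k (delta_id k) z" using Act_id[of Z z k] zZ by simp
          then show ?goal using 1 z by (metis delta_id_in)
        next
          case (2 \<sigma>' w' i)
          then have "z = Act Z k (Suc k) (coface k i) (\<sigma>', w')" using z by simp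
          then show ?goal using 2(1) coface_in by blast
        qed
      qed (use z in simp)
    qed
  next
    fix m x assume B': "(m, x, 0) \<in> cells"
    obtain \<sigma> w where x: "x = (\<sigma>, w)" by (cases x)
    have B: "(m, (\<sigma>, w), 0) \<in> cells" using B' x by simp
    note c = cellsD[OF B]
    have e: "delta_id 1 \<in> delta_hom 1 (Suc m)" by (rule initial_edge_in) simp
    show "Act Z 1 (Suc m) (delta_id 1) x \<in> edges"
      using c(7,8) x by (auto simp: edges_def compose_def One_nat_def)
    have eX: "compose {..1} \<sigma> (delta_id 1) \<in> Simp X 1" using Act_in[OF simplicial_nerve e c(1)] by simp
    \<comment> \<open>As the index is \<open>0\<close>, all strings from position \<open>1\<close>
      on contain the last element of the top string and hence have the same maximum.\<close>
    have lm: "last (\<sigma> a) = last (\<sigma> (min a 1))" if a: "a \<le> Suc m" for a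
    proof (cases "a = 0")
      case False
      have l: "last (\<sigma> b) = last (\<sigma> (Suc m))" if "0 < b" "b \<le> Suc m" for b
        using subseq_last[OF XD(1)[OF c(1) that(2)] XD(1)[OF c(1) order_refl] XD(2)[OF c(1) that(2) order_refl]]
          cell_first[OF B that(2)] that(1) by simp
      have "min a 1 = 1" using False by (simp add: min_def One_nat_def)
      then show ?thesis using l[of a] l[of 1] False a by simp
    qed simp
    have "p (Suc m) \<sigma> = compose {..Suc m} (p 1 (compose {..1} \<sigma> (delta_id 1))) (collapse (Suc m))"
      unfolding p_apply[OF c(1)] p_apply[OF eX]
    proof
      fix a show "compose {..Suc m} last \<sigma> a =
          compose {..Suc m} (compose {..1} last (compose {..1} \<sigma> (delta_id 1))) (collapse (Suc m)) a"
        using lm[of a] by (simp add: compose_def collapse_def)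
    qed
    then show "pZ (Suc m) x = Act S (Suc m) 1 (collapse (Suc m)) (pZ 1 (Act Z 1 (Suc m) (delta_id 1) x))"
      using pZ_apply[OF c(1,2)] pZ_apply[OF eX delta_compose[OF c(2) e]] x by simp
  next
    fix x y assume B: "(0, x, 0) \<in> cells" and y: "y \<in> Simp C 0" "q 0 y = vertex S 1 0 (pZ 1 x)"
    have "x \<in> Simp Z 1" using B by (cases x) (auto simp: cells_def One_nat_def)
    then have px: "pZ 1 x \<in> Simp S 1" using sset_hom_in[OF sset_over.p[OF Z_over]] by blast
    \<comment> \<open>A one-dimensional cell is attached along its source, so its value is provided
      by the locally cocartesian lifts in \<open>C\<close>.\<close>
    show "\<exists>c\<in>Collect (lc_edge C S q). q 1 c = pZ 1 x \<and> vertex C 1 0 c = y"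
      by (rule C.lc_fibration_lift[OF lcf px y]) auto
  qed
  show thesis by (rule extension) (rule that)
qed

text \<open>Besides restricting correctly, \<open>f\<close> has to preserve locally cocartesian
  edges. Appending edges are marked. Identities over \<open>P0\<close> are covered by
  \<open>start_marked\<close>, and the others by \<open>lc_edge_degenerate_target\<close>.\<close>

lemma solution: "has_solution (boundary n) (std_simplex n) D D' \<rho> u v"
proof -
  obtain f where f: "f \<in> sset_hom Z C" "\<And>k z. z \<in> Simp Z k \<Longrightarrow> q k (f k z) = pZ k z"
    "\<And>k z c. (k, z, c) \<in> start \<Longrightarrow> f k z = c"
    "\<And>z. z \<in> Simp Z 1 \<Longrightarrow> z \<in> edges \<Longrightarrow> f 1 z \<in> Collect (lc_edge C S q)"
    by (rule extension_exists) (rule that)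
  have fF: "f \<in> Simp (Fun_over X p C q) n"
    unfolding Simp_Fun_over using f(1,2) by (simp add: pZ_apply)
  have "lc_edge C S q (f 1 (e, \<lambda>_\<in>{..1}. i))" if i: "i \<le> n" and e: "lc_edge X S p e" for i e
  proof -
    let ?a = "\<lambda>_\<in>{..1::nat}. i"
    have a: "?a \<in> delta_hom 1 n" using i by auto
    have eX: "e \<in> Simp X 1" using lc_edge_in[OF e] .
    show ?thesis
    proof (cases "e 1 = e 0")
      case False
      then have "e 1 = e 0 @ [last (e 1)]" using lc_edge_sd_imp[OF e] by simp
      then have "(e, ?a) \<in> edges" unfolding edges_def by auto
      then show ?thesis using f(4)[of "(e, ?a)"] eX a by simp
    next
      case e01: True
      show ?thesis
      proof (cases "last (e 1) \<in> P0")
        case True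
        then have "e \<in> Simp Y 1" using eX Y_iff by simp
        then have s: "(1, (e, ?a), fst (V 1 (e, ?a))) \<in> start" using a unfolding start_def by blast
        show ?thesis using start_marked[OF s i e] f(3)[OF s] by simp
      next
        case False
        \<comment> \<open>A marked edge that ends at the string whose identity is considered; its
          source is in \<open>A\<close> because the last element is outside
          \<open>P0\<close>.\<close>
        let ?t = "\<lambda>j\<in>{..1::nat}. if j = 0 then butlast (e 1) else e 1"
        have e1: "e 1 \<in> A" using XD(1)[OF eX] by simp
        have sp: "e 1 = butlast (e 1) @ [last (e 1)]" using A_D(1)[OF e1] by simp
        have bl: "subseq (butlast (e 1)) (e 1)" using sp subseq_rev_drop_many[OF subseq_order.order_refl] by metis
        have tX: "?t \<in> Simp X 1"
          by (rule nerveI) (use butlast_in[OF e1 False] e1 bl in \<open>auto simp: string_incl_def\<close>)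
        have "(?t, ?a) \<in> edges" unfolding edges_def using sp by auto
        then have k: "lc_edge C S q (f 1 (?t, ?a))" using f(4)[of "(?t, ?a)"] tX a by simp
        have fC: "f 1 (?t, ?a) \<in> Simp C 1" using lc_edge_in[OF k] .
        let ?o = "\<lambda>_\<in>{..1::nat}. 0::nat" and ?l = "\<lambda>_\<in>{..0::nat}. 1::nat"
        have ol: "?o \<in> delta_hom 1 0" "?l \<in> delta_hom 0 1" by auto
        have one: "(\<lambda>_\<in>{..1::nat}. 1) \<in> delta_hom 1 1" by auto
        have "Act C 1 0 ?o (vertex C 1 1 (f 1 (?t, ?a))) = Act C 1 1 (compose {..1} ?l ?o) (f 1 (?t, ?a))"
          unfolding vertex_def by (rule Act_comp[OF C.X ol fC])
        also have "\<dots> = f 1 (Act X 1 1 (\<lambda>_\<in>{..1}. 1) ?t, compose {..1} ?a (\<lambda>_\<in>{..1}. 1))"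
          unfolding compose_const[OF ol(1)] by (rule Fun_over_nat[OF fF one tX a, symmetric])
        also have "compose {..1} ?a (\<lambda>_\<in>{..1}. 1) = ?a" by (rule compose_const[OF one])
        also have "Act X 1 1 (\<lambda>_\<in>{..1}. 1) ?t = e"
          by (rule extensionalityI[OF _ nerveD(3)[OF eX]]) (use e01 in \<open>auto simp: compose_def One_nat_def le_Suc_eq\<close>)
        finally have "Act C 1 0 ?o (vertex C 1 1 (f 1 (?t, ?a))) = f 1 (e, ?a)" .
        moreover have "inner_fibration C S q" using lcf by (simp add: locally_cocartesian_fibration_def)
        ultimately show ?thesis using C.lc_edge_degenerate_target[OF _ k] by simp
      qed
    qed
  qed
  then have fD: "f \<in> Simp D n" using fF Simp_D by blast
  have simp: "simplicial_set D" "simplicial_set D'" by (auto intro: simplicial_Fun_cocart)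
  have bnd: "f k (\<sigma>, \<alpha>) = u k \<alpha> k (\<sigma>, delta_id k)" if "\<sigma> \<in> Simp X k" "\<alpha> \<in> Simp (boundary n) k" for k \<sigma> \<alpha>
    by (rule f(3)) (use that in \<open>auto simp: start_def\<close>)
  show ?thesis
  proof (rule solutionI[OF simp(1) \<rho>_hom v fD])
    show "\<rho> n f = v n (delta_id n)"
      unfolding V_def[symmetric]
    proof (rule Fun_over_eqI[OF _ V_F])
      show "\<rho> n f \<in> Simp (Fun_over Y pY C'.C' C'.q') n" using \<rho>_in[OF fD] Simp_D' by blast
      fix k y \<alpha> assume y: "y \<in> Simp Y k" and \<alpha>: "\<alpha> \<in> delta_hom k n"
      have "f k (y, \<alpha>) = fst (V k (y, \<alpha>))" by (rule f(3)) (use y \<alpha> in \<open>auto simp: start_def\<close>)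
      then show "\<rho> n f k (y, \<alpha>) = V k (y, \<alpha>)"
        unfolding \<rho>_apply[OF fD y \<alpha>] using snd_V[OF y \<alpha>] by (simp add: prod_eq_iff)
    qed
    fix m \<alpha> assume \<alpha>: "\<alpha> \<in> Simp (boundary n) m"
    have \<alpha>d: "\<alpha> \<in> delta_hom m n" by (rule boundary_delta[OF \<alpha>])
    have "Act D m n \<alpha> f = u m \<alpha>"
    proof (rule Fun_over_eqI[OF _ uF[OF \<alpha>]])
      show "Act D m n \<alpha> f \<in> Simp (Fun_over X p C q) m" using Act_in[OF simp(1) \<alpha>d fD] Simp_D by blast
      fix k x \<beta> assume x: "x \<in> Simp X k" and \<beta>: "\<beta> \<in> delta_hom k m"
      have "Act D m n \<alpha> f k (x, \<beta>) = f k (x, compose {..k} \<alpha> \<beta>)"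
        using Act_Fun_over_apply[OF x \<beta>, of p C q n \<alpha> f] by simp
      also have "\<dots> = u k (compose {..k} \<alpha> \<beta>) k (x, delta_id k)" by (rule bnd[OF x boundary_compose[OF \<alpha> \<beta>]])
      also have "\<dots> = u m \<alpha> k (x, \<beta>)" using u_Act[OF \<alpha> \<beta> x delta_id_in] \<beta> by simp
      finally show "Act D m n \<alpha> f k (x, \<beta>) = u m \<alpha> k (x, \<beta>)" .
    qed
    then show "\<alpha> \<in> delta_hom m n \<and> Act D m n \<alpha> f = u m \<alpha>" using \<alpha>d by simp
  qed
qed

end

lemma (in sieve_restriction) trivial_fibration_restriction:
  assumes "locally_cocartesian_fibration C S q"
  shows "trivial_fibration D D' \<rho>"
  unfolding trivial_fibration_def
proof (intro conjI allI impI)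
  show "simplicial_set D" "simplicial_set D'" by (auto intro: simplicial_Fun_cocart)
  show "\<rho> \<in> sset_hom D D'" by (rule \<rho>_hom)
  fix n u v assume L: "lifting_problem (boundary n) (std_simplex n) D D' \<rho> u v"
  interpret sieve_lifting P P0 r C q n u v
    by unfold_locales (use L assms in \<open>auto simp: lifting_problem_def\<close>)
  show "has_solution (boundary n) (std_simplex n) D D' \<rho> u v" by (rule solution)
qed

theorem theorem1p5:
  fixes P P0 :: "'p set" and r :: "'p rel"
  assumes "partial_order_on P r"
    and "sieve P r P0"
  shows "locally_cocartesian_fibration (sd (strings_from P r P0)) (nerve P r)
           (sd_max (strings_from P r P0)) \<and>
         (\<forall>(C :: 'c sset) q. locally_cocartesian_fibration C (nerve P r) q \<longrightarrow>
            trivial_fibration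
              (Fun_cocart (nerve P r)
                 (sd (strings_from P r P0)) (sd_max (strings_from P r P0)) C q)
              (Fun_cocart (nerve P0 r)
                 (sd (strings P0 r)) (sd_max (strings P0 r))
                 (restrict_base C q (nerve P0 r)) (restrict_base_proj C q (nerve P0 r)))
              (restriction_functor
                 (Fun_cocart (nerve P r)
                    (sd (strings_from P r P0)) (sd_max (strings_from P r P0)) C q)
                 (sd (strings P0 r)) (sd_max (strings P0 r))))"
proof (intro conjI allI impI)
  interpret poset_strings P P0 r
    using assms by unfold_locales (auto simp: order_on_defs refl_on_def sieve_def)
  show "locally_cocartesian_fibration X S p" by (rule locally_cocartesian_sd)
  fix C :: "'c sset" and q assume C: "locally_cocartesian_fibration C S q"
  interpret sieve_restriction P P0 r C q
  proof unfold_locales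
    show "simplicial_set C" "simplicial_set S" "q \<in> sset_hom C S"
      using C by (auto simp: locally_cocartesian_fibration_def inner_fibration_def)
    show "a \<in> P0" if "b \<in> P0" "a \<in> P" "(a, b) \<in> r" for a b
      using that assms(2) by (auto simp: sieve_def)
  qed
  show "trivial_fibration D D' \<rho>" by (rule trivial_fibration_restriction[OF C])
qed

end
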